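(* Let $H\colon\mathbb{R}^3\to\mathbb{R}$ be a $C^1$ mapping such that, for some $A\in C^1(\mathbb{S}^2)$, $\beta>0$ and $\nu>0$, $$H(X)=1+\frac{A(X/|X|)}{|X|^{\beta}}+O\left(\frac{1}{|X|^{\beta+\nu}}\right)\quad\text{as }|X|\to\infty,\ X\in\mathbb{R}^3 .$$ Assume in addition that $A(\mathbf{e}_2)\neq 0$ and $\limsup_{|X|\to\infty}|X|^{\beta+1}|\nabla H(X)|<\infty$. Then there cannot exist $\alpha\in(0,1]$ and sequences $(a_k)_k\subset\mathbb{R}\setminus\{0\}$, $(n_k)_k\subset\mathbb{N}$ and $(\varphi_k)_k\subset C^{2,\alpha}(\mathbb{R}^2)$ such that: (i) $a_k\to 0$ and $n_k\to\infty$ as $k\to\infty$; (ii) $\varphi_k=\varphi_k(t,\theta)$ is doubly periodic, of period $2n_k\tau_{a_k}$ with respect to $t$ and of period $2\pi$ with respect to $\theta$, and satisfies $$\|\varphi_k\|_{C^2(K_{n_k,a_k};x_{a_k}^{-1})}\le\frac{R}{n_k^{\beta}},\qquad [D^2\varphi_k]_{\alpha,K_{n_k,a_k}}\le\frac{R}{n_k^{\beta}}$$ for some constant $R>0$ independent of $k$; (iii) the surface parameterized by $X_{n_k,a_k}+\varphi_kN_{n_k,a_k}$ has mean curvature $H(X_{n_k,a_k}+\varphi_kN_{n_k,a_k})$ (at every point).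
   Context: $\mathbf{e}_1,\mathbf{e}_2,\mathbf{e}_3$ is the canonical basis of $\mathbb{R}^3$. Delaunay functions. For $a\in[-\frac12,\infty)\setminus\{0\}$ let $\gamma_a=a(1+a)$ and let $x_a,z_a\colon\mathbb{R}\to\mathbb{R}$ solve $$x_a''=(1+2\gamma_a)x_a-2x_a^3,\ x_a(0)=1+a,\ x_a'(0)=0;\qquad z_a'=x_a^2-\gamma_a,\ z_a(0)=0.$$ The function $x_a$ is positive and even, with $|a|\le x_a\le 1+a$, and periodic; $2\tau_a>0$ denotes its (minimal, for $a>-\frac12$) period, and $h_a>0$ is the number such that $z_a(t+2\tau_a)=2h_a+z_a(t)$ for all $t$ (for $a=-\frac12$, where $x_a\equiv\frac12$, one sets $\tau_a=\pi$, $h_a=\frac{\pi}{2}$). These objects are defined only for $a\ge-\frac12$, so the $a_k$ are understood to lie in $[-\frac12,\infty)\setminus\{0\}$. Delaunay tori. For $n\in\mathbb{N}$ (sufficiently large) set $$X_{n,a}(t,\theta)=\begin{pmatrix}x_a(t)\cos\theta\\ \left(\frac{nh_a}{\pi}+x_a(t)\sin\theta\right)\cos\frac{\pi z_a(t)}{nh_a}\\ \left(\frac{nh_a}{\pi}+x_a(t)\sin\theta\right)\sin\frac{\pi z_a(t)}{nh_a}\end{pmatrix},\qquad N_{n,a}=\frac{\partial_tX_{n,a}\wedge\partial_\theta X_{n,a}}{|\partial_tX_{n,a}\wedge\partial_\theta X_{n,a}|},$$ and $K_{n,a}=[-n\tau_a,n\tau_a]\times[-\pi,\pi]$. Here $\wedge$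 is the cross product in $\mathbb{R}^3$. Norms. $\|\varphi\|_{C^2(K_{n,a};x_a^{-1})}=\sup_{(t,\theta)\in K_{n,a}}x_a(t)^{-1}\left(|\varphi|+|\nabla\varphi|+|D^2\varphi|\right)(t,\theta)$, where $|\cdot|$ is the Euclidean norm of vectors and matrices (for the Hessian $D^2\varphi$: square root of the sum of the squared entries). $[F]_{\alpha,K}$ is the Hölder constant of $F$ on $K$ with exponent $\alpha$. Mean curvature. For a regular parametric surface $X=X(t,\theta)$ with normal $N=\frac{X_t\wedge X_\theta}{|X_t\wedge X_\theta|}$, the mean curvature is $\mathfrak{M}(X)=\frac{\mathcal{E}\mathcal{N}-2\mathcal{F}\mathcal{M}+\mathcal{G}\mathcal{L}}{2(\mathcal{E}\mathcal{G}-\mathcal{F}^2)}$ with $\mathcal{E}=|X_t|^2$, $\mathcal{F}=X_t\cdot X_\theta$, $\mathcal{G}=|X_\theta|^2$, $\mathcal{L}=X_{tt}\cdot N$, $\mathcal{M}=X_{t\theta}\cdot N$, $\mathcal{N}=X_{\theta\theta}\cdot N$. *)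

theory Defs
  imports "HOL-Analysis.Analysis" "HOL-Library.Landau_Symbols"
begin

section \<open>Differentiability classes\<close>

definition grad :: "('a::real_inner \<Rightarrow> real) \<Rightarrow> 'a \<Rightarrow> 'a" where
  "grad f x = (THE D. GDERIV f x :> D)"

definition C1_on :: "'a::real_inner set \<Rightarrow> ('a \<Rightarrow> real) \<Rightarrow> bool" where
  "C1_on U f \<longleftrightarrow> (\<forall>x\<in>U. \<exists>D. GDERIV f x :> D) \<and> continuous_on U (grad f)"

text \<open>A function is of class $C^1$ on the unit sphere if it is the restriction of a $C^1$ function
  defined on an open neighbourhood of the sphere. Values of \<open>A\<close> off the sphere are irrelevant.\<close>

definition C1_on_unit_sphere :: "(real^3 \<Rightarrow> real) \<Rightarrow> bool" where
  "C1_on_unit_sphere A \<longleftrightarrow>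
     (\<exists>U g. open U \<and> sphere 0 1 \<subseteq> U \<and> C1_on U g \<and> (\<forall>x\<in>sphere 0 1. g x = A x))"

definition d_t :: "(real \<times> real \<Rightarrow> 'a::real_normed_vector) \<Rightarrow> real \<times> real \<Rightarrow> 'a" where
  "d_t f = (\<lambda>(t, \<theta>). vector_derivative (\<lambda>s. f (s, \<theta>)) (at t))"

definition d_\<theta> :: "(real \<times> real \<Rightarrow> 'a::real_normed_vector) \<Rightarrow> real \<times> real \<Rightarrow> 'a" where
  "d_\<theta> f = (\<lambda>(t, \<theta>). vector_derivative (\<lambda>s. f (t, s)) (at \<theta>))"

definition C1_plane :: "(real \<times> real \<Rightarrow> 'a::real_normed_vector) \<Rightarrow> bool" where
  "C1_plane f \<longleftrightarrow>
     (\<forall>t \<theta>. (\<lambda>s. f (s, \<theta>)) differentiable (at t) \<and> (\<lambda>s. f (t, s)) differentiable (at \<theta>)) \<and>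
     continuous_on UNIV (d_t f) \<and> continuous_on UNIV (d_\<theta> f)"

definition C2_plane :: "(real \<times> real \<Rightarrow> 'a::real_normed_vector) \<Rightarrow> bool" where
  "C2_plane f \<longleftrightarrow> C1_plane f \<and> C1_plane (d_t f) \<and> C1_plane (d_\<theta> f)"

definition grad_plane :: "(real \<times> real \<Rightarrow> real) \<Rightarrow> real \<times> real \<Rightarrow> real^2" where
  "grad_plane f p = vector [d_t f p, d_\<theta> f p]"

text \<open>The norm of the type \<^typ>\<open>real^2^2\<close> is the square root of the sum of the squared entries.\<close>

definition hess_plane :: "(real \<times> real \<Rightarrow> real) \<Rightarrow> real \<times> real \<Rightarrow> real^2^2" where
  "hess_plane f p =
     vector [vector [d_t (d_t f) p, d_\<theta> (d_t f) p], vector [d_t (d_\<theta> f) p, d_\<theta> (d_\<theta> f) p]]"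

definition holder_const ::
    "real \<Rightarrow> 'a::metric_space set \<Rightarrow> ('a \<Rightarrow> 'b::real_normed_vector) \<Rightarrow> ereal" where
  "holder_const \<alpha> K F =
     (SUP (p, q)\<in>{(p, q). p \<in> K \<and> q \<in> K \<and> p \<noteq> q}. ereal (norm (F p - F q) / dist p q powr \<alpha>))"

definition C2_holder_plane :: "real \<Rightarrow> (real \<times> real \<Rightarrow> real) \<Rightarrow> bool" where
  "C2_holder_plane \<alpha> f \<longleftrightarrow> C2_plane f \<and> holder_const \<alpha> UNIV (hess_plane f) < \<infinity>"


section \<open>Delaunay functions\<close>

definition del_\<gamma> :: "real \<Rightarrow> real" where
  "del_\<gamma> a = a * (1 + a)"

definition del_x :: "real \<Rightarrow> real \<Rightarrow> real" where
  "del_x a = (THE x. x 0 = 1 + a \<and>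
     (\<exists>x'. x' 0 = 0 \<and>
       (\<forall>t. (x has_real_derivative x' t) (at t)) \<and>
       (\<forall>t. (x' has_real_derivative ((1 + 2 * del_\<gamma> a) * x t - 2 * x t ^ 3)) (at t))))"

definition del_z :: "real \<Rightarrow> real \<Rightarrow> real" where
  "del_z a = (THE z. z 0 = 0 \<and> (\<forall>t. (z has_real_derivative ((del_x a t)\<^sup>2 - del_\<gamma> a)) (at t)))"

text \<open>For \<open>a = -1/2\<close> the function \<open>x\<^sub>a\<close> is constant and has no minimal period; the values of
  \<open>\<tau>\<^sub>a\<close> and \<open>h\<^sub>a\<close> are then fixed by convention.\<close>

definition del_\<tau> :: "real \<Rightarrow> real" where
  "del_\<tau> a = (if a = - 1/2 then pi
     else (LEAST T. T > 0 \<and> (\<forall>t. del_x a (t + T) = del_x a t)) / 2)"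

definition del_h :: "real \<Rightarrow> real" where
  "del_h a = (if a = - 1/2 then pi / 2
     else (THE h. h > 0 \<and> (\<forall>t. del_z a (t + 2 * del_\<tau> a) = 2 * h + del_z a t)))"


section \<open>Parametric surfaces and Delaunay tori\<close>

definition normal :: "(real \<times> real \<Rightarrow> real^3) \<Rightarrow> real \<times> real \<Rightarrow> real^3" where
  "normal X p = cross3 (d_t X p) (d_\<theta> X p) /\<^sub>R norm (cross3 (d_t X p) (d_\<theta> X p))"

definition mean_curvature :: "(real \<times> real \<Rightarrow> real^3) \<Rightarrow> real \<times> real \<Rightarrow> real" where
  "mean_curvature X p =
    (let E = (norm (d_t X p))\<^sup>2;
         F = d_t X p \<bullet> d_\<theta> X p;
         G = (norm (d_\<theta> X p))\<^sup>2;
         L = d_t (d_t X) p \<bullet> normal X p;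
         M = d_\<theta> (d_t X) p \<bullet> normal X p;
         N = d_\<theta> (d_\<theta> X) p \<bullet> normal X p
     in (E * N - 2 * F * M + G * L) / (2 * (E * G - F\<^sup>2)))"

text \<open>Mean curvature is meaningful only where the parametrization is regular.\<close>

definition has_mean_curvature :: "(real \<times> real \<Rightarrow> real^3) \<Rightarrow> (real^3 \<Rightarrow> real) \<Rightarrow> bool" where
  "has_mean_curvature X H \<longleftrightarrow>
     (\<forall>p. cross3 (d_t X p) (d_\<theta> X p) \<noteq> 0 \<and> mean_curvature X p = H (X p))"

definition torus_X :: "nat \<Rightarrow> real \<Rightarrow> real \<times> real \<Rightarrow> real^3" where
  "torus_X n a = (\<lambda>(t, \<theta>).
     let r = real n * del_h a / pi; \<psi> = pi * del_z a t / (real n * del_h a)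
     in vector [del_x a t * cos \<theta>,
                (r + del_x a t * sin \<theta>) * cos \<psi>,
                (r + del_x a t * sin \<theta>) * sin \<psi>])"

definition torus_N :: "nat \<Rightarrow> real \<Rightarrow> real \<times> real \<Rightarrow> real^3" where
  "torus_N n a = normal (torus_X n a)"

definition torus_K :: "nat \<Rightarrow> real \<Rightarrow> (real \<times> real) set" where
  "torus_K n a = {- real n * del_\<tau> a .. real n * del_\<tau> a} \<times> {- pi .. pi}"

definition weighted_C2_norm :: "nat \<Rightarrow> real \<Rightarrow> (real \<times> real \<Rightarrow> real) \<Rightarrow> ereal" where
  "weighted_C2_norm n a \<phi> =
     (SUP p\<in>torus_K n a.
        ereal ((\<bar>\<phi> p\<bar> + norm (grad_plane \<phi> p) + norm (hess_plane \<phi> p)) / del_x a (fst p)))"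

end

theory Submission
  imports Defs
begin

text \<open>
  As \<open>a \<rightarrow> 0\<close> one period of the Delaunay surface converges, away from its necks, to the unit sphere
  \<open>(sech t cos \<theta>, sech t sin \<theta>, tanh t)\<close>. With \<open>\<epsilon> = \<pi> / (n h)\<close>, the curvature equation for
  \<open>X + \<phi> N\<close> reads, uniformly for \<open>|t| \<le> T\<close> and up to \<open>o(n\<^bsup>-min(1,\<beta>)\<^esup>)\<close>,
  \<open>\<phi>\<^sub>t\<^sub>t + \<phi>\<^sub>\<theta>\<^sub>\<theta> + 2 sech\<^sup>2 t \<phi> + \<epsilon> \<kappa>(t) sin \<theta> = 2 sech\<^sup>2 t (H - 1)\<close>,
  where \<open>\<epsilon> \<kappa>(t) sin \<theta>\<close> comes from bending the Delaunay surface into a torus, with \<open>\<kappa>(0) \<rightarrow> -1\<close>,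
  and \<open>H - 1\<close> is asymptotic to \<open>A(e\<^sub>2) \<epsilon>\<^sup>\<beta>\<close>.
  If \<open>\<beta> > 1\<close>, all terms but the bending term are \<open>o(1/n)\<close>, which is absurd at \<open>(0, \<pi>/2)\<close>.
  If \<open>\<beta> \<le> 1\<close>, integrate over \<open>[-T, T] \<times> [-\<pi>, \<pi>]\<close> against \<open>w = 1 - t tanh t\<close>, which solves
  \<open>w'' + 2 sech\<^sup>2 t w = 0\<close>: the bending term has zero mean in \<open>\<theta>\<close>, the weighted bound on \<open>\<phi>\<close> makes the
  boundary terms \<open>O(n\<^bsup>-\<beta>\<^esup> T sech T)\<close>, and the right-hand side is of exact order \<open>A(e\<^sub>2) n\<^bsup>-\<beta>\<^esup>\<close>.
  Letting \<open>T \<rightarrow> \<infinity>\<close> gives \<open>A(e\<^sub>2) = 0\<close>.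
\<close>

section \<open>Delaunay functions\<close>

text \<open>The order of limits matters: \<open>T\<close> is fixed while \<open>k\<close> tends to
  infinity, and grows only in the final numerical inequality. On a fixed window the Delaunay profile
  stays away from its necks, so \<open>1 / x\<close> is bounded in terms of \<open>T\<close>, and
  asymptotic relations may be crude as long as they are uniform there. Only the boundary terms at
  |t| = T need constants independent of \<open>T\<close>, because \<open>w\<close> is unbounded;
  there the factor \<open>x\<close> of the weighted norm must survive (\<open>f_bounds\<close>).

  The obstacle is algebraic. Square roots enter the curvature through the normal of the torus and
  through that of the perturbed surface. Passing from \<phi> to \<eta> hides the former in the
  unknown, squaring the curvature equation removes the latter, and the linearisation becomes a
  polynomial identity.

  The bending has size 1/n and the perturbation size n^(-\<beta>), two unrelated scales; the
  expansions are made at the coarser one, n^(-min(1, \<beta>)).\<close>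

lemma gronwall_two_sided:
  fixes E E' :: "real \<Rightarrow> real"
  assumes der: "\<And>t. (E has_real_derivative E' t) (at t)"
    and bnd: "\<And>t. \<bar>E' t\<bar> \<le> C * E t + K" and C: "C > 0" and K: "K \<ge> 0"
  shows "E t \<le> (E 0 + K / C) * exp (C * \<bar>t\<bar>)"
proof (cases "t \<ge> 0")
  case True
  define G where "G = (\<lambda>t. (E t + K / C) * exp (- C * t))"
  have "(G has_real_derivative (E' t - C * E t - K) * exp (- C * t)) (at t)" for t
    unfolding G_def using C
    by (auto intro!: derivative_eq_intros der simp: field_simps)
  moreover have "(E' t - C * E t - K) * exp (- C * t) \<le> 0" for t
    using bnd[of t] by (intro mult_nonpos_nonneg) auto
  ultimately have "G t \<le> G 0"
    using True by (intro DERIV_nonpos_imp_nonincreasing[of 0 t G]) blast+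
  then have "E t + K / C \<le> (E 0 + K / C) * exp (C * \<bar>t\<bar>)"
    using True by (simp add: G_def exp_minus field_simps)
  moreover have "K / C \<ge> 0" using C K by simp
  ultimately show ?thesis by linarith
next
  case False
  define G where "G = (\<lambda>t. (E t + K / C) * exp (C * t))"
  have "(G has_real_derivative (E' t + C * E t + K) * exp (C * t)) (at t)" for t
    unfolding G_def using C
    by (auto intro!: derivative_eq_intros der simp: field_simps)
  moreover have "(E' t + C * E t + K) * exp (C * t) \<ge> 0" for t
    using bnd[of t] by (intro mult_nonneg_nonneg) auto
  ultimately have "G t \<le> G 0"
    using False by (intro DERIV_nonneg_imp_nondecreasing[of t 0 G]) (force)+
  then have "E t + K / C \<le> (E 0 + K / C) * exp (C * \<bar>t\<bar>)"
    using False by (simp add: G_def exp_minus field_simps)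
  moreover have "K / C \<ge> 0" using C K by simp
  ultimately show ?thesis by linarith
qed

text \<open>Gronwall for the squared distance in phase space, with the bound \<open>B\<close> on
  both solutions in place of a global Lipschitz condition. Equal parameters and equal data give
  uniqueness, which identifies \<open>del_x\<close>; the choice \<open>g0 = 0\<close> compares
  \<open>del_x\<close> with sech.\<close>

lemma duffing_continuous_dependence:
  fixes u u' v v' :: "real \<Rightarrow> real"
  assumes u: "\<And>t. (u has_real_derivative u' t) (at t)"
      "\<And>t. (u' has_real_derivative ((1 + 2 * g) * u t - 2 * u t ^ 3)) (at t)"
    and v: "\<And>t. (v has_real_derivative v' t) (at t)"
      "\<And>t. (v' has_real_derivative ((1 + 2 * g0) * v t - 2 * v t ^ 3)) (at t)"
    and B: "\<And>t. \<bar>u t\<bar> \<le> B" "\<And>t. \<bar>v t\<bar> \<le> B"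
    and C: "C = 3 + 2 * \<bar>g\<bar> + 6 * B\<^sup>2"
  shows "(u t - v t)\<^sup>2 + (u' t - v' t)\<^sup>2
    \<le> ((u 0 - v 0)\<^sup>2 + (u' 0 - v' 0)\<^sup>2 + 4 * (g - g0)\<^sup>2 * B\<^sup>2 / C) * exp (C * \<bar>t\<bar>)"
proof -
  define E where "E = (\<lambda>t. (u t - v t)\<^sup>2 + (u' t - v' t)\<^sup>2)"
  \<comment> \<open>Since u^3 - v^3 = (u - v)(u^2 + u v + v^2), all of \<open>E'\<close> except the
    term with \<open>g - g0\<close> is a multiple of (u - v)(u' - v'); \<open>m\<close> is half the
    factor.\<close>
  define m where "m = (\<lambda>t. 2 + 2 * g - 2 * ((u t)\<^sup>2 + u t * v t + (v t)\<^sup>2))"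
  define E' where "E' = (\<lambda>t. 2 * (u t - v t) * (u' t - v' t) * m t + 2 * (u' t - v' t) * (2 * (g - g0) * v t))"
  have C0: "C > 0" using C by (simp add: add_pos_nonneg)
  have der: "(E has_real_derivative E' t) (at t)" for t
    unfolding E_def E'_def m_def
    by (auto intro!: derivative_eq_intros u v simp: algebra_simps power2_eq_square power3_eq_cube)
  have bnd: "\<bar>E' t\<bar> \<le> C * E t + 4 * (g - g0)\<^sup>2 * B\<^sup>2" for t
  proof -
    have sq: "(u t)\<^sup>2 \<le> B\<^sup>2" "(v t)\<^sup>2 \<le> B\<^sup>2"
      using B[of t] by (simp_all add: abs_le_square_iff[symmetric] power2_le_iff_abs_le) 
    have "\<bar>u t * v t\<bar> \<le> B * B"
      unfolding abs_mult using B[of t] by (intro mult_mono) auto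
    then have "\<bar>u t * v t\<bar> \<le> B\<^sup>2" by (simp add: power2_eq_square)
    then have "\<bar>m t\<bar> \<le> 2 + 2 * \<bar>g\<bar> + 6 * B\<^sup>2"
      using sq zero_le_power2[of "u t"] zero_le_power2[of "v t"]
      unfolding m_def by (smt (verit))
    \<comment> \<open>The unit kept in reserve in \<open>C\<close> absorbs the
      \<open>q\<^sup>2\<close> that the term with \<open>g - g0\<close> produces below.\<close>
    then have mC: "\<bar>m t\<bar> \<le> C - 1" using C by simp
    define p q where "p = u t - v t" and "q = u' t - v' t"
    have pq: "2 * \<bar>p\<bar> * \<bar>q\<bar> \<le> p\<^sup>2 + q\<^sup>2"
      using sum_squares_bound[of "\<bar>p\<bar>" "\<bar>q\<bar>"] by simp
    have "\<bar>2 * p * q * m t\<bar> = (2 * \<bar>p\<bar> * \<bar>q\<bar>) * \<bar>m t\<bar>" by (simp add: abs_mult)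
    also have "\<dots> \<le> (p\<^sup>2 + q\<^sup>2) * (C - 1)"
      using pq mC by (intro mult_mono) auto
    finally have 1: "\<bar>2 * p * q * m t\<bar> \<le> (p\<^sup>2 + q\<^sup>2) * (C - 1)" .
    have "\<bar>2 * q * (2 * (g - g0) * v t)\<bar> = 2 * \<bar>q\<bar> * \<bar>2 * (g - g0) * v t\<bar>" by (simp add: abs_mult)
    also have "\<dots> \<le> q\<^sup>2 + (2 * (g - g0) * v t)\<^sup>2"
      using sum_squares_bound[of "\<bar>q\<bar>" "\<bar>2 * (g - g0) * v t\<bar>"] by simp
    also have "(2 * (g - g0) * v t)\<^sup>2 = 4 * (g - g0)\<^sup>2 * (v t)\<^sup>2"
      by (simp add: power2_eq_square algebra_simps)
    also have "\<dots> \<le> 4 * (g - g0)\<^sup>2 * B\<^sup>2"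
      using sq by (intro mult_left_mono) auto
    finally have 2: "\<bar>2 * q * (2 * (g - g0) * v t)\<bar> \<le> q\<^sup>2 + 4 * (g - g0)\<^sup>2 * B\<^sup>2" by simp
    have "\<bar>E' t\<bar> \<le> \<bar>2 * p * q * m t\<bar> + \<bar>2 * q * (2 * (g - g0) * v t)\<bar>"
      unfolding E'_def p_def q_def by (rule abs_triangle_ineq)
    also have "\<dots> \<le> (p\<^sup>2 + q\<^sup>2) * (C - 1) + q\<^sup>2 + 4 * (g - g0)\<^sup>2 * B\<^sup>2" using 1 2 by simp
    also have "\<dots> \<le> C * (p\<^sup>2 + q\<^sup>2) + 4 * (g - g0)\<^sup>2 * B\<^sup>2"
      by (simp add: algebra_simps)
    finally show ?thesis by (simp add: E_def p_def q_def)
  qed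
  show ?thesis
    using gronwall_two_sided[OF der bnd C0, of t] by (simp add: E_def)
qed

text \<open>u'^2 - u^2 + (u^2 - g)^2 is a first integral, and the initial condition puts it at level
  zero. For the Delaunay functions this reads x'^2 + z'^2 = x^2: the parametrization is
  conformal.\<close>

lemma duffing_energy:
  fixes u u' :: "real \<Rightarrow> real"
  assumes u: "\<And>t. (u has_real_derivative u' t) (at t)"
      "\<And>t. (u' has_real_derivative ((1 + 2 * g) * u t - 2 * u t ^ 3)) (at t)"
    and "(u' 0)\<^sup>2 = (u 0)\<^sup>2 - ((u 0)\<^sup>2 - g)\<^sup>2"
  shows "(u' t)\<^sup>2 = (u t)\<^sup>2 - ((u t)\<^sup>2 - g)\<^sup>2"
proof -
  define E where "E = (\<lambda>t. (u' t)\<^sup>2 - (u t)\<^sup>2 + ((u t)\<^sup>2 - g)\<^sup>2)"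
  have "(E has_real_derivative 0) (at t)" for t
    unfolding E_def
    by (auto intro!: derivative_eq_intros u simp: algebra_simps power2_eq_square power3_eq_cube)
  then have "E t = E 0" by (intro DERIV_isconst_all) auto
  then show ?thesis using assms(3) by (simp add: E_def)
qed


text \<open>The energy relation forces |p^2 - g| \<le> |p|, and beyond 1 + |g| the quantity p^2 -
  |p| exceeds |g|. This is the a priori bound that makes the comparison lemma applicable to an
  arbitrary solution.\<close>

lemma abs_le_of_energy:
  fixes p q g :: real
  assumes "q\<^sup>2 = p\<^sup>2 - (p\<^sup>2 - g)\<^sup>2"
  shows "\<bar>p\<bar> \<le> 1 + \<bar>g\<bar>"
proof -
  have "(p\<^sup>2 - g)\<^sup>2 \<le> \<bar>p\<bar>\<^sup>2" using assms zero_le_power2[of q] by simp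
  then have "\<bar>p\<^sup>2 - g\<bar> \<le> \<bar>p\<bar>" by (simp add: abs_le_square_iff)
  then have le: "\<bar>p\<bar> * \<bar>p\<bar> \<le> \<bar>p\<bar> + \<bar>g\<bar>" by (simp add: power2_eq_square abs_if split: if_splits)
  show ?thesis
  proof (rule ccontr)
    assume "\<not> ?thesis"
    then have *: "\<bar>p\<bar> > 1 + \<bar>g\<bar>" by simp
    then have "\<bar>p\<bar> * (\<bar>p\<bar> - 1) \<ge> \<bar>p\<bar> * \<bar>g\<bar>" by (intro mult_left_mono) auto
    moreover have "\<bar>p\<bar> * (\<bar>p\<bar> - 1) > 1 * \<bar>g\<bar>" 
    proof (cases "g = 0")
      case True
      then show ?thesis using * by simp
    next
      case False
      have "1 * \<bar>g\<bar> < \<bar>p\<bar> * (\<bar>p\<bar> - 1)"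
        using * False by (intro mult_strict_mono) auto
      then show ?thesis .
    qed
    ultimately show False using le by (simp add: algebra_simps)
  qed
qed

text \<open>The energy relation factors as x'^2 = ((1 + a)^2 - x^2)(x^2 - a^2). Interpolating x^2
  between its extreme values (1 + a)^2 and a^2 by an angle p reduces it to p' = x, which is solved
  by inverting an integral.\<close>

definition del_g :: "real \<Rightarrow> real \<Rightarrow> real" where
  "del_g a p = sqrt ((1 + a)\<^sup>2 * (cos p)\<^sup>2 + a\<^sup>2 * (sin p)\<^sup>2)"

text \<open>The amplitude \<open>del_am a\<close> is the solution of \<open>p' = del_g a p\<close>, \<open>p 0 = 0\<close>; then
  \<open>del_x a\<close> is its derivative, a rescaled Jacobi function dn.\<close>

definition del_G :: "real \<Rightarrow> real \<Rightarrow> real" where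
  "del_G a p = (LBINT s=0..p. 1 / del_g a s)"

definition del_am :: "real \<Rightarrow> real \<Rightarrow> real" where
  "del_am a = inv (del_G a)"

definition del_y :: "real \<Rightarrow> real \<Rightarrow> real" where
  "del_y a t = - (1 + 2 * a) * sin (del_am a t) * cos (del_am a t)"

lemma LBINT_antiderivative:
  fixes f :: "real \<Rightarrow> real"
  assumes "continuous_on UNIV f"
  shows "((\<lambda>u. LBINT s=0..u. f s) has_real_derivative f x) (at x)"
proof -
  define A where "A = \<bar>x\<bar> + 1"
  have "((\<lambda>u. LBINT s=ereal 0..ereal u. f s) has_vector_derivative f x) (at x within {-A..A})"
    by (rule interval_integral_FTC2) (auto simp: A_def intro: continuous_on_subset[OF assms])
  then have "((\<lambda>u. LBINT s=0..u. f s) has_vector_derivative f x) (at x within {-A..A})"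
    by (simp add: zero_ereal_def)
  moreover have "at x within {-A..A} = at x"
    by (rule at_within_interior) (auto simp: A_def)
  ultimately show ?thesis by (simp add: has_real_derivative_iff_has_vector_derivative)
qed

locale del_param =
  fixes a :: real
  assumes a_gt: "a > - 1/2" and a_ne: "a \<noteq> 0"
begin

lemma g_sq: "(del_g a p)\<^sup>2 = a\<^sup>2 + (1 + 2 * a) * (cos p)\<^sup>2"
proof -
  have "(del_g a p)\<^sup>2 = (1 + a)\<^sup>2 * (cos p)\<^sup>2 + a\<^sup>2 * (sin p)\<^sup>2"
    unfolding del_g_def by (simp add: add_nonneg_nonneg)
  also have "\<dots> = a\<^sup>2 + (1 + 2 * a) * (cos p)\<^sup>2"
    unfolding sin_squared_eq by (simp add: algebra_simps power2_eq_square)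
  finally show ?thesis .
qed

lemma g_pos: "del_g a p > 0"
proof -
  have "(del_g a p)\<^sup>2 > 0" unfolding g_sq using a_gt a_ne by (intro add_pos_nonneg) auto
  moreover have "del_g a p \<ge> 0" unfolding del_g_def by (simp add: add_nonneg_nonneg)
  ultimately show ?thesis by (cases "del_g a p = 0") auto
qed

lemma g_ge_abs: "del_g a p \<ge> \<bar>a\<bar>"
proof -
  have "\<bar>a\<bar>\<^sup>2 \<le> (del_g a p)\<^sup>2" unfolding g_sq using a_gt by simp
  from power2_le_imp_le[OF this] show ?thesis using g_pos[of p] by simp
qed

lemma g_le: "del_g a p \<le> 1 + a"
proof -
  have "(cos p)\<^sup>2 \<le> 1" by (simp add: abs_square_le_1)
  then have "(1 + 2 * a) * (cos p)\<^sup>2 \<le> (1 + 2 * a) * 1" using a_gt by (intro mult_left_mono) auto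
  then have "(del_g a p)\<^sup>2 \<le> (1 + a)\<^sup>2"
    unfolding g_sq by (simp add: power2_eq_square algebra_simps)
  from power2_le_imp_le[OF this] show ?thesis using a_gt by simp
qed

lemma g_ge_cos: "del_g a p \<ge> (1 + a) * \<bar>cos p\<bar>"
proof -
  have "((1 + a) * \<bar>cos p\<bar>)\<^sup>2 \<le> (del_g a p)\<^sup>2"
    unfolding del_g_def by (simp add: add_nonneg_nonneg power_mult_distrib)
  from power2_le_imp_le[OF this] show ?thesis using g_pos[of p] by simp
qed

lemma g_add_pi: "del_g a (p + pi) = del_g a p"
  by (simp add: del_g_def)

lemma g_deriv: "(del_g a has_real_derivative (- (1 + 2 * a) * sin p * cos p / del_g a p)) (at p)"
proof -
  have pos: "(1 + a)\<^sup>2 * (cos p)\<^sup>2 + a\<^sup>2 * (sin p)\<^sup>2 > 0"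
    using g_pos[of p] unfolding del_g_def by simp
  define Q where "Q = (\<lambda>p. (1 + a)\<^sup>2 * (cos p)\<^sup>2 + a\<^sup>2 * (sin p)\<^sup>2)"
  have "(Q has_real_derivative (1 + a)\<^sup>2 * (2 * cos p * (- sin p)) + a\<^sup>2 * (2 * sin p * cos p)) (at p)"
    unfolding Q_def by (auto intro!: derivative_eq_intros)
  moreover have "(1 + a)\<^sup>2 * (2 * cos p * (- sin p)) + a\<^sup>2 * (2 * sin p * cos p)
      = 2 * (- (1 + 2 * a) * sin p * cos p)"
    by (simp add: algebra_simps power2_eq_square)
  ultimately have "(Q has_real_derivative 2 * (- (1 + 2 * a) * sin p * cos p)) (at p)" by simp
  then have "((\<lambda>p. sqrt (Q p)) has_real_derivative
      inverse (sqrt (Q p)) / 2 * (2 * (- (1 + 2 * a) * sin p * cos p))) (at p)"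
    using pos by (intro DERIV_chain2[OF DERIV_real_sqrt]) (simp_all add: Q_def)
  then have "((\<lambda>p. sqrt (Q p)) has_real_derivative - (1 + 2 * a) * sin p * cos p / sqrt (Q p)) (at p)"
  proof (rule DERIV_cong)
    have "inverse q / 2 * (2 * r) = r / q" for q r :: real by (simp add: field_simps)
    then show "inverse (sqrt (Q p)) / 2 * (2 * (- (1 + 2 * a) * sin p * cos p))
      = - (1 + 2 * a) * sin p * cos p / sqrt (Q p)" .
  qed
  then show ?thesis unfolding del_g_def[abs_def] Q_def .
qed

lemma continuous_on_inverse_g: "continuous_on UNIV (\<lambda>s. 1 / del_g a s)"
proof -
  have "isCont (\<lambda>s. 1 / del_g a s) s" for s
    using DERIV_isCont[OF g_deriv[of s]] g_pos[of s] by (intro continuous_intros) auto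
  then show ?thesis by (simp add: continuous_at_imp_continuous_on)
qed

lemma G_deriv: "(del_G a has_real_derivative 1 / del_g a p) (at p)"
  unfolding del_G_def[abs_def] by (rule LBINT_antiderivative[OF continuous_on_inverse_g])

lemma G_0 [simp]: "del_G a 0 = 0"
  by (simp add: del_G_def flip: zero_ereal_def)

lemma strict_mono_G: "strict_mono (del_G a)"
proof (rule strict_monoI)
  fix p q :: real assume "p < q"
  then show "del_G a p < del_G a q"
  proof (rule DERIV_pos_imp_increasing)
    fix s
    have "1 / del_g a s > 0" using g_pos[of s] by simp
    then show "\<exists>y. (del_G a has_real_derivative y) (at s) \<and> 0 < y" using G_deriv by blast
  qed
qed

text \<open>The integrand is at least 1/(1 + a) because \<open>del_g\<close> is at most 1 + a. The
  bound makes \<open>del_G\<close> surjective and later bounds the period from below.\<close>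

lemma G_growth: "p \<le> q \<Longrightarrow> del_G a q - del_G a p \<ge> (q - p) / (1 + a)"
proof -
  assume "p \<le> q"
  have "((\<lambda>s. del_G a s - s / (1 + a)) has_real_derivative (1 / del_g a s - 1 / (1 + a))) (at s)" for s
    using a_gt by (auto intro!: derivative_eq_intros G_deriv)
  moreover have "1 / del_g a s - 1 / (1 + a) \<ge> 0" for s
    using g_le[of s] g_pos[of s] by (simp add: frac_le)
  ultimately have "del_G a p - p / (1 + a) \<le> del_G a q - q / (1 + a)"
    using \<open>p \<le> q\<close> by (intro DERIV_nonneg_imp_nondecreasing[where f = "\<lambda>s. del_G a s - s / (1 + a)"]) blast+
  then show ?thesis by (simp add: diff_divide_distrib)
qed

lemma continuous_on_G: "continuous_on S (del_G a)"
  using G_deriv by (meson DERIV_isCont continuous_at_imp_continuous_on)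

lemma bij_G: "bij (del_G a)"
proof -
  have "\<exists>p. del_G a p = t" for t
  proof -
    define b where "b = \<bar>t\<bar> * (1 + a)"
    have b: "b \<ge> 0" "b / (1 + a) = \<bar>t\<bar>" using a_gt by (auto simp: b_def)
    have "del_G a (-b) \<le> t" "t \<le> del_G a b"
      using G_growth[of 0 b] G_growth[of "-b" 0] b by auto
    then show ?thesis using IVT'[of "del_G a" "-b" t b] b continuous_on_G by auto
  qed
  then have "surj (del_G a)" by (metis surj_def)
  then show ?thesis using strict_mono_G by (simp add: bij_def strict_mono_imp_inj_on)
qed

lemma G_am [simp]: "del_G a (del_am a t) = t"
  unfolding del_am_def by (rule surj_f_inv_f[OF bij_is_surj[OF bij_G]])

lemma am_G [simp]: "del_am a (del_G a p) = p"
  unfolding del_am_def by (rule inv_f_f[OF bij_is_inj[OF bij_G]])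

lemma am_0 [simp]: "del_am a 0 = 0"
  using am_G[of 0] by simp

lemma am_less_iff: "del_am a s < del_am a t \<longleftrightarrow> s < t"
  using strict_mono_less[OF strict_mono_G, of "del_am a s" "del_am a t"] by simp

lemma am_deriv: "(del_am a has_real_derivative del_g a (del_am a t)) (at t)"
proof -
  have "isCont (del_am a) (del_G a (del_am a t))"
    by (rule isCont_inverse_function[where d = 1 and f = "del_G a"])
      (auto intro: DERIV_isCont[OF G_deriv])
  then have "(del_am a has_real_derivative inverse (1 / del_g a (del_am a t))) (at t)"
    using g_pos[of "del_am a t"]
    by (intro DERIV_inverse_function[where a = "t - 1" and b = "t + 1", OF G_deriv]) auto
  then show ?thesis by simp
qed

text \<open>The integrand of \<open>del_G\<close> has period \<pi>, so
  \<open>del_G a (p + pi) - del_G a p\<close> is constant in \<open>p\<close>.\<close>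

lemma am_add_period: "del_am a (t + del_G a pi) = del_am a t + pi"
proof -
  have "((\<lambda>p. del_G a (p + pi) - del_G a p) has_real_derivative 0) (at p)" for p
  proof -
    have "((\<lambda>p. del_G a (p + pi)) has_real_derivative 1 / del_g a p) (at p)"
      using DERIV_shift[THEN iffD1, OF G_deriv[of "p + pi"]] unfolding g_add_pi .
    from DERIV_diff[OF this G_deriv] show ?thesis by simp
  qed
  then have "del_G a (del_am a t + pi) - del_G a (del_am a t) = del_G a (0 + pi) - del_G a 0"
    by (intro DERIV_isconst_all[of "\<lambda>p. del_G a (p + pi) - del_G a p"]) blast
  then have "del_G a (del_am a t + pi) = t + del_G a pi" by simp
  then show ?thesis by (metis am_G)
qed

lemma x_ode_aux:
  "((\<lambda>t. del_g a (del_am a t)) has_real_derivative del_y a t) (at t)"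
  "(del_y a has_real_derivative
      ((1 + 2 * del_\<gamma> a) * del_g a (del_am a t) - 2 * del_g a (del_am a t) ^ 3)) (at t)"
proof -
  show "((\<lambda>t. del_g a (del_am a t)) has_real_derivative del_y a t) (at t)"
    using DERIV_chain'[OF am_deriv g_deriv, of t] g_pos[of "del_am a t"]
    by (simp add: del_y_def)
  let ?p = "del_am a t" and ?x = "del_g a (del_am a t)"
  have "(del_y a has_real_derivative - (1 + 2 * a) * ((cos ?p)\<^sup>2 - (sin ?p)\<^sup>2) * ?x) (at t)"
    unfolding del_y_def[abs_def]
    by (auto intro!: derivative_eq_intros am_deriv simp: algebra_simps power2_eq_square)
  also have "- (1 + 2 * a) * ((cos ?p)\<^sup>2 - (sin ?p)\<^sup>2) * ?x = (1 + 2 * del_\<gamma> a - 2 * ?x\<^sup>2) * ?x"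
    unfolding g_sq sin_squared_eq del_\<gamma>_def by (simp add: algebra_simps power2_eq_square)
  also have "\<dots> = (1 + 2 * del_\<gamma> a) * ?x - 2 * ?x ^ 3"
    by (simp add: algebra_simps power2_eq_square power3_eq_cube)
  finally show "(del_y a has_real_derivative
      ((1 + 2 * del_\<gamma> a) * ?x - 2 * ?x ^ 3)) (at t)" .
qed

lemma y_0 [simp]: "del_y a 0 = 0"
  by (simp add: del_y_def)

text \<open>Replaces the definite description by an explicit function. A competing solution has the
  same energy, hence the same a priori bound, and the comparison lemma with equal parameters and
  data leaves no distance between the two.\<close>

lemma x_eq: "del_x a = (\<lambda>t. del_g a (del_am a t))"
  unfolding del_x_def
proof (rule the_equality)
  have g0: "del_g a 0 = 1 + a" using a_gt by (simp add: del_g_def)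
  show "del_g a (del_am a 0) = 1 + a \<and>
    (\<exists>x'. x' 0 = 0 \<and> (\<forall>t. ((\<lambda>t. del_g a (del_am a t)) has_real_derivative x' t) (at t)) \<and>
      (\<forall>t. (x' has_real_derivative
        ((1 + 2 * del_\<gamma> a) * del_g a (del_am a t) - 2 * del_g a (del_am a t) ^ 3)) (at t)))"
    using x_ode_aux g0 by (intro conjI exI[of _ "del_y a"]) auto
  fix u assume "u 0 = 1 + a \<and> (\<exists>u'. u' 0 = 0 \<and> (\<forall>t. (u has_real_derivative u' t) (at t)) \<and>
      (\<forall>t. (u' has_real_derivative ((1 + 2 * del_\<gamma> a) * u t - 2 * u t ^ 3)) (at t)))"
  then obtain u' where u: "u 0 = 1 + a" "u' 0 = 0" "\<And>t. (u has_real_derivative u' t) (at t)"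
    "\<And>t. (u' has_real_derivative ((1 + 2 * del_\<gamma> a) * u t - 2 * u t ^ 3)) (at t)" by blast
  let ?v = "\<lambda>t. del_g a (del_am a t)"
  have init: "0\<^sup>2 = (1 + a)\<^sup>2 - ((1 + a)\<^sup>2 - del_\<gamma> a)\<^sup>2"
    by (simp add: del_\<gamma>_def algebra_simps power2_eq_square)
  define B where "B = 1 + \<bar>del_\<gamma> a\<bar>"
  have "\<bar>u t\<bar> \<le> B" for t
    unfolding B_def by (rule abs_le_of_energy[OF duffing_energy[OF u(3,4)]]) (use init u in simp)
  moreover have "\<bar>?v t\<bar> \<le> B" for t
    unfolding B_def by (rule abs_le_of_energy[OF duffing_energy[OF x_ode_aux]]) (use init g0 in simp)
  ultimately have "(u t - ?v t)\<^sup>2 + (u' t - del_y a t)\<^sup>2 \<le> 0" for t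
    using duffing_continuous_dependence[OF u(3,4) x_ode_aux _ _ refl, of B t] u g0 by simp
  then have "u t = ?v t" for t
    using sum_power2_le_zero_iff[of "u t - ?v t" "u' t - del_y a t"] by simp
  then show "u = ?v" by auto
qed

lemma x_deriv: "(del_x a has_real_derivative del_y a t) (at t)"
  and y_deriv: "(del_y a has_real_derivative ((1 + 2 * del_\<gamma> a) * del_x a t - 2 * del_x a t ^ 3)) (at t)"
  using x_ode_aux unfolding x_eq by auto

lemma x_0: "del_x a 0 = 1 + a"
  using a_gt by (simp add: x_eq del_g_def)

lemma x_pos: "del_x a t > 0"
  unfolding x_eq by (rule g_pos)

lemma x_le: "del_x a t \<le> 1 + a"
  unfolding x_eq by (rule g_le)

lemma energy: "(del_y a t)\<^sup>2 = (del_x a t)\<^sup>2 - ((del_x a t)\<^sup>2 - del_\<gamma> a)\<^sup>2"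
  by (rule duffing_energy[OF x_deriv y_deriv])
    (simp add: x_0 del_\<gamma>_def algebra_simps power2_eq_square)

lemma continuous_on_x: "continuous_on S (del_x a)"
  using x_deriv by (meson DERIV_isCont continuous_at_imp_continuous_on)

lemma continuous_on_y: "continuous_on S (del_y a)"
  using y_deriv by (meson DERIV_isCont continuous_at_imp_continuous_on)

lemma z_ode: "del_z a 0 = 0 \<and> (\<forall>t. (del_z a has_real_derivative ((del_x a t)\<^sup>2 - del_\<gamma> a)) (at t))"
proof -
  let ?w = "\<lambda>t::real. LBINT s=0..ereal t. ((del_x a s)\<^sup>2 - del_\<gamma> a)"
  have w: "(?w has_real_derivative (del_x a t)\<^sup>2 - del_\<gamma> a) (at t)" for t
    by (intro LBINT_antiderivative continuous_intros continuous_on_x)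
  have w0: "?w 0 = 0" by (simp flip: zero_ereal_def)
  have "del_z a = ?w"
    unfolding del_z_def
  proof (rule the_equality)
    show "?w 0 = 0 \<and> (\<forall>t. (?w has_real_derivative (del_x a t)\<^sup>2 - del_\<gamma> a) (at t))"
      using w w0 by blast
    fix z assume z: "z 0 = 0 \<and> (\<forall>t. (z has_real_derivative (del_x a t)\<^sup>2 - del_\<gamma> a) (at t))"
    have "((\<lambda>t. z t - ?w t) has_real_derivative 0) (at t)" for t
      using DERIV_diff[OF z[THEN conjunct2, rule_format] w, of t] by simp
    then have "z t - ?w t = z 0 - ?w 0" for t
      by (intro DERIV_isconst_all[of "\<lambda>t. z t - ?w t"]) blast
    then show "z = ?w" using z w0 by auto
  qed
  then show ?thesis using w w0 by simp
qed

lemma z_0 [simp]: "del_z a 0 = 0"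
  and z_deriv: "(del_z a has_real_derivative ((del_x a t)\<^sup>2 - del_\<gamma> a)) (at t)"
  using z_ode by auto

text \<open>The maximum 1 + a is attained exactly where the amplitude is a multiple of \<pi>. A
  smaller positive period would bring the solution back to its maximum at an amplitude strictly
  between 0 and \<pi>.\<close>

lemma tau_eq: "2 * del_\<tau> a = del_G a pi"
proof -
  have per: "del_x a (t + del_G a pi) = del_x a t" for t
    by (simp add: x_eq am_add_period g_add_pi)
  have pos: "del_G a pi > 0"
    using strict_mono_less[OF strict_mono_G, of 0 pi] by simp
  have "(LEAST T. T > 0 \<and> (\<forall>t. del_x a (t + T) = del_x a t)) = del_G a pi"
  proof (rule Least_equality)
    show "del_G a pi > 0 \<and> (\<forall>t. del_x a (t + del_G a pi) = del_x a t)" using per pos by blast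
    fix T assume T: "T > 0 \<and> (\<forall>t. del_x a (t + T) = del_x a t)"
    show "del_G a pi \<le> T"
    proof (rule ccontr)
      assume "\<not> del_G a pi \<le> T"
      then have "del_am a 0 < del_am a T" "del_am a T < del_am a (del_G a pi)"
        using T unfolding am_less_iff by auto
      then have r: "0 < del_am a T" "del_am a T < pi" by simp_all
      have "del_x a (0 + T) = del_x a 0" using T by blast
      then have "(del_g a (del_am a T))\<^sup>2 = (del_g a 0)\<^sup>2" by (simp add: x_eq)
      then have "(cos (del_am a T))\<^sup>2 = 1" unfolding g_sq using a_gt by simp
      then have "sin (del_am a T) = 0" by (simp add: cos_squared_eq)
      then show False using sin_gt_zero[OF r] by simp
    qed
  qed
  then show ?thesis using a_gt by (simp add: del_\<tau>_def)
qed

lemma z_add_period: "del_z a (t + 2 * del_\<tau> a) = del_z a (2 * del_\<tau> a) + del_z a t"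
proof -
  have per: "del_x a (t + del_G a pi) = del_x a t" for t
    by (simp add: x_eq am_add_period g_add_pi)
  have "((\<lambda>t. del_z a (t + del_G a pi) - del_z a t) has_real_derivative 0) (at t)" for t
  proof -
    have "((\<lambda>t. del_z a (t + del_G a pi)) has_real_derivative (del_x a t)\<^sup>2 - del_\<gamma> a) (at t)"
      using DERIV_shift[THEN iffD1, OF z_deriv[of "t + del_G a pi"]] unfolding per .
    from DERIV_diff[OF this z_deriv] show ?thesis by simp
  qed
  then have "del_z a (t + del_G a pi) - del_z a t = del_z a (0 + del_G a pi) - del_z a 0"
    by (intro DERIV_isconst_all[of "\<lambda>t. del_z a (t + del_G a pi) - del_z a t"]) blast
  then show ?thesis by (simp add: tau_eq)
qed

end

section \<open>Estimates uniform in small Delaunay parameters\<close>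

locale del_small = del_param +
  assumes a_small: "\<bar>a\<bar> \<le> 1/1000"
begin

lemma gamma_over_g: "\<bar>del_\<gamma> a / del_g a p\<bar> \<le> 1 + a"
proof -
  have "\<bar>del_\<gamma> a / del_g a p\<bar> = \<bar>a\<bar> * (1 + a) / del_g a p"
    using a_gt g_pos[of p] by (simp add: del_\<gamma>_def abs_mult)
  also have "\<dots> \<le> del_g a p * (1 + a) / del_g a p"
    using g_ge_abs[of p] a_gt g_pos[of p] by (intro divide_right_mono mult_right_mono) auto
  finally show ?thesis using g_pos[of p] by simp
qed

text \<open>The split isolates the neck, where \<open>cos p\<close> is small: there only the bound 1
  + a is available, elsewhere the quotient is O(|a|). The majorant is a trigonometric polynomial, so
  it has an explicit primitive. The fourth power matters: 11/10 sin^2 has mean 11/20, which already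
  exceeds the mean of the minorant 999/1000 cos^2 of \<open>del_g\<close> with which it is
  compared.\<close>

lemma gamma_over_g_le: "del_\<gamma> a / del_g a p \<le> 12/1000 + 11/10 * (sin p)^4"
proof (cases "\<bar>cos p\<bar> \<ge> 1/10")
  case True
  have "del_\<gamma> a \<le> 1/1000 * (1 + 1/1000)"
  proof -
    have "a * (1 + a) \<le> 1/1000 * (1 + a)" using a_gt a_small by (intro mult_right_mono) auto
    then show ?thesis using a_small by (simp add: del_\<gamma>_def)
  qed
  moreover have "(1 + a) * \<bar>cos p\<bar> \<ge> 999/1000 * (1/10)"
    using True a_small by (intro mult_mono) auto
  then have "del_g a p \<ge> 999/10000" using g_ge_cos[of p] by simp
  ultimately have "del_\<gamma> a \<le> 12/1000 * del_g a p" by simp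
  then have "del_\<gamma> a / del_g a p \<le> 12/1000" using g_pos[of p] by (simp add: field_simps)
  then show ?thesis by (simp add: add_increasing2)
next
  case False
  then have "\<bar>cos p\<bar>\<^sup>2 \<le> (1/10)\<^sup>2" by (intro power_mono) auto
  then have s: "(sin p)\<^sup>2 \<ge> 99/100" unfolding sin_squared_eq by (simp add: power2_eq_square)
  then have "((sin p)\<^sup>2)\<^sup>2 \<ge> (99/100)\<^sup>2" by (intro power_mono) auto
  then have "(sin p)^4 \<ge> (99/100)\<^sup>2" by simp
  then show ?thesis using abs_le_D1[OF gamma_over_g[of p]] a_small by (simp add: power2_eq_square)
qed

text \<open>In the amplitude variable a period is always an interval of length \<pi>, although it
  becomes arbitrarily long in t as a tends to 0; the derivative of z becomes g - \<gamma>/g. The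
  positive lower bound gives \<open>del_h\<close> its meaning and makes \<open>e\<close> comparable
  to 1/n.\<close>

lemma z_period_bounds: "2/10 \<le> del_z a (2 * del_\<tau> a)" "del_z a (2 * del_\<tau> a) \<le> 9"
proof -
  define Z where "Z = (\<lambda>p. del_z a (del_G a p))"
  have dZ: "(Z has_real_derivative (del_g a p - del_\<gamma> a / del_g a p)) (at p)" for p
    using DERIV_chain'[OF G_deriv z_deriv, of p] g_pos[of p]
    by (simp add: Z_def x_eq field_simps power2_eq_square)
  have Z0: "Z 0 = 0" "Z pi = del_z a (2 * del_\<tau> a)" by (simp_all add: Z_def tau_eq)
  have "Z pi - 21/10 * pi \<le> Z 0 - 21/10 * 0"
  proof (rule DERIV_nonpos_imp_nonincreasing[where f = "\<lambda>p. Z p - 21/10 * p"])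
    fix p
    have "((\<lambda>p. Z p - 21/10 * p) has_real_derivative (del_g a p - del_\<gamma> a / del_g a p - 21/10)) (at p)"
      by (auto intro!: derivative_eq_intros dZ)
    moreover have "del_g a p - del_\<gamma> a / del_g a p - 21/10 \<le> 0"
      using abs_le_D2[OF gamma_over_g[of p]] g_le[of p] a_small by linarith
    ultimately show "\<exists>y. ((\<lambda>p. Z p - 21/10 * p) has_real_derivative y) (at p) \<and> y \<le> 0" by blast
  qed simp
  then show "del_z a (2 * del_\<tau> a) \<le> 9" using pi_less_4 Z0 by simp
  \<comment> \<open>Primitive of the minorant 999/1000 cos^2 p - 12/1000 - 11/10 sin^4 p of the
    derivative of \<open>Z\<close>. At \<pi> the oscillating terms vanish, and the mean 999/2000 -
    12/1000 - 33/80 = 75/1000 remains.\<close>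
  define q :: "real \<Rightarrow> real" where "q = (\<lambda>p. 999/1000 * (p/2 + sin (2*p) / 4) - 12/1000 * p
     - 11/10 * (p/2 - sin (2*p) / 4 - (p/8 - sin (4*p) / 32)))"
  have q: "(q has_real_derivative (999/1000 * (cos p)\<^sup>2 - (12/1000 + 11/10 * (sin p)^4))) (at p)" for p
  proof -
    have "(q has_real_derivative (999/1000 * (1/2 + cos (2*p) / 2) - 12/1000
       - 11/10 * (1/2 - cos (2*p) / 2 - (1/8 - cos (4*p) / 8)))) (at p)"
      unfolding q_def by (auto intro!: derivative_eq_intros simp: field_simps)
    moreover have c2: "cos (2*p) = 2 * (cos p)\<^sup>2 - 1" by (rule cos_double_cos)
    have c4: "cos (4*p) = 2 * (2 * (cos p)\<^sup>2 - 1)\<^sup>2 - 1"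
      using cos_double_cos[of "2 * p"] c2 by simp
    have s4: "(sin p)^4 = (1 - (cos p)\<^sup>2)\<^sup>2"
      by (metis sin_squared_eq power_mult[of "sin p" 2 2] mult_2 numeral_Bit0)
    have "999/1000 * (1/2 + cos (2*p) / 2) - 12/1000 - 11/10 * (1/2 - cos (2*p) / 2 - (1/8 - cos (4*p) / 8))
      = 999/1000 * (cos p)\<^sup>2 - (12/1000 + 11/10 * (sin p)^4)"
      unfolding c2 c4 s4 by (simp add: field_simps power2_eq_square)
    ultimately show ?thesis by (simp only:)
  qed
  have "Z 0 - q 0 \<le> Z pi - q pi"
  proof (rule DERIV_nonneg_imp_nondecreasing[where f = "\<lambda>p. Z p - q p"])
    fix p
    have "((\<lambda>p. Z p - q p) has_real_derivative (del_g a p - del_\<gamma> a / del_g a p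
       - (999/1000 * (cos p)\<^sup>2 - (12/1000 + 11/10 * (sin p)^4)))) (at p)"
      by (auto intro!: derivative_eq_intros dZ q)
    moreover have "999/1000 * (cos p)\<^sup>2 \<le> del_g a p"
    proof -
      have "(cos p)\<^sup>2 = \<bar>cos p\<bar> * \<bar>cos p\<bar>" by (simp add: power2_eq_square)
      also have "\<dots> \<le> \<bar>cos p\<bar> * 1" by (intro mult_left_mono) auto
      finally have "999/1000 * (cos p)\<^sup>2 \<le> (1 + a) * \<bar>cos p\<bar>"
        using a_small by (intro mult_mono) auto
      then show ?thesis using g_ge_cos[of p] by simp
    qed
    then have "0 \<le> del_g a p - del_\<gamma> a / del_g a p - (999/1000 * (cos p)\<^sup>2 - (12/1000 + 11/10 * (sin p)^4))"
      using gamma_over_g_le[of p] by simp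
    ultimately show "\<exists>y. ((\<lambda>p. Z p - q p) has_real_derivative y) (at p) \<and> 0 \<le> y" by blast
  qed simp
  moreover have "q 0 = 0" by (simp add: q_def)
  moreover have "q pi = 75/1000 * pi"
  proof -
    have "sin (4 * pi) = 0" using sin_npi[of 4] by simp
    then show ?thesis by (simp add: q_def)
  qed
  ultimately show "2/10 \<le> del_z a (2 * del_\<tau> a)" using pi_gt3 Z0 by simp
qed

lemma h_eq: "2 * del_h a = del_z a (2 * del_\<tau> a)"
proof -
  have "(THE h. h > 0 \<and> (\<forall>t. del_z a (t + 2 * del_\<tau> a) = 2 * h + del_z a t)) = del_z a (2 * del_\<tau> a) / 2"
    using z_period_bounds z_add_period
    by (intro the_equality) (auto dest: spec[of _ 0])
  then show ?thesis using a_gt by (simp add: del_h_def)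
qed

lemma h_bounds: "1/10 \<le> del_h a" "del_h a \<le> 5"
  using h_eq z_period_bounds by simp_all

text \<open>Guarantees that the window [-T, T] lies in [-n \<tau>, n \<tau>], where the norm of
  \<phi> is controlled, as soon as n \<ge> T.\<close>

lemma tau_ge_1: "del_\<tau> a \<ge> 1"
proof -
  have "2 \<le> pi / (1 + a)" using pi_gt3 a_small by (simp add: pos_le_divide_eq)
  then show ?thesis using G_growth[of 0 pi] by (simp add: tau_eq[symmetric])
qed

text \<open>sech solves the same equation with parameter 0 and data (1, 0), so the two sources of
  error are the initial discrepancy \<open>a\<close> and \<open>del_\<gamma> a\<close>, both O(a).
  The exponential is harmless because t will range over a fixed window.\<close>

lemma x_near_sech:
  "(del_x a t - 1 / cosh t)\<^sup>2 + (del_y a t + sinh t / (cosh t)\<^sup>2)\<^sup>2 \<le> 20 * a\<^sup>2 * exp (30 * \<bar>t\<bar>)"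
proof -
  let ?v = "\<lambda>t::real. 1 / cosh t" and ?v' = "\<lambda>t::real. - sinh t / (cosh t)\<^sup>2"
  have v: "(?v has_real_derivative ?v' t) (at t)" for t
    by (auto intro!: derivative_eq_intros simp: power2_eq_square)
  have v': "(?v' has_real_derivative ((1 + 2 * 0) * ?v t - 2 * ?v t ^ 3)) (at t)" for t
  proof -
    have "(?v' has_real_derivative ((2 * (sinh t)\<^sup>2 - (cosh t)\<^sup>2) / cosh t ^ 3)) (at t)"
      by (auto intro!: derivative_eq_intros simp: power2_eq_square power3_eq_cube field_simps)
    moreover have "(2 * (sinh t)\<^sup>2 - (cosh t)\<^sup>2) / cosh t ^ 3 = (1 + 2 * 0) * ?v t - 2 * ?v t ^ 3"
      unfolding sinh_square_eq by (simp add: field_simps power2_eq_square power3_eq_cube)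
    ultimately show ?thesis by simp
  qed
  have g: "\<bar>del_\<gamma> a\<bar> \<le> 2 * \<bar>a\<bar>"
    using a_small by (simp add: del_\<gamma>_def abs_mult mult_mono mult.commute)
  define C where "C = 3 + 2 * \<bar>del_\<gamma> a\<bar> + 6 * 2\<^sup>2"
  have C: "1 \<le> C" "C \<le> 30" using g a_small by (simp_all add: C_def)
  have "(del_x a t - ?v t)\<^sup>2 + (del_y a t - ?v' t)\<^sup>2
    \<le> ((del_x a 0 - ?v 0)\<^sup>2 + (del_y a 0 - ?v' 0)\<^sup>2 + 4 * (del_\<gamma> a - 0)\<^sup>2 * 2\<^sup>2 / C) * exp (C * \<bar>t\<bar>)"
  proof (rule duffing_continuous_dependence[OF x_deriv y_deriv v v' _ _ C_def])
    show "\<bar>del_x a t\<bar> \<le> 2" for t using x_pos[of t] x_le[of t] a_small by simp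
    show "\<bar>1 / cosh t\<bar> \<le> 2" for t :: real using cosh_real_ge_1[of t] by (simp add: field_simps)
  qed
  also have "\<dots> \<le> (20 * a\<^sup>2) * exp (30 * \<bar>t\<bar>)"
  proof (rule mult_mono)
    have "4 * (del_\<gamma> a - 0)\<^sup>2 * 2\<^sup>2 / C \<le> 19 * a\<^sup>2"
    proof -
      have "\<bar>del_\<gamma> a\<bar> \<le> 101/100 * \<bar>a\<bar>"
        unfolding del_\<gamma>_def abs_mult using a_small
        by (subst mult.commute) (intro mult_right_mono, auto)
      then have "\<bar>del_\<gamma> a\<bar>\<^sup>2 \<le> (101/100 * \<bar>a\<bar>)\<^sup>2" by (intro power_mono) auto
      then have "(del_\<gamma> a)\<^sup>2 \<le> 10201/10000 * a\<^sup>2" by (simp add: power_mult_distrib power2_eq_square)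
      then have "16 * (del_\<gamma> a)\<^sup>2 \<le> 19 * a\<^sup>2" using zero_le_power2[of a] by linarith
      moreover have "19 * a\<^sup>2 * 1 \<le> 19 * a\<^sup>2 * C" using C by (intro mult_left_mono) auto
      ultimately show ?thesis using C by (simp add: field_simps)
    qed
    then show "(del_x a 0 - ?v 0)\<^sup>2 + (del_y a 0 - ?v' 0)\<^sup>2 + 4 * (del_\<gamma> a - 0)\<^sup>2 * 2\<^sup>2 / C \<le> 20 * a\<^sup>2"
      by (simp add: x_0)
    show "exp (C * \<bar>t\<bar>) \<le> exp (30 * \<bar>t\<bar>)" using C by (simp add: mult_right_mono)
  qed (use C in auto)
  finally show ?thesis by simp
qed

end

section \<open>First-order expansions\<close>

text \<open>Read f = f0 + f1 + o(d). The two parts may vary with the point; the bounds on them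
  belong to the notion in order to make it stable under products.\<close>

definition expd :: "'q filter \<Rightarrow> ('q \<Rightarrow> real) \<Rightarrow> ('q \<Rightarrow> real) \<Rightarrow> ('q \<Rightarrow> real) \<Rightarrow> ('q \<Rightarrow> real) \<Rightarrow> bool" where
  "expd F d f f0 f1 \<longleftrightarrow> f0 \<in> O[F](\<lambda>_. 1) \<and> f1 \<in> O[F](d) \<and> (\<lambda>q. f q - f0 q - f1 q) \<in> o[F](d)"

locale small_scale =
  fixes F :: "'q filter" and d :: "'q \<Rightarrow> real"
  assumes d0: "d \<in> o[F](\<lambda>_. 1)"
begin

abbreviation "bdd \<equiv> O[F](\<lambda>_. 1)"

lemma d_bdd: "d \<in> bdd" using d0 by (rule landau_o.small_imp_big)

lemma bdd_mult: "f \<in> bdd \<Longrightarrow> g \<in> bdd \<Longrightarrow> (\<lambda>q. f q * g q) \<in> bdd"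
  using landau_o.big.mult[of f F "\<lambda>_. 1" g "\<lambda>_. 1"] by simp

lemma bdd_mult_small: "f \<in> bdd \<Longrightarrow> g \<in> o[F](d) \<Longrightarrow> (\<lambda>q. f q * g q) \<in> o[F](d)"
  using landau_o.big_small_mult[of f F "\<lambda>_. 1" g d] by simp

lemma small_mult_bdd: "f \<in> o[F](d) \<Longrightarrow> g \<in> bdd \<Longrightarrow> (\<lambda>q. f q * g q) \<in> o[F](d)"
  using landau_o.small_big_mult[of f F d g "\<lambda>_. 1"] by simp

lemma bdd_mult_big: "f \<in> bdd \<Longrightarrow> g \<in> O[F](d) \<Longrightarrow> (\<lambda>q. f q * g q) \<in> O[F](d)"
  using landau_o.big.mult[of f F "\<lambda>_. 1" g d] by simp

lemma big_mult_bdd: "f \<in> O[F](d) \<Longrightarrow> g \<in> bdd \<Longrightarrow> (\<lambda>q. f q * g q) \<in> O[F](d)"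
  using landau_o.big.mult[of f F d g "\<lambda>_. 1"] by simp

lemma big_mult_big: "f \<in> O[F](d) \<Longrightarrow> g \<in> O[F](d) \<Longrightarrow> (\<lambda>q. f q * g q) \<in> o[F](d)"
proof -
  assume f: "f \<in> O[F](d)" and g: "g \<in> O[F](d)"
  have "g \<in> o[F](\<lambda>_. 1)" using landau_o.big_small_trans[OF g d0] .
  from landau_o.big_small_mult[OF f this] show ?thesis by simp
qed

lemma big_imp_bdd: "f \<in> O[F](d) \<Longrightarrow> f \<in> bdd"
  using landau_o.big_trans d_bdd by blast

lemma expd_bdd: "expd F d f f0 f1 \<Longrightarrow> f \<in> bdd"
proof -
  assume e: "expd F d f f0 f1"
  have "(\<lambda>q. (f q - f0 q - f1 q) + (f0 q + f1 q)) \<in> bdd"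
    using e unfolding expd_def
    by (intro sum_in_bigo(1)) (blast intro: big_imp_bdd landau_o.small_imp_big)+
  then show ?thesis by simp
qed

lemma expd_zeroth: "f \<in> bdd \<Longrightarrow> expd F d f f (\<lambda>_. 0)"
  by (simp add: expd_def)

lemma expd_const: "expd F d (\<lambda>_. k) (\<lambda>_. k) (\<lambda>_. 0)"
  by (simp add: expd_def)

lemma expd_first: "f \<in> O[F](d) \<Longrightarrow> expd F d f (\<lambda>_. 0) f"
  by (simp add: expd_def)

lemma expd_add:
  assumes "expd F d f f0 f1" "expd F d g g0 g1"
  shows "expd F d (\<lambda>q. f q + g q) (\<lambda>q. f0 q + g0 q) (\<lambda>q. f1 q + g1 q)"
proof -
  have "(\<lambda>q. (f q - f0 q - f1 q) + (g q - g0 q - g1 q)) \<in> o[F](d)"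
    using assms by (intro sum_in_smallo(1)) (auto simp: expd_def)
  then show ?thesis using assms by (auto simp: expd_def algebra_simps intro: sum_in_bigo)
qed

lemma expd_mult:
  assumes f: "expd F d f f0 f1" and g: "expd F d g g0 g1"
  shows "expd F d (\<lambda>q. f q * g q) (\<lambda>q. f0 q * g0 q) (\<lambda>q. f0 q * g1 q + f1 q * g0 q)"
proof -
  have f': "f0 \<in> bdd" "f1 \<in> O[F](d)" "(\<lambda>q. f q - f0 q - f1 q) \<in> o[F](d)"
    and g': "g0 \<in> bdd" "g1 \<in> O[F](d)" "(\<lambda>q. g q - g0 q - g1 q) \<in> o[F](d)"
    using f g by (auto simp: expd_def)
  \<comment> \<open>The product of the two first-order parts is O(d^2), which is o(d) because d
    tends to 0.\<close>
  have "(\<lambda>q. (f q - f0 q - f1 q) * g q + (f0 q + f1 q) * (g q - g0 q - g1 q) + f1 q * g1 q) \<in> o[F](d)"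
    by (intro sum_in_smallo(1) small_mult_bdd[OF f'(3) expd_bdd[OF g]] bdd_mult_small[OF _ g'(3)]
        big_mult_big[OF f'(2) g'(2)] sum_in_bigo(1) f'(1) big_imp_bdd[OF f'(2)])
  moreover have "(\<lambda>q. (f q - f0 q - f1 q) * g q + (f0 q + f1 q) * (g q - g0 q - g1 q) + f1 q * g1 q)
     = (\<lambda>q. f q * g q - f0 q * g0 q - (f0 q * g1 q + f1 q * g0 q))"
    by (auto simp: algebra_simps)
  ultimately show ?thesis unfolding expd_def
    by (intro conjI sum_in_bigo(1) bdd_mult bdd_mult_big[OF f'(1) g'(2)] big_mult_bdd[OF f'(2) g'(1)] f' g')
      simp
qed

lemma expd_minus: "expd F d f f0 f1 \<Longrightarrow> expd F d (\<lambda>q. - f q) (\<lambda>q. - f0 q) (\<lambda>q. - f1 q)"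
  using expd_mult[OF expd_const[of "-1"], of f f0 f1] by simp

lemma expd_diff:
  assumes "expd F d f f0 f1" "expd F d g g0 g1"
  shows "expd F d (\<lambda>q. f q - g q) (\<lambda>q. f0 q - g0 q) (\<lambda>q. f1 q - g1 q)"
  using expd_add[OF assms(1) expd_minus[OF assms(2)]] by simp

lemma expd_cong:
  assumes "expd F d f f0 f1" "\<And>q. f q = g q" "\<And>q. f0 q = g0 q" "\<And>q. f1 q = g1 q"
  shows "expd F d g g0 g1"
proof -
  have "f = g" "f0 = g0" "f1 = g1" using assms(2-4) by auto
  then show ?thesis using assms(1) by simp
qed

lemmas expd_intros = expd_add expd_diff expd_mult expd_minus expd_const

end

lemma (in small_scale) expd_cong':
  assumes "expd F d f f0 f1" "\<And>q. f0 q = g0 q" "\<And>q. f1 q = g1 q"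
  shows "expd F d f g0 g1"
  using expd_cong[OF assms(1) refl assms(2,3)] .

lemma (in small_scale) bdd_power: "f \<in> bdd \<Longrightarrow> (\<lambda>q. f q ^ j) \<in> bdd"
  using landau_o.big_power[of f F "\<lambda>_. 1" j] by simp

lemma (in small_scale) bdd_const: "(\<lambda>_. c) \<in> bdd"
  by simp

lemma (in small_scale) bdd_divide_const: "f \<in> bdd \<Longrightarrow> (\<lambda>q. f q / c) \<in> bdd"
  using bdd_mult[OF _ bdd_const[of "1 / c"], of f] by simp

lemma (in small_scale) bdd_minus: "f \<in> bdd \<Longrightarrow> (\<lambda>q. - f q) \<in> bdd"
  by simp

lemmas (in small_scale) bdd_intros = sum_in_bigo bdd_mult bdd_power bdd_const bdd_divide_const bdd_minus

text \<open>Linearisation of the squared curvature equation at the Delaunay surface.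
  \<open>e0\<close> and its companions stand for \<eta> and its derivatives, the \<open>P\<close>
  and \<open>S\<close> variables for the radial and axial displacement to first order,
  \<open>w\<close> for the curvature of the core circle, \<open>s\<close> for sin \<theta>;
  \<open>Q1\<close> and \<open>W1\<close> are the first-order parts of the curvature numerator and
  of E G - F^2. The \<eta>-terms assemble to (x \<eta>)_tt + (x \<eta>)_\<theta>\<theta> plus the
  potential of the Jacobi operator, and \<open>ka\<close> collects the effect of bending. The second
  identity says that the unperturbed surface has mean curvature 1, as (E G - F^2)^(3/2) = x^6
  there.\<close>

lemma curvature_identity:
  fixes x y g z x2 y2 zt ztt e0 et eh ett eth ehh w s c :: real
  assumes en: "y\<^sup>2 = x\<^sup>2 - z\<^sup>2" and z: "z = x\<^sup>2 - g"
    and x2: "x2 = (1 + 2 * g) * x - 2 * x ^ 3" and y2: "y2 = (1 + 2 * g) * y - 6 * x\<^sup>2 * y"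
    and zt: "zt = 2 * x * y" and ztt: "ztt = 2 * y\<^sup>2 + 2 * x * x2"
    and P: "P0 = - (e0 * z)" "Pt = - (et * z + e0 * zt)" "Ph = - (eh * z)"
      "Ptt = - (ett * z + 2 * et * zt + e0 * ztt)" "Pth = - (eth * z + eh * zt)" "Phh = - (ehh * z)"
    and S: "St = et * y + e0 * x2" "Sh = eh * y"
      "Stt = ett * y + 2 * et * x2 + e0 * y2" "Sth = eth * y + eh * x2" "Shh = ehh * y"
    and C: "C1 = - z * P0 - (St + w * z * s * x) * x" "C3 = y * P0 + Pt * x"
    and E1: "E1 = 2 * y * Pt + 2 * z * (St + w * z * s * x)"
    and hh: "hhC1 = (Phh - P0) * (- z * x) - x * C1 + Shh * (y * x)"
    and tt: "ttC0 = x2 * (- z * x) + zt * (y * x)"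
      "ttC1 = (Ptt - w * z * s * z) * (- z * x) + x2 * C1 + (Stt + w * zt * s * x + 2 * w * z * s * y) * (y * x) + zt * C3"
    and Q1: "Q1 = E1 * (x\<^sup>2 * z) + x\<^sup>2 * hhC1 + x\<^sup>2 * ttC1 + 2 * x * P0 * ttC0"
    and W1: "W1 = x\<^sup>2 * E1 + x\<^sup>2 * (2 * x * P0)"
    and ka: "ka = 2*x^3*z^3 + x^5*z + x\<^sup>2*(-x\<^sup>2*z*x2 + x*z^3 + 2*x*y\<^sup>2*z + 2*x^3*y\<^sup>2) - 6*x^5*z\<^sup>2"
  shows "Q1 - 3 * x\<^sup>2 * W1 =
    x^4 * (x * ett + 2 * y * et + x2 * e0 + x * ehh) + 2 * (x^6 + g\<^sup>2 * x\<^sup>2) * x * e0 + w * s * ka"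
    and "x\<^sup>2 * (x\<^sup>2 * z) + x\<^sup>2 * ttC0 = 2 * x^6"
proof -
  show "x\<^sup>2 * (x\<^sup>2 * z) + x\<^sup>2 * ttC0 = 2 * x^6"
    using en unfolding tt zt x2 z by algebra
  show "Q1 - 3 * x\<^sup>2 * W1 =
    x^4 * (x * ett + 2 * y * et + x2 * e0 + x * ehh) + 2 * (x^6 + g\<^sup>2 * x\<^sup>2) * x * e0 + w * s * ka"
    using en unfolding Q1 W1 ka hh tt E1 C P S ztt zt y2 x2 z
    by algebra
qed


context small_scale
begin

text \<open>Both sides of the squared equation have zeroth-order part 4 x^12, so their first-order
  parts agree up to o(d). Squaring does not weaken the linearised equation: the numerator is close
  to 2 x^6, and the common factor 4 x^6 can be divided out since \<open>1 / x\<close> is bounded. A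
  further division by x^4 normalises the second derivatives.\<close>

lemma curvature_expansion:
  fixes x y g z x2 y2 zt ztt e0 et eh ett eth ehh w s c h :: "'q \<Rightarrow> real"
  assumes en: "\<And>q. (y q)\<^sup>2 = (x q)\<^sup>2 - (z q)\<^sup>2" and z: "\<And>q. z q = (x q)\<^sup>2 - g q"
    and x2: "\<And>q. x2 q = (1 + 2 * g q) * x q - 2 * x q ^ 3"
    and y2: "\<And>q. y2 q = (1 + 2 * g q) * y q - 6 * (x q)\<^sup>2 * y q"
    and zt: "\<And>q. zt q = 2 * x q * y q" and ztt: "\<And>q. ztt q = 2 * (y q)\<^sup>2 + 2 * x q * x2 q"
    and P: "\<And>q. P0 q = - (e0 q * z q)" "\<And>q. Pt q = - (et q * z q + e0 q * zt q)" "\<And>q. Ph q = - (eh q * z q)"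
      "\<And>q. Ptt q = - (ett q * z q + 2 * et q * zt q + e0 q * ztt q)"
      "\<And>q. Pth q = - (eth q * z q + eh q * zt q)" "\<And>q. Phh q = - (ehh q * z q)"
    and S: "\<And>q. St q = et q * y q + e0 q * x2 q" "\<And>q. Sh q = eh q * y q"
      "\<And>q. Stt q = ett q * y q + 2 * et q * x2 q + e0 q * y2 q" "\<And>q. Sth q = eth q * y q + eh q * x2 q"
      "\<And>q. Shh q = ehh q * y q"
    and T: "expd F d T1 y Pt" "expd F d T2 (\<lambda>_. 0) (\<lambda>_. 0)" "expd F d T3 z (\<lambda>q. St q + w q * z q * s q * x q)"
    and U: "expd F d U1 (\<lambda>_. 0) Ph" "expd F d U2 x P0" "expd F d U3 (\<lambda>_. 0) Sh"
    and hh: "expd F d hh1 (\<lambda>q. - x q) (\<lambda>q. Phh q - P0 q)" "expd F d hh2 (\<lambda>_. 0) (\<lambda>q. 2 * Ph q)"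
      "expd F d hh3 (\<lambda>_. 0) Shh"
    and th: "expd F d th1 (\<lambda>_. 0) Pth" "expd F d th2 y Pt"
      "expd F d th3 (\<lambda>_. 0) (\<lambda>q. Sth q + w q * z q * c q * x q)"
    and tt: "expd F d tt1 x2 (\<lambda>q. Ptt q - w q * z q * s q * z q)"
      "expd F d tt2 (\<lambda>_. 0) (\<lambda>q. - w q * z q * c q * z q)"
      "expd F d tt3 zt (\<lambda>q. Stt q + w q * zt q * s q * x q + 2 * w q * z q * s q * y q)"
    and h: "h \<in> O[F](d)"
    and C: "\<And>q. C1 q = T2 q * U3 q - T3 q * U2 q" "\<And>q. C2 q = T3 q * U1 q - T1 q * U3 q"
      "\<And>q. C3 q = T1 q * U2 q - T2 q * U1 q"
    and E: "\<And>q. E q = T1 q * T1 q + T2 q * T2 q + T3 q * T3 q"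
      "\<And>q. Fm q = T1 q * U1 q + T2 q * U2 q + T3 q * U3 q"
      "\<And>q. G q = U1 q * U1 q + U2 q * U2 q + U3 q * U3 q"
    and eq: "\<forall>\<^sub>F q in F. (E q * (hh1 q * C1 q + hh2 q * C2 q + hh3 q * C3 q)
        - 2 * Fm q * (th1 q * C1 q + th2 q * C2 q + th3 q * C3 q)
        + G q * (tt1 q * C1 q + tt2 q * C2 q + tt3 q * C3 q))\<^sup>2
      = 4 * (1 + h q)\<^sup>2 * (E q * G q - (Fm q)\<^sup>2) ^ 3"
    and x: "x \<in> bdd" "(\<lambda>q. 1 / x q) \<in> bdd" "\<And>q. x q \<noteq> 0"
    and ka: "\<And>q. ka q = (2*x q^3*z q^3 + x q^5*z q + (x q)\<^sup>2*(-(x q)\<^sup>2*z q*x2 q + x q*z q^3 + 2*x q*(y q)\<^sup>2*z q + 2*x q^3*(y q)\<^sup>2) - 6*x q^5*(z q)\<^sup>2) / x q ^ 4"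
  shows "(\<lambda>q. x q * ett q + 2 * y q * et q + x2 q * e0 q + x q * ehh q
      + 2 * ((x q)\<^sup>2 + (g q / x q)\<^sup>2) * (x q * e0 q) + w q * s q * ka q - 2 * (x q)\<^sup>2 * h q) \<in> o[F](d)"
proof -
  define C1' where "C1' = (\<lambda>q. - z q * P0 q - (St q + w q * z q * s q * x q) * x q)"
  define C2' where "C2' = (\<lambda>q. z q * Ph q - y q * Sh q)"
  define C3' where "C3' = (\<lambda>q. y q * P0 q + Pt q * x q)"
  define E' where "E' = (\<lambda>q. 2 * y q * Pt q + 2 * z q * (St q + w q * z q * s q * x q))"
  define F' where "F' = (\<lambda>q. y q * Ph q + z q * Sh q)"
  define hh' where "hh' = (\<lambda>q. (Phh q - P0 q) * (- z q * x q) - x q * C1' q + Shh q * (y q * x q))"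
  define th' where "th' = (\<lambda>q. Pth q * (- z q * x q) + y q * C2' q + (Sth q + w q * z q * c q * x q) * (y q * x q))"
  define tt0 where "tt0 = (\<lambda>q. x2 q * (- z q * x q) + zt q * (y q * x q))"
  define tt' where "tt' = (\<lambda>q. (Ptt q - w q * z q * s q * z q) * (- z q * x q) + x2 q * C1' q
     + (Stt q + w q * zt q * s q * x q + 2 * w q * z q * s q * y q) * (y q * x q) + zt q * C3' q)"
  define Q1 where "Q1 = (\<lambda>q. E' q * ((x q)\<^sup>2 * z q) + (x q)\<^sup>2 * hh' q + (x q)\<^sup>2 * tt' q + 2 * x q * P0 q * tt0 q)"
  define W1 where "W1 = (\<lambda>q. (x q)\<^sup>2 * E' q + (x q)\<^sup>2 * (2 * x q * P0 q))"
  define ka' where "ka' = (\<lambda>q. 2*x q^3*z q^3 + x q^5*z q + (x q)\<^sup>2*(-(x q)\<^sup>2*z q*x2 q + x q*z q^3 + 2*x q*(y q)\<^sup>2*z q + 2*x q^3*(y q)\<^sup>2) - 6*x q^5*(z q)\<^sup>2)"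
  have id1: "Q1 q - 3 * (x q)\<^sup>2 * W1 q =
      x q^4 * (x q * ett q + 2 * y q * et q + x2 q * e0 q + x q * ehh q)
      + 2 * (x q^6 + (g q)\<^sup>2 * (x q)\<^sup>2) * x q * e0 q + w q * s q * ka' q"
    and id2: "(x q)\<^sup>2 * ((x q)\<^sup>2 * z q) + (x q)\<^sup>2 * tt0 q = 2 * x q^6" for q
    using curvature_identity[OF en[of q] z[of q] x2[of q] y2[of q] zt[of q] ztt[of q]
        P(1)[of q] P(2)[of q] P(3)[of q] P(4)[of q] P(5)[of q] P(6)[of q]
        S(1)[of q] S(2)[of q] S(3)[of q] S(4)[of q] S(5)[of q]
        fun_cong[OF C1'_def, of q] fun_cong[OF C3'_def, of q] fun_cong[OF E'_def, of q]
        fun_cong[OF hh'_def, of q] fun_cong[OF tt0_def, of q] fun_cong[OF tt'_def, of q]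
        fun_cong[OF Q1_def, of q] fun_cong[OF W1_def, of q] fun_cong[OF ka'_def, of q]]
    by blast+
  have eC1: "expd F d C1 (\<lambda>q. - z q * x q) C1'"
    by (rule expd_cong[OF expd_diff[OF expd_mult[OF T(2) U(3)] expd_mult[OF T(3) U(2)]]])
      (simp_all add: C C1'_def)
  have eC2: "expd F d C2 (\<lambda>q. 0) C2'"
    by (rule expd_cong[OF expd_diff[OF expd_mult[OF T(3) U(1)] expd_mult[OF T(1) U(3)]]])
      (simp_all add: C C2'_def)
  have eC3: "expd F d C3 (\<lambda>q. y q * x q) C3'"
    by (rule expd_cong[OF expd_diff[OF expd_mult[OF T(1) U(2)] expd_mult[OF T(2) U(1)]]])
      (simp_all add: C C3'_def)
  have eE: "expd F d E (\<lambda>q. (x q)\<^sup>2) E'"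
  proof (rule expd_cong[OF expd_add[OF expd_add[OF expd_mult[OF T(1) T(1)] expd_mult[OF T(2) T(2)]] expd_mult[OF T(3) T(3)]]])
    show "y q * y q + 0 * 0 + z q * z q = (x q)\<^sup>2" for q
      using en[of q] by (simp add: power2_eq_square)
  qed (simp_all add: E E'_def algebra_simps)
  \<comment> \<open>To zeroth order the parametrization is conformal and the mixed second
    fundamental form vanishes, so \<open>Fm\<close> enters only through products of two first-order
    quantities.\<close>
  have eF: "expd F d Fm (\<lambda>q. 0) F'"
    by (rule expd_cong[OF expd_add[OF expd_add[OF expd_mult[OF T(1) U(1)] expd_mult[OF T(2) U(2)]] expd_mult[OF T(3) U(3)]]])
      (simp_all add: E F'_def algebra_simps)
  have eG: "expd F d G (\<lambda>q. (x q)\<^sup>2) (\<lambda>q. 2 * x q * P0 q)"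
    by (rule expd_cong[OF expd_add[OF expd_add[OF expd_mult[OF U(1) U(1)] expd_mult[OF U(2) U(2)]] expd_mult[OF U(3) U(3)]]])
      (simp_all add: E power2_eq_square)
  have eh': "expd F d (\<lambda>q. hh1 q * C1 q + hh2 q * C2 q + hh3 q * C3 q) (\<lambda>q. (x q)\<^sup>2 * z q) hh'"
    by (rule expd_cong[OF expd_add[OF expd_add[OF expd_mult[OF hh(1) eC1] expd_mult[OF hh(2) eC2]] expd_mult[OF hh(3) eC3]]])
      (simp_all add: hh'_def power2_eq_square)
  have eth': "expd F d (\<lambda>q. th1 q * C1 q + th2 q * C2 q + th3 q * C3 q) (\<lambda>q. 0) th'"
    by (rule expd_cong[OF expd_add[OF expd_add[OF expd_mult[OF th(1) eC1] expd_mult[OF th(2) eC2]] expd_mult[OF th(3) eC3]]])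
      (simp_all add: th'_def)
  have ett': "expd F d (\<lambda>q. tt1 q * C1 q + tt2 q * C2 q + tt3 q * C3 q) tt0 tt'"
    by (rule expd_cong[OF expd_add[OF expd_add[OF expd_mult[OF tt(1) eC1] expd_mult[OF tt(2) eC2]] expd_mult[OF tt(3) eC3]]])
      (simp_all add: tt0_def tt'_def)
  define Q where "Q = (\<lambda>q. E q * (hh1 q * C1 q + hh2 q * C2 q + hh3 q * C3 q)
        - 2 * Fm q * (th1 q * C1 q + th2 q * C2 q + th3 q * C3 q)
        + G q * (tt1 q * C1 q + tt2 q * C2 q + tt3 q * C3 q))"
  define W where "W = (\<lambda>q. E q * G q - (Fm q)\<^sup>2)"
  have eQ: "expd F d Q (\<lambda>q. 2 * x q^6) Q1"
  proof (rule expd_cong[OF expd_add[OF expd_diff[OF expd_mult[OF eE eh'] expd_mult[OF expd_mult[OF expd_const[of 2] eF] eth']] expd_mult[OF eG ett']]])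
    show "(x q)\<^sup>2 * ((x q)\<^sup>2 * z q) - 2 * 0 * 0 + (x q)\<^sup>2 * tt0 q = 2 * x q ^ 6" for q
      using id2[of q] by simp
  qed (simp_all add: Q_def Q1_def algebra_simps)
  have eW: "expd F d W (\<lambda>q. (x q)\<^sup>2 * (x q)\<^sup>2) W1"
    by (rule expd_cong[OF expd_diff[OF expd_mult[OF eE eG] expd_mult[OF eF eF]]])
      (simp_all add: W_def W1_def power2_eq_square algebra_simps)
  have eQ2: "expd F d (\<lambda>q. (Q q)\<^sup>2) (\<lambda>q. 4 * x q^12) (\<lambda>q. 4 * x q^6 * Q1 q)"
    by (rule expd_cong[OF expd_mult[OF eQ eQ]]) (simp_all add: power2_eq_square flip: power_add)
  have "expd F d (\<lambda>q. 1 + h q) (\<lambda>_. 1) h"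
    by (rule expd_cong[OF expd_add[OF expd_const[of 1] expd_first[OF h]]]) simp_all
  note eH = expd_mult[OF expd_const[of 4] expd_mult[OF this this]]
  have eR: "expd F d (\<lambda>q. 4 * (1 + h q)\<^sup>2 * W q ^ 3) (\<lambda>q. 4 * x q^12) (\<lambda>q. 8 * h q * x q^12 + 12 * x q^8 * W1 q)"
    by (rule expd_cong[OF expd_mult[OF eH expd_mult[OF eW expd_mult[OF eW eW]]]])
      (simp_all add: power2_eq_square power3_eq_cube algebra_simps power_numeral_reduce)
  have "(\<lambda>q. (Q q)\<^sup>2 - 4 * x q^12 - 4 * x q^6 * Q1 q) \<in> o[F](d)" using eQ2 by (simp add: expd_def)
  moreover have "(\<lambda>q. (4 * (1 + h q)\<^sup>2 * W q ^ 3) - 4 * x q^12 - (8 * h q * x q^12 + 12 * x q^8 * W1 q)) \<in> o[F](d)"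
    using eR by (simp add: expd_def)
  ultimately have "(\<lambda>q. ((4 * (1 + h q)\<^sup>2 * W q ^ 3) - 4 * x q^12 - (8 * h q * x q^12 + 12 * x q^8 * W1 q))
      - ((Q q)\<^sup>2 - 4 * x q^12 - 4 * x q^6 * Q1 q)) \<in> o[F](d)"
    by (rule sum_in_smallo(2)[rotated])
  moreover have "\<forall>\<^sub>F q in F. ((4 * (1 + h q)\<^sup>2 * W q ^ 3) - 4 * x q^12 - (8 * h q * x q^12 + 12 * x q^8 * W1 q))
      - ((Q q)\<^sup>2 - 4 * x q^12 - 4 * x q^6 * Q1 q) = 4 * x q^6 * (Q1 q - 3 * (x q)\<^sup>2 * W1 q - 2 * h q * x q^6)"
  proof (rule eventually_mono)
    show "\<forall>\<^sub>F q in F. (Q q)\<^sup>2 = 4 * (1 + h q)\<^sup>2 * W q ^ 3" using eq by (simp only: Q_def W_def)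
    fix q assume "(Q q)\<^sup>2 = 4 * (1 + h q)\<^sup>2 * W q ^ 3"
    moreover have "K - 4 * x q^12 - (8 * h q * x q^12 + 12 * x q^8 * W1 q) - (K - 4 * x q^12 - 4 * x q^6 * Q1 q)
      = 4 * x q^6 * (Q1 q - 3 * (x q)\<^sup>2 * W1 q - 2 * h q * x q^6)" for K
      by (simp add: algebra_simps power_numeral_reduce)
    ultimately show "((4 * (1 + h q)\<^sup>2 * W q ^ 3) - 4 * x q^12 - (8 * h q * x q^12 + 12 * x q^8 * W1 q))
      - ((Q q)\<^sup>2 - 4 * x q^12 - 4 * x q^6 * Q1 q) = 4 * x q^6 * (Q1 q - 3 * (x q)\<^sup>2 * W1 q - 2 * h q * x q^6)"
      by (simp only:)
  qed
  ultimately have A: "(\<lambda>q. 4 * x q^6 * (Q1 q - 3 * (x q)\<^sup>2 * W1 q - 2 * h q * x q^6)) \<in> o[F](d)"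
    using landau_o.small.in_cong by fast
  have quarter: "(\<lambda>_. 1/4) \<in> bdd" by simp
  have "(\<lambda>q. 1 / x q ^ 10) \<in> bdd"
    using landau_o.big_power[OF x(2), of 10] by (simp add: power_one_over)
  from bdd_mult_small[OF bdd_mult[OF quarter this] A] show ?thesis
  proof (rule back_subst[where P = "\<lambda>f. f \<in> o[F](d)"], intro ext)
    fix q
    have "1/4 * (1 / x q ^ 10) * (4 * x q^6 * (Q1 q - 3 * (x q)\<^sup>2 * W1 q - 2 * h q * x q^6))
      = (Q1 q - 3 * (x q)\<^sup>2 * W1 q - 2 * h q * x q^6) / x q ^ 4"
      using x(3)[of q] by (simp add: field_simps flip: power_add)
    also have "\<dots> = x q * ett q + 2 * y q * et q + x2 q * e0 q + x q * ehh q
      + 2 * ((x q)\<^sup>2 + (g q / x q)\<^sup>2) * (x q * e0 q) + w q * s q * ka q - 2 * (x q)\<^sup>2 * h q"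
    proof -
      have k: "ka' q = ka q * x q ^ 4" using x(3)[of q] by (simp add: ka ka'_def)
      have g: "(g q)\<^sup>2 = (g q / x q)\<^sup>2 * (x q)\<^sup>2" using x(3)[of q] by (simp add: power_divide)
      have "Q1 q - 3 * (x q)\<^sup>2 * W1 q - 2 * h q * x q^6 = (x q * ett q + 2 * y q * et q + x2 q * e0 q + x q * ehh q
      + 2 * ((x q)\<^sup>2 + (g q / x q)\<^sup>2) * (x q * e0 q) + w q * s q * ka q - 2 * (x q)\<^sup>2 * h q) * x q ^ 4"
        unfolding id1 k g by (simp add: algebra_simps power_numeral_reduce)
      then show ?thesis using x(3)[of q] by (simp add: field_simps)
    qed
    finally show "1/4 * (1 / x q ^ 10) * (4 * x q^6 * (Q1 q - 3 * (x q)\<^sup>2 * W1 q - 2 * h q * x q^6))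
      = x q * ett q + 2 * y q * et q + x2 q * e0 q + x q * ehh q
      + 2 * ((x q)\<^sup>2 + (g q / x q)\<^sup>2) * (x q * e0 q) + w q * s q * ka q - 2 * (x q)\<^sup>2 * h q" .
  qed
qed

end

section \<open>Surfaces in a moving frame\<close>

text \<open>\<open>fr u \<theta>\<close> has the orthonormal frame \<open>(cos \<theta>, sin \<theta> r)\<close>, \<open>(- sin \<theta>, cos \<theta> r)\<close>, \<open>r\<^sup>\<bottom>\<close>, where
  \<open>r = (cos u, sin u)\<close>.\<close>

definition fr :: "real \<Rightarrow> real \<Rightarrow> real \<Rightarrow> real \<Rightarrow> real \<Rightarrow> real^3" where
  "fr u \<theta> p q s = vector [p * cos \<theta> - q * sin \<theta>,
     (p * sin \<theta> + q * cos \<theta>) * cos u - s * sin u,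
     (p * sin \<theta> + q * cos \<theta>) * sin u + s * cos u]"

lemma trig_norm: "(cos t)\<^sup>2 + (sin t)\<^sup>2 = (1::real)" for t
  using sin_cos_squared_add[of t] by simp

lemma fr_inner: "fr u \<theta> p q s \<bullet> fr u \<theta> p' q' s' = p * p' + q * q' + s * s'"
proof -
  have "fr u \<theta> p q s \<bullet> fr u \<theta> p' q' s'
    = (p * cos \<theta> - q * sin \<theta>) * (p' * cos \<theta> - q' * sin \<theta>)
     + ((p * sin \<theta> + q * cos \<theta>) * cos u - s * sin u) * ((p' * sin \<theta> + q' * cos \<theta>) * cos u - s' * sin u)
     + ((p * sin \<theta> + q * cos \<theta>) * sin u + s * cos u) * ((p' * sin \<theta> + q' * cos \<theta>) * sin u + s' * cos u)"
    by (simp add: fr_def inner_vec_def sum_3)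
  also have "\<dots> = p * p' + q * q' + s * s'"
    using trig_norm[of u] trig_norm[of \<theta>] by algebra
  finally show ?thesis .
qed

lemma fr_cross: "cross3 (fr u \<theta> p q s) (fr u \<theta> p' q' s') =
    fr u \<theta> (q * s' - s * q') (s * p' - p * s') (p * q' - q * p')"
proof -
  have 1: "((p * sin \<theta> + q * cos \<theta>) * cos u - s * sin u) * ((p' * sin \<theta> + q' * cos \<theta>) * sin u + s' * cos u)
     - ((p * sin \<theta> + q * cos \<theta>) * sin u + s * cos u) * ((p' * sin \<theta> + q' * cos \<theta>) * cos u - s' * sin u)
     = (q * s' - s * q') * cos \<theta> - (s * p' - p * s') * sin \<theta>"
    using trig_norm[of u] by algebra
  have 2: "((p * sin \<theta> + q * cos \<theta>) * sin u + s * cos u) * (p' * cos \<theta> - q' * sin \<theta>)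
     - (p * cos \<theta> - q * sin \<theta>) * ((p' * sin \<theta> + q' * cos \<theta>) * sin u + s' * cos u)
     = ((q * s' - s * q') * sin \<theta> + (s * p' - p * s') * cos \<theta>) * cos u - (p * q' - q * p') * sin u"
    using trig_norm[of \<theta>] by algebra
  have 3: "(p * cos \<theta> - q * sin \<theta>) * ((p' * sin \<theta> + q' * cos \<theta>) * cos u - s' * sin u)
     - ((p * sin \<theta> + q * cos \<theta>) * cos u - s * sin u) * (p' * cos \<theta> - q' * sin \<theta>)
     = ((q * s' - s * q') * sin \<theta> + (s * p' - p * s') * cos \<theta>) * sin u + (p * q' - q * p') * cos u"
    using trig_norm[of \<theta>] by algebra
  show ?thesis unfolding cross3_def fr_def by (simp add: 1 2 3)
qed

lemma fr_scaleR: "k *\<^sub>R fr u \<theta> p q s = fr u \<theta> (k * p) (k * q) (k * s)"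
  by (simp add: fr_def vec_eq_iff forall_3 algebra_simps)

lemma fr_add: "fr u \<theta> p q s + fr u \<theta> p' q' s' = fr u \<theta> (p + p') (q + q') (s + s')"
  by (simp add: fr_def vec_eq_iff forall_3 algebra_simps)

lemma fr_norm_sq: "(norm (fr u \<theta> p q s))\<^sup>2 = p\<^sup>2 + q\<^sup>2 + s\<^sup>2"
  unfolding power2_norm_eq_inner fr_inner by (simp add: power2_eq_square)

lemma has_vector_derivative_vector3:
  assumes "(f has_real_derivative f') F" "(g has_real_derivative g') F" "(h has_real_derivative h') F"
  shows "((\<lambda>t. vector [f t, g t, h t] :: real^3) has_vector_derivative vector [f', g', h']) F"
proof -
  have eq: "(vector [p, q, r] :: real^3) = p *\<^sub>R axis 1 1 + q *\<^sub>R axis 2 1 + r *\<^sub>R axis 3 1" for p q r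
    by (simp add: vec_eq_iff forall_3 axis_def)
  show ?thesis unfolding eq
    using assms unfolding has_real_derivative_iff_has_vector_derivative
    by (auto intro!: derivative_eq_intros simp: has_vector_derivative_def scaleR_add_right)
qed

text \<open>The angle turns only \<open>r\<close> and its orthogonal direction into each other; sin
  \<theta> and cos \<theta> are the components of \<open>r\<close> along the first two frame
  vectors.\<close>

lemma fr_deriv_angle:
  assumes "(u has_real_derivative w) (at t)" "(p has_real_derivative p') (at t)"
    "(q has_real_derivative q') (at t)" "(s has_real_derivative s') (at t)"
  shows "((\<lambda>t. fr (u t) \<theta> (p t) (q t) (s t)) has_vector_derivative
    fr (u t) \<theta> (p' - w * sin \<theta> * s t) (q' - w * cos \<theta> * s t) (s' + w * (sin \<theta> * p t + cos \<theta> * q t))) (at t)"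
proof -
  let ?e = "sin \<theta> * p t + cos \<theta> * q t" and ?c = "cos (u t)" and ?n = "sin (u t)"
  have "((\<lambda>t. fr (u t) \<theta> (p t) (q t) (s t)) has_vector_derivative
     vector [p' * cos \<theta> - q' * sin \<theta>,
       (p' * sin \<theta> + q' * cos \<theta>) * cos (u t) - (p t * sin \<theta> + q t * cos \<theta>) * (sin (u t) * w) - (s' * sin (u t) + s t * (cos (u t) * w)),
       (p' * sin \<theta> + q' * cos \<theta>) * sin (u t) + (p t * sin \<theta> + q t * cos \<theta>) * (cos (u t) * w) + (s' * cos (u t) - s t * (sin (u t) * w))]) (at t)"
    unfolding fr_def
    by (intro has_vector_derivative_vector3)
      (auto intro!: derivative_eq_intros assms simp: algebra_simps)
  also have "vector [p' * cos \<theta> - q' * sin \<theta>,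
       (p' * sin \<theta> + q' * cos \<theta>) * cos (u t) - (p t * sin \<theta> + q t * cos \<theta>) * (sin (u t) * w) - (s' * sin (u t) + s t * (cos (u t) * w)),
       (p' * sin \<theta> + q' * cos \<theta>) * sin (u t) + (p t * sin \<theta> + q t * cos \<theta>) * (cos (u t) * w) + (s' * cos (u t) - s t * (sin (u t) * w))]
    = fr (u t) \<theta> (p' - w * sin \<theta> * s t) (q' - w * cos \<theta> * s t) (s' + w * (sin \<theta> * p t + cos \<theta> * q t))"
  proof -
    have 1: "p' * cos \<theta> - q' * sin \<theta> = (p' - w * sin \<theta> * s t) * cos \<theta> - (q' - w * cos \<theta> * s t) * sin \<theta>"
      by (simp add: algebra_simps)
    have 2: "(p' * sin \<theta> + q' * cos \<theta>) * ?c - (p t * sin \<theta> + q t * cos \<theta>) * (?n * w) - (s' * ?n + s t * (?c * w))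
      = ((p' - w * sin \<theta> * s t) * sin \<theta> + (q' - w * cos \<theta> * s t) * cos \<theta>) * ?c - (s' + w * ?e) * ?n"
      using trig_norm[of \<theta>] by algebra
    have 3: "(p' * sin \<theta> + q' * cos \<theta>) * ?n + (p t * sin \<theta> + q t * cos \<theta>) * (?c * w) + (s' * ?c - s t * (?n * w))
      = ((p' - w * sin \<theta> * s t) * sin \<theta> + (q' - w * cos \<theta> * s t) * cos \<theta>) * ?n + (s' + w * ?e) * ?c"
      using trig_norm[of \<theta>] by algebra
    show ?thesis unfolding fr_def 1 2 3 ..
  qed
  finally show ?thesis .
qed

lemma fr_deriv_theta:
  assumes "(p has_real_derivative p') (at \<theta>)"
    "(q has_real_derivative q') (at \<theta>)" "(s has_real_derivative s') (at \<theta>)"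
  shows "((\<lambda>\<theta>. fr u \<theta> (p \<theta>) (q \<theta>) (s \<theta>)) has_vector_derivative
    fr u \<theta> (p' - q \<theta>) (q' + p \<theta>) s') (at \<theta>)"
  unfolding fr_def
  by (intro has_vector_derivative_vector3)
    (auto intro!: derivative_eq_intros assms simp: algebra_simps)

lemma d_t_eqI:
  assumes "\<And>t \<theta>. ((\<lambda>s. f (s, \<theta>)) has_vector_derivative f' (t, \<theta>)) (at t)"
  shows "d_t f = f'"
  using assms by (auto simp: d_t_def intro!: ext vector_derivative_at)

lemma d_theta_eqI:
  assumes "\<And>t \<theta>. ((\<lambda>s. f (t, s)) has_vector_derivative f' (t, \<theta>)) (at \<theta>)"
  shows "d_\<theta> f = f'"
  using assms by (auto simp: d_\<theta>_def intro!: ext vector_derivative_at)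

text \<open>By Lagrange's identity the squared length of the cross product is E G - F^2, so squaring
  turns the normalisation of the normal into a polynomial expression, and only the unnormalised
  normal remains.\<close>

lemma mean_curvature_squared:
  assumes "cross3 (d_t X p) (d_\<theta> X p) \<noteq> 0"
  shows "(norm (d_t X p) ^ 2 * (d_\<theta> (d_\<theta> X) p \<bullet> cross3 (d_t X p) (d_\<theta> X p))
      - 2 * (d_t X p \<bullet> d_\<theta> X p) * (d_\<theta> (d_t X) p \<bullet> cross3 (d_t X p) (d_\<theta> X p))
      + norm (d_\<theta> X p) ^ 2 * (d_t (d_t X) p \<bullet> cross3 (d_t X p) (d_\<theta> X p)))\<^sup>2
    = 4 * (mean_curvature X p)\<^sup>2 * (norm (d_t X p) ^ 2 * norm (d_\<theta> X p) ^ 2 - (d_t X p \<bullet> d_\<theta> X p)\<^sup>2) ^ 3"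
proof -
  define T U C where "T = d_t X p" and "U = d_\<theta> X p" and "C = cross3 T U"
  define W where "W = norm T ^ 2 * norm U ^ 2 - (T \<bullet> U)\<^sup>2"
  define Q where "Q = norm T ^ 2 * (d_\<theta> (d_\<theta> X) p \<bullet> C) - 2 * (T \<bullet> U) * (d_\<theta> (d_t X) p \<bullet> C)
     + norm U ^ 2 * (d_t (d_t X) p \<bullet> C)"
  have C: "norm C > 0" using assms by (simp add: C_def T_def U_def)
  have W: "(norm C)\<^sup>2 = W"
    using norm_cross_dot[of T U] by (simp add: W_def C_def power_mult_distrib algebra_simps)
  then have W0: "W > 0" using C by (metis zero_less_power)
  have "mean_curvature X p = (Q / norm C) / (2 * W)"
    unfolding mean_curvature_def normal_def Let_def T_def[symmetric] U_def[symmetric] C_def[symmetric]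
      W_def[symmetric] Q_def
    using C by (simp add: inner_scaleR_right field_simps)
  then have "Q = 2 * mean_curvature X p * W * norm C"
    using C W0 by (simp add: field_simps)
  then have "Q\<^sup>2 = 4 * (mean_curvature X p)\<^sup>2 * W\<^sup>2 * (norm C)\<^sup>2"
    by (simp add: power_mult_distrib)
  also have "\<dots> = 4 * (mean_curvature X p)\<^sup>2 * W ^ 3"
    unfolding W by (simp add: power2_eq_square power3_eq_cube)
  finally show ?thesis
    unfolding Q_def W_def C_def T_def U_def .
qed

text \<open>Surfaces written as a circle of radius \<open>1 / e\<close> in the plane of the last two coordinates plus a
  displacement \<open>(p, 0, s)\<close> in the moving frame.\<close>

locale framed_surface =
  fixes e :: real and u z zt :: "real \<Rightarrow> real"
    and p pt ph ptt pth phh s st sh stt sth shh :: "real \<times> real \<Rightarrow> real"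
  assumes e: "e \<noteq> 0"
    and u: "\<And>t. (u has_real_derivative e * z t) (at t)"
    and z: "\<And>t. (z has_real_derivative zt t) (at t)"
    and p: "\<And>t \<theta>. ((\<lambda>r. p (r, \<theta>)) has_real_derivative pt (t, \<theta>)) (at t)"
      "\<And>t \<theta>. ((\<lambda>r. p (t, r)) has_real_derivative ph (t, \<theta>)) (at \<theta>)"
      "\<And>t \<theta>. ((\<lambda>r. pt (r, \<theta>)) has_real_derivative ptt (t, \<theta>)) (at t)"
      "\<And>t \<theta>. ((\<lambda>r. pt (t, r)) has_real_derivative pth (t, \<theta>)) (at \<theta>)"
      "\<And>t \<theta>. ((\<lambda>r. ph (t, r)) has_real_derivative phh (t, \<theta>)) (at \<theta>)"
    and s: "\<And>t \<theta>. ((\<lambda>r. s (r, \<theta>)) has_real_derivative st (t, \<theta>)) (at t)"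
      "\<And>t \<theta>. ((\<lambda>r. s (t, r)) has_real_derivative sh (t, \<theta>)) (at \<theta>)"
      "\<And>t \<theta>. ((\<lambda>r. st (r, \<theta>)) has_real_derivative stt (t, \<theta>)) (at t)"
      "\<And>t \<theta>. ((\<lambda>r. st (t, r)) has_real_derivative sth (t, \<theta>)) (at \<theta>)"
      "\<And>t \<theta>. ((\<lambda>r. sh (t, r)) has_real_derivative shh (t, \<theta>)) (at \<theta>)"
begin

text \<open>(sin \<theta>, cos \<theta>, 0) / e is the point \<open>r\<close> / e of the core
  circle, written in the moving frame.\<close>

definition Y :: "real \<times> real \<Rightarrow> real^3" where
  "Y = (\<lambda>(t, \<theta>). fr (u t) \<theta> (p (t, \<theta>) + sin \<theta> / e) (cos \<theta> / e) (s (t, \<theta>)))"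

definition T1 where "T1 = (\<lambda>(t, \<theta>). pt (t, \<theta>) - e * z t * sin \<theta> * s (t, \<theta>))"
definition T2 where "T2 = (\<lambda>(t, \<theta>). - (e * z t * cos \<theta> * s (t, \<theta>)))"
definition T3 where "T3 = (\<lambda>(t, \<theta>). z t + st (t, \<theta>) + e * z t * sin \<theta> * p (t, \<theta>))"

definition T1h where "T1h = (\<lambda>(t, \<theta>). pth (t, \<theta>) - e * z t * (cos \<theta> * s (t, \<theta>) + sin \<theta> * sh (t, \<theta>)))"
definition T2h where "T2h = (\<lambda>(t, \<theta>). e * z t * (sin \<theta> * s (t, \<theta>) - cos \<theta> * sh (t, \<theta>)))"
definition T3h where "T3h = (\<lambda>(t, \<theta>). sth (t, \<theta>) + e * z t * (cos \<theta> * p (t, \<theta>) + sin \<theta> * ph (t, \<theta>)))"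

definition T1t where "T1t = (\<lambda>(t, \<theta>). ptt (t, \<theta>) - e * sin \<theta> * (zt t * s (t, \<theta>) + z t * st (t, \<theta>)))"
definition T2t where "T2t = (\<lambda>(t, \<theta>). - (e * cos \<theta> * (zt t * s (t, \<theta>) + z t * st (t, \<theta>))))"
definition T3t where "T3t = (\<lambda>(t, \<theta>). zt t + stt (t, \<theta>) + e * sin \<theta> * (zt t * p (t, \<theta>) + z t * pt (t, \<theta>)))"

lemma T_deriv_theta:
  "((\<lambda>r. T1 (t, r)) has_real_derivative T1h (t, \<theta>)) (at \<theta>)"
  "((\<lambda>r. T2 (t, r)) has_real_derivative T2h (t, \<theta>)) (at \<theta>)"
  "((\<lambda>r. T3 (t, r)) has_real_derivative T3h (t, \<theta>)) (at \<theta>)"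
  unfolding T1_def T2_def T3_def T1h_def T2h_def T3h_def
  by (auto intro!: derivative_eq_intros p s simp: algebra_simps)

lemma T_deriv_t:
  "((\<lambda>r. T1 (r, \<theta>)) has_real_derivative T1t (t, \<theta>)) (at t)"
  "((\<lambda>r. T2 (r, \<theta>)) has_real_derivative T2t (t, \<theta>)) (at t)"
  "((\<lambda>r. T3 (r, \<theta>)) has_real_derivative T3t (t, \<theta>)) (at t)"
  unfolding T1_def T2_def T3_def T1t_def T2t_def T3t_def
  by (auto intro!: derivative_eq_intros p s z simp: algebra_simps)

lemma d_t_Y: "d_t Y = (\<lambda>(t, \<theta>). fr (u t) \<theta> (T1 (t, \<theta>)) (T2 (t, \<theta>)) (T3 (t, \<theta>)))"
proof (rule d_t_eqI)
  fix t \<theta>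
  have pd: "((\<lambda>t. p (t, \<theta>) + sin \<theta> / e) has_real_derivative pt (t, \<theta>)) (at t)"
    by (auto intro!: derivative_eq_intros p)
  have "((\<lambda>t. fr (u t) \<theta> (p (t, \<theta>) + sin \<theta> / e) (cos \<theta> / e) (s (t, \<theta>))) has_vector_derivative
      fr (u t) \<theta> (pt (t, \<theta>) - e * z t * sin \<theta> * s (t, \<theta>)) (0 - e * z t * cos \<theta> * s (t, \<theta>))
        (st (t, \<theta>) + e * z t * (sin \<theta> * (p (t, \<theta>) + sin \<theta> / e) + cos \<theta> * (cos \<theta> / e)))) (at t)"
    by (rule fr_deriv_angle[OF u pd _ s(1)]) simp
  \<comment> \<open>The large quantities 1/e cancel: moving along the core circle contributes
    exactly \<open>z t\<close>. From here on all derivatives are polynomial in \<open>e\<close>,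
    although the surface itself escapes to infinity as \<open>e\<close> tends to 0.\<close>
  moreover have "st (t, \<theta>) + e * z t * (sin \<theta> * (p (t, \<theta>) + sin \<theta> / e) + cos \<theta> * (cos \<theta> / e)) = T3 (t, \<theta>)"
  proof -
    have "e * z t * (sin \<theta> * (p (t, \<theta>) + sin \<theta> / e) + cos \<theta> * (cos \<theta> / e))
      = z t * ((cos \<theta>)\<^sup>2 + (sin \<theta>)\<^sup>2) + e * z t * sin \<theta> * p (t, \<theta>)"
    proof -
      have "e * inverse e = 1" using e by simp
      then show ?thesis unfolding divide_inverse by algebra
    qed
    then show ?thesis by (simp only: T3_def trig_norm) simp
  qed
  ultimately show "((\<lambda>s. Y (s, \<theta>)) has_vector_derivative
     (case (t, \<theta>) of (t, \<theta>) \<Rightarrow> fr (u t) \<theta> (T1 (t, \<theta>)) (T2 (t, \<theta>)) (T3 (t, \<theta>)))) (at t)"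
    by (simp add: Y_def T1_def T2_def)
qed

lemma d_theta_Y: "d_\<theta> Y = (\<lambda>(t, \<theta>). fr (u t) \<theta> (ph (t, \<theta>)) (p (t, \<theta>)) (sh (t, \<theta>)))"
proof (rule d_theta_eqI)
  fix t \<theta>
  have pd: "((\<lambda>\<theta>. p (t, \<theta>) + sin \<theta> / e) has_real_derivative ph (t, \<theta>) + cos \<theta> / e) (at \<theta>)"
    using e by (auto intro!: derivative_eq_intros p)
  have cd: "((\<lambda>\<theta>. cos \<theta> / e) has_real_derivative - sin \<theta> / e) (at \<theta>)"
    using e by (auto intro!: derivative_eq_intros)
  from fr_deriv_theta[OF pd cd s(2), of "u t"]
  show "((\<lambda>s. Y (t, s)) has_vector_derivative
     (case (t, \<theta>) of (t, \<theta>) \<Rightarrow> fr (u t) \<theta> (ph (t, \<theta>)) (p (t, \<theta>)) (sh (t, \<theta>)))) (at \<theta>)"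
    by (simp add: Y_def)
qed

lemma d_theta_theta_Y:
  "d_\<theta> (d_\<theta> Y) = (\<lambda>(t, \<theta>). fr (u t) \<theta> (phh (t, \<theta>) - p (t, \<theta>)) (2 * ph (t, \<theta>)) (shh (t, \<theta>)))"
  unfolding d_theta_Y
proof (rule d_theta_eqI)
  fix t \<theta>
  from fr_deriv_theta[OF p(5)[of t \<theta>] p(2)[of t \<theta>] s(5)[of t \<theta>], of "u t"]
  show "((\<lambda>s. case (t, s) of (t, \<theta>) \<Rightarrow> fr (u t) \<theta> (ph (t, \<theta>)) (p (t, \<theta>)) (sh (t, \<theta>))) has_vector_derivative
     (case (t, \<theta>) of (t, \<theta>) \<Rightarrow> fr (u t) \<theta> (phh (t, \<theta>) - p (t, \<theta>)) (2 * ph (t, \<theta>)) (shh (t, \<theta>)))) (at \<theta>)"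
    by simp
qed

lemma d_theta_t_Y:
  "d_\<theta> (d_t Y) = (\<lambda>(t, \<theta>). fr (u t) \<theta> (T1h (t, \<theta>) - T2 (t, \<theta>)) (T2h (t, \<theta>) + T1 (t, \<theta>)) (T3h (t, \<theta>)))"
  unfolding d_t_Y
proof (rule d_theta_eqI)
  fix t \<theta>
  from fr_deriv_theta[OF T_deriv_theta[of t \<theta>], of "u t"]
  show "((\<lambda>s. case (t, s) of (t, \<theta>) \<Rightarrow> fr (u t) \<theta> (T1 (t, \<theta>)) (T2 (t, \<theta>)) (T3 (t, \<theta>))) has_vector_derivative
     (case (t, \<theta>) of (t, \<theta>) \<Rightarrow> fr (u t) \<theta> (T1h (t, \<theta>) - T2 (t, \<theta>)) (T2h (t, \<theta>) + T1 (t, \<theta>)) (T3h (t, \<theta>)))) (at \<theta>)"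
    by simp
qed

lemma d_t_t_Y:
  "d_t (d_t Y) = (\<lambda>(t, \<theta>). fr (u t) \<theta> (T1t (t, \<theta>) - e * z t * sin \<theta> * T3 (t, \<theta>))
     (T2t (t, \<theta>) - e * z t * cos \<theta> * T3 (t, \<theta>))
     (T3t (t, \<theta>) + e * z t * (sin \<theta> * T1 (t, \<theta>) + cos \<theta> * T2 (t, \<theta>))))"
  unfolding d_t_Y
proof (rule d_t_eqI)
  fix t \<theta>
  from fr_deriv_angle[OF u[of t] T_deriv_t[of \<theta> t], of \<theta>]
  show "((\<lambda>s. case (s, \<theta>) of (t, \<theta>) \<Rightarrow> fr (u t) \<theta> (T1 (t, \<theta>)) (T2 (t, \<theta>)) (T3 (t, \<theta>))) has_vector_derivative
     (case (t, \<theta>) of (t, \<theta>) \<Rightarrow> fr (u t) \<theta> (T1t (t, \<theta>) - e * z t * sin \<theta> * T3 (t, \<theta>))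
     (T2t (t, \<theta>) - e * z t * cos \<theta> * T3 (t, \<theta>))
     (T3t (t, \<theta>) + e * z t * (sin \<theta> * T1 (t, \<theta>) + cos \<theta> * T2 (t, \<theta>))))) (at t)"
    by simp
qed

definition "C1 = (\<lambda>q. T2 q * sh q - T3 q * p q)"
definition "C2 = (\<lambda>q. T3 q * ph q - T1 q * sh q)"
definition "C3 = (\<lambda>q. T1 q * p q - T2 q * ph q)"
definition "EE = (\<lambda>q. T1 q * T1 q + T2 q * T2 q + T3 q * T3 q)"
definition "FF = (\<lambda>q. T1 q * ph q + T2 q * p q + T3 q * sh q)"
definition "GG = (\<lambda>q. ph q * ph q + p q * p q + sh q * sh q)"

definition "tt1 = (\<lambda>q. T1t q - e * z (fst q) * sin (snd q) * T3 q)"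
definition "tt2 = (\<lambda>q. T2t q - e * z (fst q) * cos (snd q) * T3 q)"
definition "tt3 = (\<lambda>q. T3t q + e * z (fst q) * (sin (snd q) * T1 q + cos (snd q) * T2 q))"

text \<open>Inner and cross products see only the frame components, so apart from the argument of
  \<open>H\<close> the equation contains neither the angle \<open>u\<close> nor 1/e.\<close>

lemma curvature_equation:
  assumes "has_mean_curvature Y H"
  shows "(EE q * ((phh q - p q) * C1 q + 2 * ph q * C2 q + shh q * C3 q)
        - 2 * FF q * ((T1h q - T2 q) * C1 q + (T2h q + T1 q) * C2 q + T3h q * C3 q)
        + GG q * (tt1 q * C1 q + tt2 q * C2 q + tt3 q * C3 q))\<^sup>2
      = 4 * (H (Y q))\<^sup>2 * (EE q * GG q - (FF q)\<^sup>2) ^ 3"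
proof -
  obtain t \<theta> where q: "q = (t, \<theta>)" by (cases q)
  have "cross3 (d_t Y q) (d_\<theta> Y q) \<noteq> 0" and M: "mean_curvature Y q = H (Y q)"
    using assms unfolding has_mean_curvature_def by blast+
  from mean_curvature_squared[OF this(1)] M show ?thesis
    unfolding d_theta_theta_Y d_theta_t_Y d_t_t_Y
    unfolding d_t_Y d_theta_Y
    unfolding q prod.case fr_cross fr_inner fr_norm_sq
    by (simp add: q C1_def C2_def C3_def EE_def FF_def GG_def tt1_def tt2_def tt3_def power2_eq_square)
qed

end

section \<open>Normal graphs over Delaunay tori\<close>

text \<open>Expressing the derivative through the cube of the function itself makes all derivatives
  of \<kappa> polynomials in \<kappa> and the derivatives of \<open>Q\<close>.\<close>

lemma has_real_derivative_inverse_sqrt: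
  assumes "(f has_real_derivative f') (at t)" "f t > 0"
  shows "((\<lambda>t. 1 / sqrt (f t)) has_real_derivative (- ((1 / sqrt (f t)) ^ 3) * f' / 2)) (at t)"
proof -
  have "((\<lambda>t. sqrt (f t)) has_real_derivative inverse (sqrt (f t)) / 2 * f') (at t)"
    using assms by (intro DERIV_chain2[OF DERIV_real_sqrt])
  from DERIV_inverse'[OF this] assms(2)
  have "((\<lambda>t. inverse (sqrt (f t))) has_real_derivative
     - (inverse (sqrt (f t)) * (inverse (sqrt (f t)) / 2 * f') * inverse (sqrt (f t)))) (at t)" by simp
  moreover have "- (k * (k / 2 * f') * k) = - (k ^ 3) * f' / 2" for k
    by (simp add: power3_eq_cube)
  ultimately show ?thesis by (simp only: inverse_eq_divide)
qed

locale torus = del_small a for a +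
  fixes n :: nat and \<phi> :: "real \<times> real \<Rightarrow> real"
  assumes n_ge: "n \<ge> 100" and C2: "C2_plane \<phi>"
begin

definition e :: real where "e = pi / (real n * del_h a)"

abbreviation "x \<equiv> del_x a"
abbreviation "y \<equiv> del_y a"
abbreviation "\<gamma> \<equiv> del_\<gamma> a"

text \<open>Suffixes \<open>t\<close> and \<open>h\<close> denote derivatives in \<open>t\<close> and \<open>\<theta>\<close>; \<open>x2\<close> and \<open>y2\<close> are the second and third
  derivatives of \<open>x\<close>, and \<open>\<zeta> = z'\<close>. In the moving frame the unnormalised normal is \<open>(- K, 0, y)\<close> with
  \<open>K = (1 + e x sin \<theta>) \<zeta>\<close> and squared length \<open>Q\<close>; in terms of \<open>\<eta> = \<phi> / sqrt Q\<close> instead of \<open>\<phi>\<close> the surface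
  depends polynomially on the data.\<close>

definition "x2 t = (1 + 2 * \<gamma>) * x t - 2 * x t ^ 3"
definition "y2 t = (1 + 2 * \<gamma>) * y t - 6 * (x t)\<^sup>2 * y t"
definition "\<zeta> t = (x t)\<^sup>2 - \<gamma>"
definition "\<zeta>t t = 2 * x t * y t"
definition "\<zeta>tt t = 2 * (y t)\<^sup>2 + 2 * x t * x2 t"
definition "m t = x t * \<zeta> t"
definition "mt t = y t * \<zeta> t + x t * \<zeta>t t"
definition "mtt t = x2 t * \<zeta> t + 2 * y t * \<zeta>t t + x t * \<zeta>tt t"

definition "K = (\<lambda>(t, \<theta>). \<zeta> t + e * (sin \<theta> * m t))"
definition "Kt = (\<lambda>(t, \<theta>). \<zeta>t t + e * (sin \<theta> * mt t))"
definition "Kh = (\<lambda>(t, \<theta>). e * (cos \<theta> * m t))"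
definition "Ktt = (\<lambda>(t, \<theta>). \<zeta>tt t + e * (sin \<theta> * mtt t))"
definition "Kth = (\<lambda>(t, \<theta>). e * (cos \<theta> * mt t))"
definition "Khh = (\<lambda>(t, \<theta>). - e * (sin \<theta> * m t))"

definition "Q = (\<lambda>(t, \<theta>). (y t)\<^sup>2 + (K (t, \<theta>))\<^sup>2)"
definition "Qt = (\<lambda>(t, \<theta>). 2 * y t * x2 t + 2 * K (t, \<theta>) * Kt (t, \<theta>))"
definition "Qh = (\<lambda>q. 2 * K q * Kh q)"
definition "Qtt = (\<lambda>(t, \<theta>). 2 * (x2 t)\<^sup>2 + 2 * y t * y2 t + 2 * (Kt (t, \<theta>))\<^sup>2 + 2 * K (t, \<theta>) * Ktt (t, \<theta>))"
definition "Qth = (\<lambda>q. 2 * Kh q * Kt q + 2 * K q * Kth q)"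
definition "Qhh = (\<lambda>q. 2 * (Kh q)\<^sup>2 + 2 * K q * Khh q)"

definition "\<kappa> = (\<lambda>q. 1 / sqrt (Q q))"
definition "\<kappa>t = (\<lambda>q. - (\<kappa> q ^ 3) * Qt q / 2)"
definition "\<kappa>h = (\<lambda>q. - (\<kappa> q ^ 3) * Qh q / 2)"
definition "\<kappa>tt = (\<lambda>q. - (3 * (\<kappa> q)\<^sup>2 * \<kappa>t q * Qt q + \<kappa> q ^ 3 * Qtt q) / 2)"
definition "\<kappa>th = (\<lambda>q. - (3 * (\<kappa> q)\<^sup>2 * \<kappa>h q * Qt q + \<kappa> q ^ 3 * Qth q) / 2)"
definition "\<kappa>hh = (\<lambda>q. - (3 * (\<kappa> q)\<^sup>2 * \<kappa>h q * Qh q + \<kappa> q ^ 3 * Qhh q) / 2)"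

definition "\<eta> = (\<lambda>q. \<phi> q * \<kappa> q)"
definition "\<eta>t = (\<lambda>q. d_t \<phi> q * \<kappa> q + \<phi> q * \<kappa>t q)"
definition "\<eta>h = (\<lambda>q. d_\<theta> \<phi> q * \<kappa> q + \<phi> q * \<kappa>h q)"
definition "\<eta>tt = (\<lambda>q. d_t (d_t \<phi>) q * \<kappa> q + 2 * d_t \<phi> q * \<kappa>t q + \<phi> q * \<kappa>tt q)"
definition "\<eta>th = (\<lambda>q. d_\<theta> (d_t \<phi>) q * \<kappa> q + d_t \<phi> q * \<kappa>h q + d_\<theta> \<phi> q * \<kappa>t q + \<phi> q * \<kappa>th q)"
definition "\<eta>hh = (\<lambda>q. d_\<theta> (d_\<theta> \<phi>) q * \<kappa> q + 2 * d_\<theta> \<phi> q * \<kappa>h q + \<phi> q * \<kappa>hh q)"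

definition "P = (\<lambda>(t, \<theta>). x t - \<eta> (t, \<theta>) * K (t, \<theta>))"
definition "Pt = (\<lambda>(t, \<theta>). y t - (\<eta>t (t, \<theta>) * K (t, \<theta>) + \<eta> (t, \<theta>) * Kt (t, \<theta>)))"
definition "Ph = (\<lambda>q. - (\<eta>h q * K q + \<eta> q * Kh q))"
definition "Ptt = (\<lambda>(t, \<theta>). x2 t - (\<eta>tt (t, \<theta>) * K (t, \<theta>) + 2 * \<eta>t (t, \<theta>) * Kt (t, \<theta>) + \<eta> (t, \<theta>) * Ktt (t, \<theta>)))"
definition "Pth = (\<lambda>q. - (\<eta>th q * K q + \<eta>t q * Kh q + \<eta>h q * Kt q + \<eta> q * Kth q))"
definition "Phh = (\<lambda>q. - (\<eta>hh q * K q + 2 * \<eta>h q * Kh q + \<eta> q * Khh q))"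

definition "S = (\<lambda>(t, \<theta>). \<eta> (t, \<theta>) * y t)"
definition "St = (\<lambda>(t, \<theta>). \<eta>t (t, \<theta>) * y t + \<eta> (t, \<theta>) * x2 t)"
definition "Sh = (\<lambda>(t, \<theta>). \<eta>h (t, \<theta>) * y t)"
definition "Stt = (\<lambda>(t, \<theta>). \<eta>tt (t, \<theta>) * y t + 2 * \<eta>t (t, \<theta>) * x2 t + \<eta> (t, \<theta>) * y2 t)"
definition "Sth = (\<lambda>(t, \<theta>). \<eta>th (t, \<theta>) * y t + \<eta>h (t, \<theta>) * x2 t)"
definition "Shh = (\<lambda>(t, \<theta>). \<eta>hh (t, \<theta>) * y t)"

lemma e_pos: "e > 0"
  using h_bounds n_ge by (simp add: e_def)

lemma e_le: "e \<le> 40 / real n"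
proof -
  have "1 \<le> del_h a * 10" using h_bounds by simp
  then have "pi \<le> 4 * (del_h a * 10)" using pi_less_4 by linarith
  then have "pi / (real n * del_h a) \<le> 4 * (del_h a * 10) / (real n * del_h a)"
    using h_bounds n_ge by (intro divide_right_mono) auto
  also have "\<dots> = 40 / real n" using h_bounds n_ge by (simp add: field_simps)
  finally show ?thesis by (simp add: e_def)
qed

lemma e_ge: "e \<ge> 1 / (2 * real n)"
proof -
  have "1 / (2 * real n) = (1/2) * (1 / real n)" by simp
  also have "\<dots> \<le> (pi / del_h a) * (1 / real n)"
  proof (rule mult_right_mono)
    show "1/2 \<le> pi / del_h a" using h_bounds pi_gt3 by (simp add: field_simps)
  qed simp
  also have "\<dots> = e" by (simp add: e_def)
  finally show ?thesis .
qed

lemma x_le_2: "x t \<le> 2"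
  using x_le[of t] a_small by simp

text \<open>The left side is \<open>e\<close> times the distance of a point of the torus from the
  axis of the core circle. With n \<ge> 100 one has e x \<le> 8/10, so the torus stays clear of that
  axis.\<close>

lemma rho_ge: "1 + e * x t * sin \<theta> \<ge> 1 / 10"
proof -
  have "40 / real n \<le> 40 / 100" using n_ge by (intro divide_left_mono) auto
  then have "e \<le> 4/10" using e_le by simp
  then have "e * x t \<le> 4/10 * 2" using x_le_2[of t] x_pos[of t] e_pos by (intro mult_mono) auto
  moreover have "e * x t * (- sin \<theta>) \<le> e * x t * 1"
    using e_pos x_pos[of t] by (intro mult_left_mono) (auto simp: mult_nonneg_nonneg)
  ultimately have "e * x t * (- sin \<theta>) \<le> 8/10" by linarith
  then show ?thesis by simp
qed

lemma K_eq: "K (t, \<theta>) = (1 + e * x t * sin \<theta>) * \<zeta> t"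
  by (simp add: K_def m_def algebra_simps)

lemma energy_zeta: "(y t)\<^sup>2 = (x t)\<^sup>2 - (\<zeta> t)\<^sup>2"
  using energy by (simp add: \<zeta>_def)

text \<open>Conformality gives y^2 + \<zeta>^2 = x^2, and bending only multiplies \<zeta> by a
  factor of at least 1/10. The resulting bound \<kappa> \<le> 10 / x is what later preserves the
  weight of the norm.\<close>

lemma Q_ge: "Q (t, \<theta>) \<ge> (x t)\<^sup>2 / 100"
proof -
  have "(1/10)\<^sup>2 \<le> (1 + e * x t * sin \<theta>)\<^sup>2" using rho_ge by (intro power_mono) auto
  then have "(1/10)\<^sup>2 * (\<zeta> t)\<^sup>2 \<le> (1 + e * x t * sin \<theta>)\<^sup>2 * (\<zeta> t)\<^sup>2" by (intro mult_right_mono) auto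
  then have "(\<zeta> t)\<^sup>2 / 100 \<le> (K (t, \<theta>))\<^sup>2" unfolding K_eq power_mult_distrib by (simp add: power_divide)
  from add_mono[OF _ this, of "(y t)\<^sup>2 / 100" "(y t)\<^sup>2"]
  have "((y t)\<^sup>2 + (\<zeta> t)\<^sup>2) / 100 \<le> Q (t, \<theta>)"
    unfolding Q_def prod.case by (simp add: add_divide_distrib)
  then show ?thesis using energy_zeta[of t] by simp
qed

lemma Q_pos: "Q q > 0"
proof (cases q)
  case (Pair t \<theta>)
  have "(x t)\<^sup>2 / 100 > 0" using x_pos[of t] by simp
  with Q_ge[of t \<theta>] have "Q (t, \<theta>) > 0" by (rule less_le_trans[rotated])
  then show ?thesis by (simp add: Pair)
qed

lemma base_deriv:
  "(x has_real_derivative y t) (at t)"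
  "(y has_real_derivative x2 t) (at t)"
  "(x2 has_real_derivative y2 t) (at t)"
  "(\<zeta> has_real_derivative \<zeta>t t) (at t)"
  "(\<zeta>t has_real_derivative \<zeta>tt t) (at t)"
  "(m has_real_derivative mt t) (at t)"
  "(mt has_real_derivative mtt t) (at t)"
proof -
  show X: "(x has_real_derivative y t) (at t)" for t by (rule x_deriv)
  show Y: "(y has_real_derivative x2 t) (at t)" for t unfolding x2_def by (rule y_deriv)
  show "(x2 has_real_derivative y2 t) (at t)"
    unfolding x2_def[abs_def] y2_def by (auto intro!: derivative_eq_intros X simp: algebra_simps)
  show Z: "(\<zeta> has_real_derivative \<zeta>t t) (at t)" for t
    unfolding \<zeta>_def[abs_def] \<zeta>t_def by (auto intro!: derivative_eq_intros X)
  show Z2: "(\<zeta>t has_real_derivative \<zeta>tt t) (at t)" for t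
    unfolding \<zeta>t_def[abs_def] \<zeta>tt_def
    by (auto intro!: derivative_eq_intros X Y simp: algebra_simps power2_eq_square)
  show "(m has_real_derivative mt t) (at t)"
    unfolding m_def[abs_def] mt_def by (auto intro!: derivative_eq_intros X Z)
  show "(mt has_real_derivative mtt t) (at t)"
    unfolding mt_def[abs_def] mtt_def by (auto intro!: derivative_eq_intros X Y Z Z2)
qed

lemma K_deriv:
  "((\<lambda>r. K (r, \<theta>)) has_real_derivative Kt (t, \<theta>)) (at t)"
  "((\<lambda>r. K (t, r)) has_real_derivative Kh (t, \<theta>)) (at \<theta>)"
  "((\<lambda>r. Kt (r, \<theta>)) has_real_derivative Ktt (t, \<theta>)) (at t)"
  "((\<lambda>r. Kt (t, r)) has_real_derivative Kth (t, \<theta>)) (at \<theta>)"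
  "((\<lambda>r. Kh (t, r)) has_real_derivative Khh (t, \<theta>)) (at \<theta>)"
  unfolding K_def Kt_def Kh_def Ktt_def Kth_def Khh_def
  by (auto intro!: derivative_eq_intros base_deriv)

lemma Q_deriv:
  "((\<lambda>r. Q (r, \<theta>)) has_real_derivative Qt (t, \<theta>)) (at t)"
  "((\<lambda>r. Q (t, r)) has_real_derivative Qh (t, \<theta>)) (at \<theta>)"
  "((\<lambda>r. Qt (r, \<theta>)) has_real_derivative Qtt (t, \<theta>)) (at t)"
  "((\<lambda>r. Qt (t, r)) has_real_derivative Qth (t, \<theta>)) (at \<theta>)"
  "((\<lambda>r. Qh (t, r)) has_real_derivative Qhh (t, \<theta>)) (at \<theta>)"
  unfolding Q_def Qt_def Qh_def Qtt_def Qth_def Qhh_def prod.case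
  by (auto intro!: derivative_eq_intros base_deriv K_deriv simp: power2_eq_square)

lemma kappa_deriv1:
  "((\<lambda>r. \<kappa> (r, \<theta>)) has_real_derivative \<kappa>t (t, \<theta>)) (at t)"
  "((\<lambda>r. \<kappa> (t, r)) has_real_derivative \<kappa>h (t, \<theta>)) (at \<theta>)"
  unfolding \<kappa>_def \<kappa>t_def \<kappa>h_def
  by (rule has_real_derivative_inverse_sqrt[OF Q_deriv(1) Q_pos] has_real_derivative_inverse_sqrt[OF Q_deriv(2) Q_pos])+

lemma kappa_deriv:
  "((\<lambda>r. \<kappa> (r, \<theta>)) has_real_derivative \<kappa>t (t, \<theta>)) (at t)"
  "((\<lambda>r. \<kappa> (t, r)) has_real_derivative \<kappa>h (t, \<theta>)) (at \<theta>)"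
  "((\<lambda>r. \<kappa>t (r, \<theta>)) has_real_derivative \<kappa>tt (t, \<theta>)) (at t)"
  "((\<lambda>r. \<kappa>t (t, r)) has_real_derivative \<kappa>th (t, \<theta>)) (at \<theta>)"
  "((\<lambda>r. \<kappa>h (t, r)) has_real_derivative \<kappa>hh (t, \<theta>)) (at \<theta>)"
proof -
  show "((\<lambda>r. \<kappa>t (r, \<theta>)) has_real_derivative \<kappa>tt (t, \<theta>)) (at t)"
    unfolding \<kappa>t_def \<kappa>tt_def
    by (auto intro!: derivative_eq_intros kappa_deriv1 Q_deriv simp: \<kappa>t_def field_simps)
  show "((\<lambda>r. \<kappa>t (t, r)) has_real_derivative \<kappa>th (t, \<theta>)) (at \<theta>)"
    unfolding \<kappa>t_def \<kappa>th_def
    by (auto intro!: derivative_eq_intros kappa_deriv1 Q_deriv simp: \<kappa>h_def field_simps)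
  show "((\<lambda>r. \<kappa>h (t, r)) has_real_derivative \<kappa>hh (t, \<theta>)) (at \<theta>)"
    unfolding \<kappa>h_def \<kappa>hh_def
    by (auto intro!: derivative_eq_intros kappa_deriv1 Q_deriv simp: \<kappa>h_def field_simps)
qed (rule kappa_deriv1)+

end

text \<open>Brings the partial derivatives into the form that the differentiation rules for real
  functions consume.\<close>

lemma C1_plane_deriv:
  fixes f :: "real \<times> real \<Rightarrow> real"
  assumes "C1_plane f"
  shows "((\<lambda>r. f (r, \<theta>)) has_real_derivative d_t f (t, \<theta>)) (at t)"
    "((\<lambda>r. f (t, r)) has_real_derivative d_\<theta> f (t, \<theta>)) (at \<theta>)"
  using assms unfolding C1_plane_def d_t_def d_\<theta>_def
  by (auto simp: has_real_derivative_iff_has_vector_derivative vector_derivative_works[symmetric])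

text \<open>Continuity of the partial derivatives gives total differentiability, hence continuity of
  the function; the double integrals of the test argument rely on it.\<close>

lemma C1_plane_continuous:
  fixes f :: "real \<times> real \<Rightarrow> real"
  assumes "C1_plane f"
  shows "continuous_on UNIV f"
proof -
  have "isCont f (t, \<theta>)" for t \<theta>
  proof -
    let ?D = "\<lambda>t \<theta>. blinfun_scaleR_left (d_\<theta> f (t, \<theta>)) :: real \<Rightarrow>\<^sub>L real"
    have 1: "((\<lambda>r. f (r, \<theta>)) has_derivative (\<lambda>u. u * d_t f (t, \<theta>))) (at t within UNIV)"
      using C1_plane_deriv(1)[OF assms, of \<theta> t] by (simp add: has_field_derivative_def mult_commute_abs)
    have 2: "((\<lambda>r. f (v, r)) has_derivative blinfun_apply (?D v w)) (at w within UNIV)" for v w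
    proof -
      have "blinfun_apply (?D v w) = (*) (d_\<theta> f (v, w))" by (auto simp: mult.commute)
      then show ?thesis
        using C1_plane_deriv(2)[OF assms, of v w] by (simp add: has_field_derivative_def)
    qed
    have "continuous_on UNIV (d_\<theta> f)" using assms by (simp add: C1_plane_def)
    then have "isCont (d_\<theta> f) (t, \<theta>)" by (simp add: continuous_on_eq_continuous_at)
    then have "isCont (\<lambda>q. blinfun_scaleR_left (d_\<theta> f q) :: real \<Rightarrow>\<^sub>L real) (t, \<theta>)"
      by (rule bounded_linear.isCont[OF bounded_linear_blinfun_scaleR_left])
    then have 3: "continuous (at (t, \<theta>) within UNIV \<times> UNIV) (\<lambda>(v, w). ?D v w)"
      by (simp add: case_prod_unfold)
    from has_derivative_continuous[OF has_derivative_partialsI[where f = "\<lambda>v w. f (v, w)", OF 1 2 3]]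
    show ?thesis by (simp add: case_prod_unfold)
  qed
  then show ?thesis by (auto intro!: continuous_at_imp_continuous_on)
qed

section \<open>The perturbed torus in the moving frame\<close>

context torus
begin

lemma phi_deriv:
  "((\<lambda>r. \<phi> (r, \<theta>)) has_real_derivative d_t \<phi> (t, \<theta>)) (at t)"
  "((\<lambda>r. \<phi> (t, r)) has_real_derivative d_\<theta> \<phi> (t, \<theta>)) (at \<theta>)"
  "((\<lambda>r. d_t \<phi> (r, \<theta>)) has_real_derivative d_t (d_t \<phi>) (t, \<theta>)) (at t)"
  "((\<lambda>r. d_t \<phi> (t, r)) has_real_derivative d_\<theta> (d_t \<phi>) (t, \<theta>)) (at \<theta>)"
  "((\<lambda>r. d_\<theta> \<phi> (t, r)) has_real_derivative d_\<theta> (d_\<theta> \<phi>) (t, \<theta>)) (at \<theta>)"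
  using C2 unfolding C2_plane_def by (blast intro: C1_plane_deriv)+

lemma eta_deriv:
  "((\<lambda>r. \<eta> (r, \<theta>)) has_real_derivative \<eta>t (t, \<theta>)) (at t)"
  "((\<lambda>r. \<eta> (t, r)) has_real_derivative \<eta>h (t, \<theta>)) (at \<theta>)"
  "((\<lambda>r. \<eta>t (r, \<theta>)) has_real_derivative \<eta>tt (t, \<theta>)) (at t)"
  "((\<lambda>r. \<eta>t (t, r)) has_real_derivative \<eta>th (t, \<theta>)) (at \<theta>)"
  "((\<lambda>r. \<eta>h (t, r)) has_real_derivative \<eta>hh (t, \<theta>)) (at \<theta>)"
  unfolding \<eta>_def \<eta>t_def \<eta>h_def \<eta>tt_def \<eta>th_def \<eta>hh_def
  by (auto intro!: derivative_eq_intros phi_deriv kappa_deriv)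

lemma P_deriv:
  "((\<lambda>r. P (r, \<theta>)) has_real_derivative Pt (t, \<theta>)) (at t)"
  "((\<lambda>r. P (t, r)) has_real_derivative Ph (t, \<theta>)) (at \<theta>)"
  "((\<lambda>r. Pt (r, \<theta>)) has_real_derivative Ptt (t, \<theta>)) (at t)"
  "((\<lambda>r. Pt (t, r)) has_real_derivative Pth (t, \<theta>)) (at \<theta>)"
  "((\<lambda>r. Ph (t, r)) has_real_derivative Phh (t, \<theta>)) (at \<theta>)"
  unfolding P_def Pt_def Ph_def Ptt_def Pth_def Phh_def prod.case
  by (auto intro!: derivative_eq_intros eta_deriv K_deriv base_deriv)

lemma S_deriv:
  "((\<lambda>r. S (r, \<theta>)) has_real_derivative St (t, \<theta>)) (at t)"
  "((\<lambda>r. S (t, r)) has_real_derivative Sh (t, \<theta>)) (at \<theta>)"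
  "((\<lambda>r. St (r, \<theta>)) has_real_derivative Stt (t, \<theta>)) (at t)"
  "((\<lambda>r. St (t, r)) has_real_derivative Sth (t, \<theta>)) (at \<theta>)"
  "((\<lambda>r. Sh (t, r)) has_real_derivative Shh (t, \<theta>)) (at \<theta>)"
  unfolding S_def St_def Sh_def Stt_def Sth_def Shh_def prod.case
  by (auto intro!: derivative_eq_intros eta_deriv base_deriv)

lemma u_deriv: "((\<lambda>t. e * del_z a t) has_real_derivative e * \<zeta> t) (at t)"
  unfolding \<zeta>_def by (auto intro!: derivative_eq_intros z_deriv)

sublocale fs: framed_surface e "\<lambda>t. e * del_z a t" \<zeta> \<zeta>t P Pt Ph Ptt Pth Phh S St Sh Stt Sth Shh
  using e_pos by unfold_locales (auto intro: u_deriv base_deriv P_deriv S_deriv)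

text \<open>The unperturbed torus has radial displacement \<open>x\<close> and no axial one. Its
  first derivatives yield the normal along which the graph is taken.\<close>

interpretation X0: framed_surface e "\<lambda>t. e * del_z a t" \<zeta> \<zeta>t "\<lambda>(t, _). x t" "\<lambda>(t, _). y t" "\<lambda>_. 0"
    "\<lambda>(t, _). x2 t" "\<lambda>_. 0" "\<lambda>_. 0" "\<lambda>_. 0" "\<lambda>_. 0" "\<lambda>_. 0" "\<lambda>_. 0" "\<lambda>_. 0" "\<lambda>_. 0"
  using e_pos by unfold_locales (auto intro: u_deriv base_deriv)

lemma torus_X_eq: "torus_X n a = (\<lambda>(t, \<theta>). fr (e * del_z a t) \<theta> (x t + sin \<theta> / e) (cos \<theta> / e) 0)"
proof (rule ext, clarify)
  fix t \<theta>
  have r: "real n * del_h a / pi = 1 / e" by (simp add: e_def)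
  have u: "pi * del_z a t / (real n * del_h a) = e * del_z a t" by (simp add: e_def)
  have c: "(x t + sin \<theta> / e) * sin \<theta> + cos \<theta> / e * cos \<theta> = 1 / e + x t * sin \<theta>"
  proof -
    have "(x t + sin \<theta> / e) * sin \<theta> + cos \<theta> / e * cos \<theta> = ((cos \<theta>)\<^sup>2 + (sin \<theta>)\<^sup>2) / e + x t * sin \<theta>"
      by (simp only: power2_eq_square add_divide_distrib distrib_right) simp
    then show ?thesis by (simp only: trig_norm)
  qed
  have c1: "(x t + sin \<theta> / e) * cos \<theta> - cos \<theta> / e * sin \<theta> = x t * cos \<theta>"
    by (simp add: algebra_simps)
  show "torus_X n a (t, \<theta>) = fr (e * del_z a t) \<theta> (x t + sin \<theta> / e) (cos \<theta> / e) 0"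
    unfolding torus_X_def Let_def prod.case r u fr_def c c1 by simp
qed

lemma torus_X_Y: "torus_X n a = X0.Y"
  unfolding torus_X_eq X0.Y_def by (auto simp: fun_eq_iff)

lemma torus_N_eq: "torus_N n a (t, \<theta>) = fr (e * del_z a t) \<theta> (- K (t, \<theta>) * \<kappa> (t, \<theta>)) 0 (y t * \<kappa> (t, \<theta>))"
proof -
  let ?f = "fr (e * del_z a t) \<theta>"
  have T: "d_t (torus_X n a) (t, \<theta>) = ?f (y t) 0 (K (t, \<theta>))"
    unfolding torus_X_Y X0.d_t_Y by (simp add: X0.T1_def X0.T2_def X0.T3_def K_def m_def algebra_simps)
  have U: "d_\<theta> (torus_X n a) (t, \<theta>) = ?f 0 (x t) 0"
    unfolding torus_X_Y X0.d_theta_Y by simp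
  have C: "cross3 (d_t (torus_X n a) (t, \<theta>)) (d_\<theta> (torus_X n a) (t, \<theta>)) = ?f (- K (t, \<theta>) * x t) 0 (y t * x t)"
    unfolding T U fr_cross by simp
  have "(norm (?f (- K (t, \<theta>) * x t) 0 (y t * x t)))\<^sup>2 = (x t)\<^sup>2 * Q (t, \<theta>)"
    unfolding fr_norm_sq by (simp add: Q_def power_mult_distrib algebra_simps)
  also have "\<dots> = (x t * sqrt (Q (t, \<theta>)))\<^sup>2"
    using Q_pos[of "(t, \<theta>)"] by (simp add: power_mult_distrib)
  finally have "norm (?f (- K (t, \<theta>) * x t) 0 (y t * x t)) = x t * sqrt (Q (t, \<theta>))"
    using x_pos[of t] Q_pos[of "(t, \<theta>)"] by (simp add: power2_eq_iff_nonneg)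
  then show ?thesis
    unfolding torus_N_def normal_def C fr_scaleR using x_pos[of t]
    by (simp add: \<kappa>_def field_simps)
qed

lemma surface_eq: "(\<lambda>q. torus_X n a q + \<phi> q *\<^sub>R torus_N n a q) = fs.Y"
proof (rule ext, clarify)
  fix t \<theta>
  show "torus_X n a (t, \<theta>) + \<phi> (t, \<theta>) *\<^sub>R torus_N n a (t, \<theta>) = fs.Y (t, \<theta>)"
    unfolding torus_N_eq torus_X_eq fs.Y_def prod.case fr_scaleR fr_add
    by (simp add: P_def S_def \<eta>_def algebra_simps)
qed

text \<open>The product x \<eta> is the unknown of the limit equation. For vanishing bending
  \<open>Q\<close> equals x^2, so it is asymptotically \<phi> itself, and the second derivatives
  below are those produced by the linearisation.\<close>

definition "f = (\<lambda>(t, \<theta>). x t * \<eta> (t, \<theta>))"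
definition "ft = (\<lambda>(t, \<theta>). y t * \<eta> (t, \<theta>) + x t * \<eta>t (t, \<theta>))"
definition "fh = (\<lambda>(t, \<theta>). x t * \<eta>h (t, \<theta>))"
definition "ftt = (\<lambda>(t, \<theta>). x2 t * \<eta> (t, \<theta>) + 2 * y t * \<eta>t (t, \<theta>) + x t * \<eta>tt (t, \<theta>))"
definition "fhh = (\<lambda>(t, \<theta>). x t * \<eta>hh (t, \<theta>))"

lemma f_deriv:
  "((\<lambda>r. f (r, \<theta>)) has_real_derivative ft (t, \<theta>)) (at t)"
  "((\<lambda>r. ft (r, \<theta>)) has_real_derivative ftt (t, \<theta>)) (at t)"
  "((\<lambda>r. fh (t, r)) has_real_derivative fhh (t, \<theta>)) (at \<theta>)"
  unfolding f_def ft_def fh_def ftt_def fhh_def prod.case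
  by (auto intro!: derivative_eq_intros eta_deriv base_deriv)

section \<open>Regularity, periodicity and weighted bounds for the unknown of the limit
  equation\<close>

lemma base_continuous:
  "continuous_on UNIV (\<lambda>q::real \<times> real. x (fst q))" "continuous_on UNIV (\<lambda>q::real \<times> real. y (fst q))"
proof -
  have c: "continuous_on UNIV (\<lambda>q::real \<times> real. g (fst q))" if "continuous_on UNIV g" for g :: "real \<Rightarrow> real"
    by (rule continuous_on_compose2[OF that]) (auto intro: continuous_intros)
  show "continuous_on UNIV (\<lambda>q::real \<times> real. x (fst q))" "continuous_on UNIV (\<lambda>q::real \<times> real. y (fst q))"
    by (rule c, rule continuous_on_x, rule c, rule continuous_on_y)
qed

lemma phi_continuous:
  "continuous_on UNIV \<phi>" "continuous_on UNIV (d_t \<phi>)" "continuous_on UNIV (d_\<theta> \<phi>)"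
  "continuous_on UNIV (d_t (d_t \<phi>))" "continuous_on UNIV (d_\<theta> (d_\<theta> \<phi>))"
  using C2 C1_plane_continuous[of \<phi>] unfolding C2_plane_def C1_plane_def by blast+

lemma K_continuous:
  "continuous_on UNIV K" "continuous_on UNIV Kt" "continuous_on UNIV Kh"
  "continuous_on UNIV Ktt" "continuous_on UNIV Khh"
  unfolding K_def Kt_def Kh_def Ktt_def Khh_def m_def mt_def mtt_def \<zeta>_def \<zeta>t_def \<zeta>tt_def x2_def case_prod_unfold
  by (intro continuous_intros base_continuous)+

lemma Q_continuous:
  "continuous_on UNIV Q" "continuous_on UNIV Qt" "continuous_on UNIV Qh"
  "continuous_on UNIV Qtt" "continuous_on UNIV Qhh"
  unfolding Q_def Qt_def Qh_def Qtt_def Qhh_def x2_def y2_def case_prod_unfold prod.collapse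
  by (intro continuous_intros base_continuous K_continuous)+

lemma kappa_continuous:
  "continuous_on UNIV \<kappa>" "continuous_on UNIV \<kappa>t" "continuous_on UNIV \<kappa>h"
  "continuous_on UNIV \<kappa>tt" "continuous_on UNIV \<kappa>hh"
proof -
  have "sqrt (Q q) \<noteq> 0" for q using Q_pos[of q] by simp
  then show k: "continuous_on UNIV \<kappa>"
    unfolding \<kappa>_def by (intro continuous_intros Q_continuous) auto
  show t: "continuous_on UNIV \<kappa>t" and h: "continuous_on UNIV \<kappa>h"
    unfolding \<kappa>t_def \<kappa>h_def by (intro continuous_intros k Q_continuous; simp)+
  show "continuous_on UNIV \<kappa>tt" "continuous_on UNIV \<kappa>hh"
    unfolding \<kappa>tt_def \<kappa>hh_def by (intro continuous_intros k t h Q_continuous; simp)+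
qed

lemma f_continuous: "continuous_on UNIV f" "continuous_on UNIV ftt" "continuous_on UNIV fhh"
  unfolding f_def ftt_def fhh_def \<eta>_def \<eta>t_def \<eta>tt_def \<eta>hh_def x2_def case_prod_unfold prod.collapse
  by (intro continuous_intros base_continuous phi_continuous kappa_continuous)+

text \<open>Makes the integral of \<open>fhh\<close> over a full circle vanish.\<close>

lemma fh_periodic:
  assumes "\<And>t \<theta>. \<phi> (t, \<theta> + 2 * pi) = \<phi> (t, \<theta>)"
  shows "fh (t, pi) = fh (t, - pi)"
proof -
  have p: "\<phi> (t, pi) = \<phi> (t, - pi)" using assms[of t "- pi"] by simp
  have "((\<lambda>r. \<phi> (t, r)) has_real_derivative d_\<theta> \<phi> (t, pi)) (at (- pi + 2 * pi))"
    using phi_deriv(2)[of t pi] by simp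
  then have "((\<lambda>r. \<phi> (t, r + 2 * pi)) has_real_derivative d_\<theta> \<phi> (t, pi)) (at (- pi))"
    by (rule DERIV_shift[THEN iffD1])
  then have "((\<lambda>r. \<phi> (t, r)) has_real_derivative d_\<theta> \<phi> (t, pi)) (at (- pi))"
    by (simp only: assms)
  then have d: "d_\<theta> \<phi> (t, pi) = d_\<theta> \<phi> (t, - pi)"
    using phi_deriv(2)[of t "- pi"] by (rule DERIV_unique)
  have "K (t, pi) = K (t, - pi)" "Kh (t, pi) = Kh (t, - pi)"
    by (simp_all add: K_def Kh_def)
  then show ?thesis
    by (simp add: fh_def \<eta>h_def \<kappa>h_def \<kappa>_def Q_def Qh_def p d)
qed

lemma x_kappa: "x t * \<kappa> (t, \<theta>) \<le> 10" "\<kappa> (t, \<theta>) > 0"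
proof -
  have "sqrt ((x t)\<^sup>2 / 100) \<le> sqrt (Q (t, \<theta>))" using Q_ge[of t \<theta>] by (rule real_sqrt_le_mono)
  then have "x t / 10 \<le> sqrt (Q (t, \<theta>))" using x_pos[of t] by (simp add: real_sqrt_divide)
  moreover have "sqrt (Q (t, \<theta>)) > 0" using Q_pos by simp
  ultimately show "x t * \<kappa> (t, \<theta>) \<le> 10" "\<kappa> (t, \<theta>) > 0"
    by (simp_all add: \<kappa>_def field_simps)
qed

lemma y_le: "\<bar>y t\<bar> \<le> x t" and zeta_le: "\<bar>\<zeta> t\<bar> \<le> x t"
proof -
  have "(y t)\<^sup>2 \<le> (x t)\<^sup>2" "(\<zeta> t)\<^sup>2 \<le> (x t)\<^sup>2"
    using energy_zeta[of t] zero_le_power2[of "y t"] zero_le_power2[of "\<zeta> t"] by linarith+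
  then have "\<bar>y t\<bar> \<le> \<bar>x t\<bar>" "\<bar>\<zeta> t\<bar> \<le> \<bar>x t\<bar>" by (simp_all add: abs_le_square_iff)
  then show "\<bar>y t\<bar> \<le> x t" "\<bar>\<zeta> t\<bar> \<le> x t" using x_pos[of t] by simp_all
qed

lemma gamma_le: "\<bar>\<gamma>\<bar> \<le> 1/10"
proof -
  have "\<bar>a\<bar> * \<bar>1 + a\<bar> \<le> 1/1000 * 2" using a_small by (intro mult_mono) auto
  then show ?thesis by (simp add: del_\<gamma>_def abs_mult)
qed

text \<open>What counts is the factor x^2, uniform in t: together with x it balances \<kappa>^3 in x
  \<kappa>t.\<close>

lemma Qt_bound: "\<bar>Qt (t, \<theta>)\<bar> \<le> 80 * (x t)\<^sup>2"
proof -
  let ?X = "x t"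
  have X: "0 < ?X" "?X \<le> 2" using x_pos x_le_2 by auto
  have e: "0 < e" "e \<le> 1"
  proof -
    have "40 / real n \<le> 40 / 100" using n_ge by (intro divide_left_mono) auto
    then show "0 < e" "e \<le> 1" using e_le e_pos by simp_all
  qed
  have "?X * ?X \<le> 2 * 2" using X by (intro mult_mono) auto
  then have "?X\<^sup>2 \<le> 4" by (simp add: power2_eq_square)
  then have "\<bar>1 + 2 * \<gamma> - 2 * ?X\<^sup>2\<bar> \<le> 8"
    using abs_le_D1[OF gamma_le] abs_le_D2[OF gamma_le] zero_le_power2[of ?X] by linarith
  then have "?X * \<bar>1 + 2 * \<gamma> - 2 * ?X\<^sup>2\<bar> \<le> ?X * 8" using X by (intro mult_left_mono) auto
  moreover have "x2 t = ?X * (1 + 2 * \<gamma> - 2 * ?X\<^sup>2)"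
    by (simp add: x2_def algebra_simps power2_eq_square power3_eq_cube)
  ultimately have x2: "\<bar>x2 t\<bar> \<le> 8 * ?X" using X by (simp add: abs_mult)
  have 1: "\<bar>y t * x2 t\<bar> \<le> ?X * (8 * ?X)" unfolding abs_mult using y_le[of t] x2 X by (intro mult_mono) auto
  have zt: "\<bar>\<zeta>t t\<bar> \<le> 4 * ?X"
  proof -
    have "\<bar>\<zeta>t t\<bar> = 2 * ?X * \<bar>y t\<bar>" using X by (simp add: \<zeta>t_def abs_mult)
    also have "\<dots> \<le> 2 * 2 * ?X" using X y_le[of t] by (intro mult_mono) auto
    finally show ?thesis by simp
  qed
  have "\<bar>y t * \<zeta> t\<bar> \<le> ?X * 2" unfolding abs_mult using y_le[of t] zeta_le[of t] X by (intro mult_mono) auto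
  moreover have "\<bar>?X * \<zeta>t t\<bar> \<le> 2 * (4 * ?X)" unfolding abs_mult using zt X by (intro mult_mono) auto
  ultimately have mt: "\<bar>mt t\<bar> \<le> 10 * ?X" unfolding mt_def by linarith
  have "\<bar>e * (sin \<theta> * mt t)\<bar> \<le> 1 * (1 * (10 * ?X))"
    unfolding abs_mult using e mt X by (intro mult_mono) auto
  then have Kt: "\<bar>Kt (t, \<theta>)\<bar> \<le> 14 * ?X" using zt unfolding Kt_def prod.case by linarith
  have "\<bar>m t\<bar> \<le> 2 * ?X" unfolding m_def abs_mult using zeta_le[of t] X by (intro mult_mono) auto
  then have "\<bar>e * (sin \<theta> * m t)\<bar> \<le> e * (1 * (2 * ?X))"
    unfolding abs_mult using e X by (intro mult_mono) auto
  also have "\<dots> \<le> 4/10 * (1 * (2 * ?X))"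
  proof (rule mult_right_mono)
    have "40 / real n \<le> 40 / 100" using n_ge by (intro divide_left_mono) auto
    then show "e \<le> 4/10" using e_le by simp
  qed (use X in simp)
  finally have K: "\<bar>K (t, \<theta>)\<bar> \<le> 2 * ?X" using zeta_le[of t] X unfolding K_def prod.case by linarith
  have 2: "\<bar>K (t, \<theta>) * Kt (t, \<theta>)\<bar> \<le> 2 * ?X * (14 * ?X)"
    unfolding abs_mult using K Kt X by (intro mult_mono) auto
  have "\<bar>Qt (t, \<theta>)\<bar> \<le> 2 * \<bar>y t * x2 t\<bar> + 2 * \<bar>K (t, \<theta>) * Kt (t, \<theta>)\<bar>"
    unfolding Qt_def prod.case by (rule order_trans[OF abs_triangle_ineq]) (simp add: abs_mult)
  also have "\<dots> \<le> 2 * (?X * (8 * ?X)) + 2 * (2 * ?X * (14 * ?X))" using 1 2 by simp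
  also have "\<dots> \<le> 80 * (x t)\<^sup>2" by (simp add: power2_eq_square)
  finally show ?thesis .
qed

text \<open>No negative power of x is left over, because x \<kappa> \<le> 10 and x^3 \<kappa>^3
  \<le> 1000. The constant is therefore independent of the window, and a bound \<open>c\<close>
  proportional to x(t) passes to \<open>f\<close> and \<open>ft\<close> with its decay intact. The
  number 50000 rounds up 10 + 10 + 40000.\<close>

lemma f_bounds:
  assumes "\<bar>\<phi> (t, \<theta>)\<bar> \<le> c" "\<bar>d_t \<phi> (t, \<theta>)\<bar> \<le> c"
  shows "\<bar>f (t, \<theta>)\<bar> \<le> 50000 * c" "\<bar>ft (t, \<theta>)\<bar> \<le> 50000 * c"
proof -
  let ?k = "\<kappa> (t, \<theta>)"
  have c: "c \<ge> 0" using assms(1) by simp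
  have X: "0 < x t" using x_pos by auto
  note k = x_kappa[where t = t and \<theta> = \<theta>]
  have 1: "\<bar>x t * ?k * v\<bar> \<le> 10 * c" if "\<bar>v\<bar> \<le> c" for v
    unfolding abs_mult[of _ v] using that k X by (intro mult_mono) auto
  have 2: "\<bar>y t * ?k * v\<bar> \<le> 10 * c" if "\<bar>v\<bar> \<le> c" for v
  proof -
    have "\<bar>y t * ?k\<bar> \<le> x t * ?k" unfolding abs_mult using y_le[of t] k by (intro mult_mono) auto
    then show ?thesis unfolding abs_mult[of _ v] using that k by (intro mult_mono) auto
  qed
  have "(x t * ?k) ^ 3 \<le> 10 ^ 3" using k X by (intro power_mono) auto
  then have k3: "x t ^ 3 * ?k ^ 3 \<le> 1000" by (simp add: power_mult_distrib)
  have "\<bar>x t * \<kappa>t (t, \<theta>)\<bar> = x t * ?k ^ 3 * \<bar>Qt (t, \<theta>)\<bar> / 2"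
    using X k by (simp add: \<kappa>t_def abs_mult)
  also have "\<dots> \<le> x t * ?k ^ 3 * (80 * (x t)\<^sup>2) / 2"
    using X k Qt_bound by (intro divide_right_mono mult_left_mono) auto
  also have "\<dots> = 40 * (x t ^ 3 * ?k ^ 3)" by (simp add: power2_eq_square power3_eq_cube)
  also have "\<dots> \<le> 40 * 1000" using k3 by simp
  finally have kt: "\<bar>x t * \<kappa>t (t, \<theta>)\<bar> \<le> 40000" by simp
  have 3: "\<bar>x t * \<kappa>t (t, \<theta>) * \<phi> (t, \<theta>)\<bar> \<le> 40000 * c"
    unfolding abs_mult[of _ "\<phi> _"] using kt assms by (intro mult_mono) auto
  have "f (t, \<theta>) = x t * ?k * \<phi> (t, \<theta>)" by (simp add: f_def \<eta>_def)
  then show "\<bar>f (t, \<theta>)\<bar> \<le> 50000 * c" using 1[OF assms(1)] c by simp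
  have "ft (t, \<theta>) = y t * ?k * \<phi> (t, \<theta>) + x t * ?k * d_t \<phi> (t, \<theta>) + x t * \<kappa>t (t, \<theta>) * \<phi> (t, \<theta>)"
    by (simp add: ft_def \<eta>_def \<eta>t_def algebra_simps)
  then show "\<bar>ft (t, \<theta>)\<bar> \<le> 50000 * c"
    using 2[OF assms(1)] 1[OF assms(2)] 3 c by linarith
qed

end

section \<open>The test function\<close>

text \<open>The double integral of w (ftt + 2 sech^2 f) is evaluated twice. With t first, only
  boundary terms remain; with \<theta> first, the approximate equation leaves 4 \<pi> c times the
  integral of w sech^2, which is tanh T + T sech^2 T because w'' = -2 sech^2 w. The second solution
  tanh t of the equation of \<open>w\<close> would be of no use: it is odd and pairs to zero with
  sech^2.\<close>

lemma green_test:
  fixes f ft ftt fh fhh :: "real \<times> real \<Rightarrow> real" and b :: "real \<Rightarrow> real" and T c e M :: real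
  assumes T: "T > 0"
    and f: "\<And>t \<theta>. ((\<lambda>r. f (r, \<theta>)) has_real_derivative ft (t, \<theta>)) (at t)"
      "\<And>t \<theta>. ((\<lambda>r. ft (r, \<theta>)) has_real_derivative ftt (t, \<theta>)) (at t)"
      "\<And>t \<theta>. ((\<lambda>r. fh (t, r)) has_real_derivative fhh (t, \<theta>)) (at \<theta>)"
    and cont: "continuous_on UNIV f" "continuous_on UNIV ftt" "continuous_on UNIV fhh"
    and per: "\<And>t. fh (t, pi) = fh (t, - pi)"
    and eq: "\<And>t \<theta>. \<bar>t\<bar> \<le> T \<Longrightarrow> \<bar>\<theta>\<bar> \<le> pi \<Longrightarrow>
      \<bar>ftt (t, \<theta>) + fhh (t, \<theta>) + 2 * (1 - (tanh t)\<^sup>2) * f (t, \<theta>) + b t * sin \<theta> - 2 * (1 - (tanh t)\<^sup>2) * c\<bar> \<le> e"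
    and bd: "\<And>t \<theta>. \<bar>t\<bar> = T \<Longrightarrow> \<bar>\<theta>\<bar> \<le> pi \<Longrightarrow> \<bar>f (t, \<theta>)\<bar> \<le> M"
      "\<And>t \<theta>. \<bar>t\<bar> = T \<Longrightarrow> \<bar>\<theta>\<bar> \<le> pi \<Longrightarrow> \<bar>ft (t, \<theta>)\<bar> \<le> M"
  shows "\<bar>c\<bar> * tanh T \<le> 2 * (1 + T) * M + T * (1 + T) * e"
proof -
  \<comment> \<open>\<open>w\<close> is the even solution of the linearised equation with constant data on circles.\<close>
  define w where "w = (\<lambda>t::real. 1 - t * tanh t)"
  define w1 where "w1 = (\<lambda>t::real. - (tanh t + t * (1 - (tanh t)\<^sup>2)))"
  define s2 where "s2 = (\<lambda>t::real. 1 - (tanh t)\<^sup>2)"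
  have dth: "(tanh has_real_derivative (1 - (tanh t)\<^sup>2)) (at t)" for t :: real
    by (auto intro!: derivative_eq_intros)
  have dw: "(w has_real_derivative w1 t) (at t)" for t
    unfolding w_def w1_def by (auto intro!: derivative_eq_intros)
  have dw1: "(w1 has_real_derivative - 2 * s2 t * w t) (at t)" for t
    unfolding w_def w1_def s2_def
    by (auto intro!: derivative_eq_intros simp: algebra_simps power2_eq_square)
  have cth: "continuous_on S (tanh :: real \<Rightarrow> real)" for S
    using dth by (meson DERIV_isCont continuous_at_imp_continuous_on)
  have th: "\<bar>tanh t\<bar> \<le> 1" for t :: real
    using tanh_real_bounds[of t] by auto
  have s2: "0 \<le> s2 t" "s2 t \<le> 1" for t
    using th[of t] by (simp_all add: s2_def abs_square_le_1)
  have wb: "\<bar>w t\<bar> \<le> 1 + T" if "\<bar>t\<bar> \<le> T" for t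
  proof -
    have "\<bar>t * tanh t\<bar> \<le> T * 1" unfolding abs_mult using that th[of t] by (intro mult_mono) auto
    then show ?thesis unfolding w_def by linarith
  qed
  have w1b: "\<bar>w1 t\<bar> \<le> 1 + T" if "\<bar>t\<bar> \<le> T" for t
  proof -
    have "\<bar>t * s2 t\<bar> \<le> T * 1" unfolding abs_mult using that s2[of t] by (intro mult_mono) auto
    then show ?thesis using th[of t] unfolding w1_def s2_def by linarith
  qed
  define g where "g = (\<lambda>t \<theta>. w t * (ftt (t, \<theta>) + 2 * s2 t * f (t, \<theta>)))"
  have cfst: "continuous_on UNIV (\<lambda>q::real \<times> real. tanh (fst q))"
    by (rule continuous_on_compose2[OF cth[of UNIV]]) (auto intro: continuous_intros)
  have cg: "continuous_on S (\<lambda>(t, \<theta>). g t \<theta>)" for S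
    unfolding g_def w_def s2_def case_prod_unfold prod.collapse
    by (rule continuous_on_subset[OF _ subset_UNIV]) (intro continuous_intros cfst cont)
  define I where "I = integral {-T..T} (\<lambda>t. integral {-pi..pi} (g t))"
  have I2: "I = integral {-pi..pi} (\<lambda>\<theta>. integral {-T..T} (\<lambda>t. g t \<theta>))"
    unfolding I_def using integral_swap_continuous[OF cg[of "cbox (-T, -pi) (T, pi)"]] by simp
  \<comment> \<open>Boundary values of \<open>w ft - w1 f\<close>, a primitive in t of w (ftt + 2
    sech^2 f) since \<open>w\<close> solves the homogeneous equation.\<close>
  define B where "B = (\<lambda>\<theta>. (w T * ft (T, \<theta>) - w1 T * f (T, \<theta>)) - (w (-T) * ft (-T, \<theta>) - w1 (-T) * f (-T, \<theta>)))"
  have inner: "integral {-T..T} (\<lambda>t. g t \<theta>) = B \<theta>" for \<theta>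
  proof -
    have "((\<lambda>t. g t \<theta>) has_integral B \<theta>) {-T..T}"
      unfolding B_def
    proof (rule fundamental_theorem_of_calculus)
      show "((\<lambda>t. w t * ft (t, \<theta>) - w1 t * f (t, \<theta>)) has_vector_derivative g t \<theta>) (at t within {-T..T})" for t
        unfolding has_real_derivative_iff_has_vector_derivative[symmetric] g_def
        by (rule has_field_derivative_at_within)
          (auto intro!: derivative_eq_intros dw dw1 f simp: algebra_simps)
    qed (use T in simp)
    then show ?thesis by (rule integral_unique)
  qed
  have Bb: "\<bar>B \<theta>\<bar> \<le> 4 * (1 + T) * M" if "\<bar>\<theta>\<bar> \<le> pi" for \<theta>
  proof -
    have 1: "\<bar>w t * ft (t, \<theta>)\<bar> \<le> (1 + T) * M" if "\<bar>t\<bar> = T" for t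
      unfolding abs_mult using wb[of t] bd(2)[OF that \<open>\<bar>\<theta>\<bar> \<le> pi\<close>] that T by (intro mult_mono) auto
    have 2: "\<bar>w1 t * f (t, \<theta>)\<bar> \<le> (1 + T) * M" if "\<bar>t\<bar> = T" for t
      unfolding abs_mult using w1b[of t] bd(1)[OF that \<open>\<bar>\<theta>\<bar> \<le> pi\<close>] that T by (intro mult_mono) auto
    have "\<bar>B \<theta>\<bar> \<le> \<bar>w T * ft (T, \<theta>)\<bar> + \<bar>w1 T * f (T, \<theta>)\<bar> + \<bar>w (-T) * ft (-T, \<theta>)\<bar> + \<bar>w1 (-T) * f (-T, \<theta>)\<bar>"
      unfolding B_def by linarith
    also have "\<dots> \<le> 4 * ((1 + T) * M)" using 1[of T] 1[of "-T"] 2[of T] 2[of "-T"] T by simp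
    finally show ?thesis by (simp only: mult.assoc)
  qed
  have cB: "continuous_on {-pi..pi} B"
  proof -
    have "continuous_on ({-pi..pi} \<times> cbox (-T) T) (\<lambda>q. (snd q, fst q))" by (intro continuous_intros)
    then have "continuous_on ({-pi..pi} \<times> cbox (-T) T) (\<lambda>q. g (snd q) (fst q))"
      using continuous_on_compose2[OF cg[of UNIV], of _ "\<lambda>q. (snd q, fst q)"] by simp
    then have "continuous_on {-pi..pi} (\<lambda>\<theta>. integral (cbox (-T) T) (\<lambda>t. g t \<theta>))"
      by (intro integral_continuous_on_param) (simp add: case_prod_unfold)
    then show ?thesis by (simp add: inner)
  qed
  have IB: "\<bar>I\<bar> \<le> 4 * (1 + T) * M * (2 * pi)"
  proof -
    have "norm (integral {-pi..pi} B) \<le> 4 * (1 + T) * M * (pi - (-pi))"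
      by (rule integral_bound) (use cB Bb in \<open>auto simp: abs_le_iff\<close>)
    then show ?thesis unfolding I2 inner by (simp add: mult.commute)
  qed
  have cs: "continuous_on S (\<lambda>\<theta>. k (t, \<theta>))" if "continuous_on UNIV k" for S t and k :: "real \<times> real \<Rightarrow> real"
    by (rule continuous_on_compose2[OF that]) (auto intro: continuous_intros)
  have slice: "\<bar>integral {-pi..pi} (g t) - 4 * pi * c * (w t * s2 t)\<bar> \<le> (1 + T) * e * (2 * pi)" if t: "\<bar>t\<bar> \<le> T" for t
  proof -
    define r where "r = (\<lambda>\<theta>. ftt (t, \<theta>) + fhh (t, \<theta>) + 2 * s2 t * f (t, \<theta>) + b t * sin \<theta> - 2 * s2 t * c)"
    have cr: "continuous_on {-pi..pi} (\<lambda>\<theta>. w t * r \<theta>)"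
      unfolding r_def by (intro continuous_intros cs cont)
    have "norm (integral {-pi..pi} (\<lambda>\<theta>. w t * r \<theta>)) \<le> (1 + T) * e * (pi - (-pi))"
    proof (rule integral_bound)
      fix \<theta> assume "\<theta> \<in> {-pi..pi}"
      then have "\<bar>r \<theta>\<bar> \<le> e" using eq[OF t, of \<theta>] by (auto simp: r_def s2_def)
      then have "\<bar>w t * r \<theta>\<bar> \<le> (1 + T) * e" unfolding abs_mult using wb[OF t] by (intro mult_mono) auto
      then show "norm (w t * r \<theta>) \<le> (1 + T) * e" by simp
    qed (use cr in auto)
    moreover have int: "((\<lambda>\<theta>. w t * r \<theta>) has_integral (integral {-pi..pi} (g t) - 4 * pi * c * (w t * s2 t))) {-pi..pi}"
    proof -
      have A: "((\<lambda>\<theta>. w t * (fhh (t, \<theta>) + b t * sin \<theta> - 2 * s2 t * c)) has_integral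
          (w t * (fh (t, pi) - b t * cos pi - 2 * s2 t * c * pi)) - (w t * (fh (t, -pi) - b t * cos (-pi) - 2 * s2 t * c * (-pi)))) {-pi..pi}"
      proof (rule fundamental_theorem_of_calculus)
        show "((\<lambda>\<theta>. w t * (fh (t, \<theta>) - b t * cos \<theta> - 2 * s2 t * c * \<theta>)) has_vector_derivative
            w t * (fhh (t, \<theta>) + b t * sin \<theta> - 2 * s2 t * c)) (at \<theta> within {-pi..pi})" for \<theta>
          unfolding has_real_derivative_iff_has_vector_derivative[symmetric]
          by (rule has_field_derivative_at_within) (auto intro!: derivative_eq_intros f)
      qed simp
      have E: "(w t * (fh (t, pi) - b t * cos pi - 2 * s2 t * c * pi)) - (w t * (fh (t, -pi) - b t * cos (-pi) - 2 * s2 t * c * (-pi)))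
          = - 4 * pi * c * (w t * s2 t)"
        by (simp add: per algebra_simps)
      have G: "(g t has_integral integral {-pi..pi} (g t)) {-pi..pi}"
        unfolding g_def
        by (intro integrable_integral integrable_continuous_interval continuous_intros cs cont)
      note has_integral_add[OF G A[unfolded E]]
      moreover have "(\<lambda>\<theta>. g t \<theta> + w t * (fhh (t, \<theta>) + b t * sin \<theta> - 2 * s2 t * c)) = (\<lambda>\<theta>. w t * r \<theta>)"
        by (auto simp: g_def r_def algebra_simps)
      ultimately show ?thesis by simp
    qed
    ultimately show ?thesis unfolding integral_unique[OF int] by simp
  qed
  have cP: "continuous_on {-T..T} (\<lambda>t. integral {-pi..pi} (g t))"
    using integral_continuous_on_param[of "{-T..T}" "-pi" pi g] cg by simp
  have cw: "continuous_on {-T..T} (\<lambda>t. 4 * pi * c * (w t * s2 t))"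
    unfolding w_def s2_def by (intro continuous_intros cth)
  have "norm (integral {-T..T} (\<lambda>t. integral {-pi..pi} (g t) - 4 * pi * c * (w t * s2 t))) \<le> (1 + T) * e * (2 * pi) * (T - (-T))"
    by (rule integral_bound) (use T cP cw slice in \<open>auto intro!: continuous_intros simp: abs_le_iff\<close>)
  moreover have "integral {-T..T} (\<lambda>t. integral {-pi..pi} (g t) - 4 * pi * c * (w t * s2 t))
      = I - 4 * pi * c * (tanh T + T * s2 T)"
  proof -
    have "((\<lambda>t. 4 * pi * c * (w t * s2 t)) has_integral (- 2 * pi * c * w1 T) - (- 2 * pi * c * w1 (- T))) {-T..T}"
    proof (rule fundamental_theorem_of_calculus)
      show "((\<lambda>t. - 2 * pi * c * w1 t) has_vector_derivative 4 * pi * c * (w t * s2 t)) (at t within {-T..T})" for t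
        unfolding has_real_derivative_iff_has_vector_derivative[symmetric]
        by (rule has_field_derivative_at_within) (auto intro!: derivative_eq_intros dw1)
    qed (use T in simp)
    moreover have "(- 2 * pi * c * w1 T) - (- 2 * pi * c * w1 (- T)) = 4 * pi * c * (tanh T + T * s2 T)"
      by (simp add: w1_def s2_def algebra_simps)
    ultimately have "((\<lambda>t. 4 * pi * c * (w t * s2 t)) has_integral 4 * pi * c * (tanh T + T * s2 T)) {-T..T}" by simp
    moreover have "((\<lambda>t. integral {-pi..pi} (g t)) has_integral I) {-T..T}"
      unfolding I_def by (intro integrable_integral integrable_continuous_interval cP)
    ultimately show ?thesis by (intro integral_unique has_integral_diff)
  qed
  ultimately have D: "\<bar>I - 4 * pi * c * (tanh T + T * s2 T)\<bar> \<le> 4 * pi * (T * (1 + T) * e)"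
    by (simp add: algebra_simps)
  have tT: "tanh T > 0" using T by simp
  \<comment> \<open>The summand T sech^2 T is non-negative and is discarded.\<close>
  have "4 * pi * (\<bar>c\<bar> * tanh T) \<le> 4 * pi * (\<bar>c\<bar> * (tanh T + T * s2 T))"
    using T s2[of T] by (intro mult_left_mono) auto
  also have "\<dots> = \<bar>4 * pi * c * (tanh T + T * s2 T)\<bar>"
    using T s2[of T] tT by (simp add: abs_mult add_nonneg_nonneg)
  also have "\<dots> \<le> \<bar>I\<bar> + \<bar>I - 4 * pi * c * (tanh T + T * s2 T)\<bar>" by linarith
  also have "\<dots> \<le> 4 * (1 + T) * M * (2 * pi) + 4 * pi * (T * (1 + T) * e)" using IB D by simp
  also have "\<dots> = 4 * pi * (2 * (1 + T) * M + T * (1 + T) * e)" by (simp add: algebra_simps)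
  finally show ?thesis by simp
qed

section \<open>Asymptotics along a sequence of tori\<close>

text \<open>All conditions are required for every index, so that each member is an instance of
  \<open>torus\<close>; finitely many initial terms will have been discarded beforehand. The bound
  keeps the weight \<open>del_x\<close>, which is needed at the ends of the window.\<close>

locale torus_seq =
  fixes a :: "nat \<Rightarrow> real" and n :: "nat \<Rightarrow> nat" and \<phi> :: "nat \<Rightarrow> real \<times> real \<Rightarrow> real"
    and \<beta> R T :: real
  assumes torus: "\<And>k. torus (a k) (n k) (\<phi> k)"
    and pos: "\<beta> > 0" "R > 0" "T \<ge> 1"
    and n_ge_T: "\<And>k. T \<le> real (n k)"
    and a_lim: "a \<longlonglongrightarrow> 0" and n_lim: "filterlim n at_top sequentially"
    and bnd: "\<And>k t \<theta> \<psi>. \<lbrakk>\<bar>t\<bar> \<le> T; \<bar>\<theta>\<bar> \<le> pi;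
        \<psi> \<in> {\<phi> k, d_t (\<phi> k), d_\<theta> (\<phi> k), d_t (d_t (\<phi> k)), d_\<theta> (d_t (\<phi> k)), d_\<theta> (d_\<theta> (\<phi> k))}\<rbrakk>
      \<Longrightarrow> \<bar>\<psi> (t, \<theta>)\<bar> \<le> R * real (n k) powr - \<beta> * del_x (a k) t"
begin

sublocale tor: torus "a k" "n k" "\<phi> k" for k
  by (rule torus)

definition box :: "(real \<times> real) set" where "box = {-T..T} \<times> {-pi..pi}"
text \<open>Limits along this filter are limits in the index that are uniform over the box. Landau
  symbols for functions of (k, t, \<theta>) thus express uniform asymptotics.\<close>

definition Fil :: "(nat \<times> real \<times> real) filter" where "Fil = sequentially \<times>\<^sub>F principal box"
text \<open>The coarser of the scales 1/n and n^(-\<beta>), so that bending and perturbation are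
  both O(d).\<close>

definition d :: "nat \<times> real \<times> real \<Rightarrow> real" where "d q = real (n (fst q)) powr - min 1 \<beta>"

lemma eventually_Fil: "eventually P Fil \<longleftrightarrow> (\<forall>\<^sub>F k in sequentially. \<forall>p\<in>box. P (k, p))"
proof
  assume "eventually P Fil"
  then obtain A B where AB: "eventually A sequentially" "\<forall>p\<in>box. B p" "\<And>k p. A k \<Longrightarrow> B p \<Longrightarrow> P (k, p)"
    unfolding Fil_def eventually_prod_filter eventually_principal by blast
  from AB(1) show "\<forall>\<^sub>F k in sequentially. \<forall>p\<in>box. P (k, p)"
    by (rule eventually_mono) (use AB in blast)
next
  assume "\<forall>\<^sub>F k in sequentially. \<forall>p\<in>box. P (k, p)"
  then show "eventually P Fil"
    unfolding Fil_def eventually_prod_filter eventually_principal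
    by (intro exI[of _ "\<lambda>k. \<forall>p\<in>box. P (k, p)"] exI[of _ "\<lambda>p. p \<in> box"]) auto
qed

lemma FilI: "(\<And>k t \<theta>. \<bar>t\<bar> \<le> T \<Longrightarrow> \<bar>\<theta>\<bar> \<le> pi \<Longrightarrow> P (k, t, \<theta>)) \<Longrightarrow> eventually P Fil"
  unfolding eventually_Fil by (intro always_eventually) (auto simp: box_def abs_le_iff)

lemma lim_fst: "(f \<longlongrightarrow> l) sequentially \<Longrightarrow> ((\<lambda>q. f (fst q)) \<longlongrightarrow> l) Fil"
  unfolding Fil_def by (rule filterlim_compose[OF _ filterlim_fst])

lemma n_pos: "real (n k) > 0"
  using n_ge_T[of k] pos by simp

lemma d_pos: "d q > 0"
  using n_pos by (simp add: d_def)

lemma n_real_lim: "filterlim (\<lambda>k. real (n k)) at_top sequentially"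
  by (rule filterlim_compose[OF filterlim_real_sequentially n_lim])

lemma powr_lim: "c > 0 \<Longrightarrow> ((\<lambda>q. real (n (fst q)) powr - c) \<longlongrightarrow> 0) Fil"
  by (rule lim_fst) (rule tendsto_neg_powr[OF _ n_real_lim], simp)

sublocale sc: small_scale Fil d
  by unfold_locales (use powr_lim[of "min 1 \<beta>"] pos in \<open>simp add: d_def smalloI_tendsto\<close>)

abbreviation "X \<equiv> \<lambda>q. del_x (a (fst q)) (fst (snd q))"
abbreviation "Yd \<equiv> \<lambda>q. del_y (a (fst q)) (fst (snd q))"
abbreviation "Gm \<equiv> \<lambda>q::nat \<times> real \<times> real. del_\<gamma> (a (fst q))"
abbreviation "sn \<equiv> \<lambda>q::nat \<times> real \<times> real. sin (snd (snd q))"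
abbreviation "cs \<equiv> \<lambda>q::nat \<times> real \<times> real. cos (snd (snd q))"
abbreviation "ep \<equiv> \<lambda>q::nat \<times> real \<times> real. tor.e (fst q)"
abbreviation "X2 \<equiv> \<lambda>q. tor.x2 (fst q) (fst (snd q))"
abbreviation "Y2 \<equiv> \<lambda>q. tor.y2 (fst q) (fst (snd q))"
abbreviation "Z \<equiv> \<lambda>q. tor.\<zeta> (fst q) (fst (snd q))"
abbreviation "Zt \<equiv> \<lambda>q. tor.\<zeta>t (fst q) (fst (snd q))"
abbreviation "Ztt \<equiv> \<lambda>q. tor.\<zeta>tt (fst q) (fst (snd q))"
abbreviation "Mm \<equiv> \<lambda>q. tor.m (fst q) (fst (snd q))"
abbreviation "Mt \<equiv> \<lambda>q. tor.mt (fst q) (fst (snd q))"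
abbreviation "Mtt \<equiv> \<lambda>q. tor.mtt (fst q) (fst (snd q))"
abbreviation "L g \<equiv> \<lambda>q::nat \<times> real \<times> real. g (fst q) (snd q) :: real"

section \<open>Uniform bounds on the window\<close>

lemma bddI: fixes C :: real shows "(\<And>k t \<theta>. \<bar>t\<bar> \<le> T \<Longrightarrow> \<bar>\<theta>\<bar> \<le> pi \<Longrightarrow> \<bar>g (k, t, \<theta>)\<bar> \<le> C) \<Longrightarrow> g \<in> sc.bdd"
  by (rule bigoI[where c = C]) (rule FilI, simp)

lemma X_bdd: "X \<in> sc.bdd"
  by (rule bddI[where C = 2]) (use tor.x_le_2 tor.x_pos in \<open>simp add: less_imp_le\<close>)

lemma Yd_bdd: "Yd \<in> sc.bdd"
  by (rule bddI[where C = 2]) (use order_trans[OF tor.y_le tor.x_le_2] in simp)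

lemma Gm_bdd: "Gm \<in> sc.bdd"
  by (rule bddI[where C = "1/10"]) (use tor.gamma_le in simp)

lemma sn_bdd: "sn \<in> sc.bdd" and cs_bdd: "cs \<in> sc.bdd"
  by (rule bddI[where C = 1], simp)+

lemma base_bdd: "X2 \<in> sc.bdd" "Y2 \<in> sc.bdd" "Z \<in> sc.bdd" "Zt \<in> sc.bdd" "Ztt \<in> sc.bdd"
  "Mm \<in> sc.bdd" "Mt \<in> sc.bdd" "Mtt \<in> sc.bdd"
  unfolding tor.m_def tor.mt_def tor.mtt_def tor.\<zeta>_def tor.\<zeta>t_def tor.\<zeta>tt_def tor.x2_def tor.y2_def
  by (intro sc.bdd_intros X_bdd Yd_bdd Gm_bdd)+

lemma ep_big: "ep \<in> O[Fil](d)"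
proof (rule bigoI[where c = 40], rule FilI)
  fix k t \<theta>
  have "1 \<le> real (n k)" using n_ge_T[of k] pos by simp
  then have "real (n k) powr - 1 \<le> real (n k) powr - min 1 \<beta>" by (intro powr_mono) auto
  then have "40 / real (n k) \<le> 40 * d (k, t, \<theta>)"
    using n_pos[of k] by (simp add: d_def powr_minus divide_inverse)
  then show "norm (ep (k, t, \<theta>)) \<le> 40 * norm (d (k, t, \<theta>))"
    using tor.e_le[of k] tor.e_pos[of k] d_pos[of "(k, t, \<theta>)"] by simp
qed

lemma phi_big_beta:
  "\<psi> \<in> {L \<phi>, L (\<lambda>k. d_t (\<phi> k)), L (\<lambda>k. d_\<theta> (\<phi> k)), L (\<lambda>k. d_t (d_t (\<phi> k))),
     L (\<lambda>k. d_\<theta> (d_t (\<phi> k))), L (\<lambda>k. d_\<theta> (d_\<theta> (\<phi> k)))} \<Longrightarrow> \<psi> \<in> O[Fil](\<lambda>q. real (n (fst q)) powr - \<beta>)"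
proof (rule bigoI[where c = "2 * R"], rule FilI)
  fix k t \<theta> assume t: "\<bar>t\<bar> \<le> T" "\<bar>\<theta>\<bar> \<le> pi"
    and mem: "\<psi> \<in> {L \<phi>, L (\<lambda>k. d_t (\<phi> k)), L (\<lambda>k. d_\<theta> (\<phi> k)), L (\<lambda>k. d_t (d_t (\<phi> k))),
     L (\<lambda>k. d_\<theta> (d_t (\<phi> k))), L (\<lambda>k. d_\<theta> (d_\<theta> (\<phi> k)))}"
  let ?C = "R * real (n k) powr - \<beta> * del_x (a k) t"
  have B: "\<bar>\<phi> k (t, \<theta>)\<bar> \<le> ?C" "\<bar>d_t (\<phi> k) (t, \<theta>)\<bar> \<le> ?C" "\<bar>d_\<theta> (\<phi> k) (t, \<theta>)\<bar> \<le> ?C"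
    "\<bar>d_t (d_t (\<phi> k)) (t, \<theta>)\<bar> \<le> ?C" "\<bar>d_\<theta> (d_t (\<phi> k)) (t, \<theta>)\<bar> \<le> ?C"
    "\<bar>d_\<theta> (d_\<theta> (\<phi> k)) (t, \<theta>)\<bar> \<le> ?C"
    by (rule bnd[OF t]; simp)+
  have "\<bar>\<psi> (k, t, \<theta>)\<bar> \<le> ?C"
    using mem by (elim insertE emptyE) (simp_all only: fst_conv snd_conv B)
  also have "\<dots> \<le> R * real (n k) powr - \<beta> * 2"
    using tor.x_le_2[of k t] pos by (intro mult_left_mono) auto
  finally show "norm (\<psi> (k, t, \<theta>)) \<le> 2 * R * norm (real (n (fst (k, t, \<theta>))) powr - \<beta>)" by simp
qed

lemma powr_beta_big: "(\<lambda>q. real (n (fst q)) powr - \<beta>) \<in> O[Fil](d)"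
proof (rule bigoI[where c = 1], rule FilI)
  fix k t \<theta>
  have "1 \<le> real (n k)" using n_ge_T[of k] pos by simp
  then have "real (n k) powr - \<beta> \<le> real (n k) powr - min 1 \<beta>" by (intro powr_mono) auto
  then show "norm (real (n (fst (k, t, \<theta>))) powr - \<beta>) \<le> 1 * norm (d (k, t, \<theta>))"
    by (simp add: d_def)
qed

lemmas phi_big = landau_o.big_trans[OF phi_big_beta powr_beta_big]

text \<open>On the window the exponential factor in \<open>x_near_sech\<close> is at most exp (30
  T), so the distance is a constant times |a|, uniformly.\<close>

lemma sech_lim: "((\<lambda>q. X q - 1 / cosh (fst (snd q))) \<longlongrightarrow> 0) Fil"
proof (rule Lim_null_comparison)
  define C where "C = sqrt (20 * exp (30 * T))"
  show "\<forall>\<^sub>F q in Fil. norm (X q - 1 / cosh (fst (snd q))) \<le> C * \<bar>a (fst q)\<bar>"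
  proof (rule FilI)
    fix k t \<theta> assume t: "\<bar>t\<bar> \<le> T"
    have "(del_x (a k) t - 1 / cosh t)\<^sup>2 \<le> 20 * (a k)\<^sup>2 * exp (30 * \<bar>t\<bar>)"
      using tor.x_near_sech[of k t] zero_le_power2[of "del_y (a k) t + sinh t / (cosh t)\<^sup>2"] by linarith
    also have "\<dots> \<le> 20 * (a k)\<^sup>2 * exp (30 * T)" using t by (intro mult_left_mono) auto
    also have "\<dots> = (C * \<bar>a k\<bar>)\<^sup>2" by (simp add: C_def power_mult_distrib)
    finally have "\<bar>del_x (a k) t - 1 / cosh t\<bar> \<le> \<bar>C * \<bar>a k\<bar>\<bar>" by (simp add: abs_le_square_iff)
    then show "norm (X (k, t, \<theta>) - 1 / cosh (fst (snd (k, t, \<theta>)))) \<le> C * \<bar>a (fst (k, t, \<theta>))\<bar>"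
      by (simp add: C_def)
  qed
  have "((\<lambda>k. C * \<bar>a k\<bar>) \<longlongrightarrow> C * \<bar>0\<bar>) sequentially" by (intro tendsto_intros a_lim)
  then show "((\<lambda>q. C * \<bar>a (fst q)\<bar>) \<longlongrightarrow> 0) Fil" using lim_fst by fastforce
qed

lemma cosh_le: "\<bar>t\<bar> \<le> T \<Longrightarrow> cosh t \<le> cosh T" for t :: real
  using cosh_real_nonneg_le_iff[of "\<bar>t\<bar>" T] pos by simp

text \<open>sech is at least 1 / cosh T on the window, and x is eventually at least half of that.
  This keeps the necks out and bounds \<kappa>, which is of size 1/x.\<close>

lemma inv_X_bdd: "(\<lambda>q. 1 / X q) \<in> sc.bdd"
proof (rule bigoI[where c = "2 * cosh T"])
  have "\<forall>\<^sub>F q in Fil. dist (X q - 1 / cosh (fst (snd q))) 0 < 1 / (2 * cosh T)"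
    using sech_lim by (rule tendstoD) simp
  moreover have "\<forall>\<^sub>F q in Fil. 1 / cosh T \<le> 1 / cosh (fst (snd q))"
    by (rule FilI) (auto intro!: frac_le cosh_le)
  ultimately show "\<forall>\<^sub>F q in Fil. norm (1 / X q) \<le> 2 * cosh T * norm (1::real)"
  proof eventually_elim
    case (elim q)
    have "1 / cosh T = 1 / (2 * cosh T) + 1 / (2 * cosh T)" by (simp add: field_simps)
    then have "1 / (2 * cosh T) \<le> X q" using elim unfolding dist_real_def by linarith
    moreover have "X q > 0" by (rule tor.x_pos)
    ultimately show ?case by (simp add: field_simps)
  qed
qed

lemma kappa_bdd: "L tor.\<kappa> \<in> sc.bdd"
proof -
  have "L tor.\<kappa> \<in> O[Fil](\<lambda>q. 1 / X q)"
  proof (rule bigoI[where c = 10], rule FilI)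
    fix k t \<theta>
    show "norm (L tor.\<kappa> (k, t, \<theta>)) \<le> 10 * norm (1 / X (k, t, \<theta>))"
      using tor.x_kappa[of k t \<theta>] tor.x_pos[of k t] by (simp add: field_simps)
  qed
  then show ?thesis using landau_o.big_trans inv_X_bdd by blast
qed

lemma ep_bdd: "ep \<in> sc.bdd"
  by (rule sc.big_imp_bdd[OF ep_big])

lemma K_bdd: "L tor.K \<in> sc.bdd" "L tor.Kt \<in> sc.bdd" "L tor.Kh \<in> sc.bdd"
  "L tor.Ktt \<in> sc.bdd" "L tor.Kth \<in> sc.bdd" "L tor.Khh \<in> sc.bdd"
  unfolding tor.K_def tor.Kt_def tor.Kh_def tor.Ktt_def tor.Kth_def tor.Khh_def case_prod_unfold
  by (intro sc.bdd_intros base_bdd ep_bdd sn_bdd cs_bdd)+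

lemma Q_bdd: "L tor.Qt \<in> sc.bdd" "L tor.Qh \<in> sc.bdd"
  "L tor.Qtt \<in> sc.bdd" "L tor.Qth \<in> sc.bdd" "L tor.Qhh \<in> sc.bdd"
  unfolding tor.Qt_def tor.Qh_def tor.Qtt_def tor.Qth_def tor.Qhh_def case_prod_unfold prod.collapse
  by (intro sc.bdd_intros base_bdd Yd_bdd K_bdd)+

lemma kappa_jet_bdd: "L tor.\<kappa>t \<in> sc.bdd" "L tor.\<kappa>h \<in> sc.bdd"
  "L tor.\<kappa>tt \<in> sc.bdd" "L tor.\<kappa>th \<in> sc.bdd" "L tor.\<kappa>hh \<in> sc.bdd"
  unfolding tor.\<kappa>tt_def tor.\<kappa>th_def tor.\<kappa>hh_def tor.\<kappa>t_def tor.\<kappa>h_def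
  by (intro sc.bdd_intros kappa_bdd Q_bdd)+

text \<open>The comparison function is left free because two scales occur: \<open>d\<close> in the
  expansions, and n^(-\<beta>) where the perturbation has to be negligible against 1/n.\<close>

lemma eta_jet_big:
  assumes "\<And>\<psi>. \<psi> \<in> {L \<phi>, L (\<lambda>k. d_t (\<phi> k)), L (\<lambda>k. d_\<theta> (\<phi> k)), L (\<lambda>k. d_t (d_t (\<phi> k))),
     L (\<lambda>k. d_\<theta> (d_t (\<phi> k))), L (\<lambda>k. d_\<theta> (d_\<theta> (\<phi> k)))} \<Longrightarrow> \<psi> \<in> O[Fil](b)"
  shows "L tor.\<eta> \<in> O[Fil](b)" "L tor.\<eta>t \<in> O[Fil](b)" "L tor.\<eta>h \<in> O[Fil](b)"
    "L tor.\<eta>tt \<in> O[Fil](b)" "L tor.\<eta>th \<in> O[Fil](b)" "L tor.\<eta>hh \<in> O[Fil](b)"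
proof -
  have m: "(\<lambda>q. u q * v q) \<in> O[Fil](b)" if "u \<in> O[Fil](b)" "v \<in> sc.bdd" for u v
    using landau_o.big.mult[OF that] by simp
  have c: "(\<lambda>q. 2 * u q) \<in> O[Fil](b)" if "u \<in> O[Fil](b)" for u
    using that by simp
  have p: "L \<phi> \<in> O[Fil](b)" "L (\<lambda>k. d_t (\<phi> k)) \<in> O[Fil](b)" "L (\<lambda>k. d_\<theta> (\<phi> k)) \<in> O[Fil](b)"
    "L (\<lambda>k. d_t (d_t (\<phi> k))) \<in> O[Fil](b)" "L (\<lambda>k. d_\<theta> (d_t (\<phi> k))) \<in> O[Fil](b)"
    "L (\<lambda>k. d_\<theta> (d_\<theta> (\<phi> k))) \<in> O[Fil](b)"
    by (rule assms; simp)+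
  note i = sum_in_bigo(1) m c kappa_bdd kappa_jet_bdd p
  show "L tor.\<eta> \<in> O[Fil](b)" unfolding tor.\<eta>_def by (intro i)
  show "L tor.\<eta>t \<in> O[Fil](b)" unfolding tor.\<eta>t_def by (intro i)
  show "L tor.\<eta>h \<in> O[Fil](b)" unfolding tor.\<eta>h_def by (intro i)
  show "L tor.\<eta>tt \<in> O[Fil](b)" unfolding tor.\<eta>tt_def by (intro i)
  show "L tor.\<eta>th \<in> O[Fil](b)" unfolding tor.\<eta>th_def by (intro i)
  show "L tor.\<eta>hh \<in> O[Fil](b)" unfolding tor.\<eta>hh_def by (intro i)
qed

text \<open>Coefficient of the first-order effect of bending the Delaunay surface into a torus.\<close>

definition ka :: "nat \<times> real \<times> real \<Rightarrow> real" where
  "ka q = (2*X q^3*Z q^3 + X q^5*Z q + (X q)\<^sup>2*(-(X q)\<^sup>2*Z q*X2 q + X q*Z q^3 + 2*X q*(Yd q)\<^sup>2*Z q + 2*X q^3*(Yd q)\<^sup>2) - 6*X q^5*(Z q)\<^sup>2) / X q ^ 4"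

lemmas expd0 = X_bdd[THEN sc.expd_zeroth] Yd_bdd[THEN sc.expd_zeroth] sn_bdd[THEN sc.expd_zeroth]
  cs_bdd[THEN sc.expd_zeroth] base_bdd[THEN sc.expd_zeroth]

lemma eta_big: "L tor.\<eta> \<in> O[Fil](d)" "L tor.\<eta>t \<in> O[Fil](d)" "L tor.\<eta>h \<in> O[Fil](d)"
    "L tor.\<eta>tt \<in> O[Fil](d)" "L tor.\<eta>th \<in> O[Fil](d)" "L tor.\<eta>hh \<in> O[Fil](d)"
  by (rule eta_jet_big, erule phi_big)+

lemmas expd1 = ep_big[THEN sc.expd_first] eta_big[THEN sc.expd_first]

section \<open>First-order expansions of the geometric data\<close>

lemma expd_K:
  "expd Fil d (L tor.K) Z (\<lambda>q. ep q * (sn q * Mm q))"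
  "expd Fil d (L tor.Kt) Zt (\<lambda>q. ep q * (sn q * Mt q))"
  "expd Fil d (L tor.Kh) (\<lambda>_. 0) (\<lambda>q. ep q * (cs q * Mm q))"
  "expd Fil d (L tor.Ktt) Ztt (\<lambda>q. ep q * (sn q * Mtt q))"
  "expd Fil d (L tor.Kth) (\<lambda>_. 0) (\<lambda>q. ep q * (cs q * Mt q))"
  "expd Fil d (L tor.Khh) (\<lambda>_. 0) (\<lambda>q. - ep q * (sn q * Mm q))"
  unfolding tor.K_def tor.Kt_def tor.Kh_def tor.Ktt_def tor.Kth_def tor.Khh_def case_prod_unfold
  by (rule sc.expd_cong', (rule expd0 expd1 sc.expd_intros)+, simp, simp)+

lemmas expd_rules = expd0 expd1 expd_K sc.expd_intros

abbreviation "e0 \<equiv> L tor.\<eta>"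
abbreviation "et \<equiv> L tor.\<eta>t"
abbreviation "eh \<equiv> L tor.\<eta>h"
abbreviation "ett \<equiv> L tor.\<eta>tt"
abbreviation "eth \<equiv> L tor.\<eta>th"
abbreviation "ehh \<equiv> L tor.\<eta>hh"
abbreviation "P0 \<equiv> \<lambda>q. - (e0 q * Z q)"
abbreviation "Pt0 \<equiv> \<lambda>q. - (et q * Z q + e0 q * Zt q)"
abbreviation "Ph0 \<equiv> \<lambda>q. - (eh q * Z q)"
abbreviation "Ptt0 \<equiv> \<lambda>q. - (ett q * Z q + 2 * et q * Zt q + e0 q * Ztt q)"
abbreviation "Pth0 \<equiv> \<lambda>q. - (eth q * Z q + eh q * Zt q)"
abbreviation "Phh0 \<equiv> \<lambda>q. - (ehh q * Z q)"
abbreviation "St0 \<equiv> \<lambda>q. et q * Yd q + e0 q * X2 q"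
abbreviation "Sh0 \<equiv> \<lambda>q. eh q * Yd q"
abbreviation "Stt0 \<equiv> \<lambda>q. ett q * Yd q + 2 * et q * X2 q + e0 q * Y2 q"
abbreviation "Sth0 \<equiv> \<lambda>q. eth q * Yd q + eh q * X2 q"
abbreviation "Shh0 \<equiv> \<lambda>q. ehh q * Yd q"

text \<open>The bending part of \<open>K\<close> is multiplied by \<eta>, a second-order effect. To
  first order the displacement is that of a normal graph over the unbent Delaunay surface, and no
  \<open>e\<close> appears.\<close>

lemma expd_PS:
  "expd Fil d (L tor.P) X P0"
  "expd Fil d (L tor.Pt) Yd Pt0"
  "expd Fil d (L tor.Ph) (\<lambda>_. 0) Ph0"
  "expd Fil d (L tor.Ptt) X2 Ptt0"
  "expd Fil d (L tor.Pth) (\<lambda>_. 0) Pth0"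
  "expd Fil d (L tor.Phh) (\<lambda>_. 0) Phh0"
  "expd Fil d (L tor.S) (\<lambda>_. 0) (\<lambda>q. e0 q * Yd q)"
  "expd Fil d (L tor.St) (\<lambda>_. 0) St0"
  "expd Fil d (L tor.Sh) (\<lambda>_. 0) Sh0"
  "expd Fil d (L tor.Stt) (\<lambda>_. 0) Stt0"
  "expd Fil d (L tor.Sth) (\<lambda>_. 0) Sth0"
  "expd Fil d (L tor.Shh) (\<lambda>_. 0) Shh0"
  unfolding tor.P_def tor.Pt_def tor.Ph_def tor.Ptt_def tor.Pth_def tor.Phh_def
    tor.S_def tor.St_def tor.Sh_def tor.Stt_def tor.Sth_def tor.Shh_def case_prod_unfold prod.collapse
  by (rule sc.expd_cong', (rule expd_rules)+, simp, simp)+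

lemma expd_T:
  "expd Fil d (L tor.fs.T1) Yd Pt0"
  "expd Fil d (L tor.fs.T2) (\<lambda>_. 0) (\<lambda>_. 0)"
  "expd Fil d (L tor.fs.T3) Z (\<lambda>q. St0 q + ep q * Z q * sn q * X q)"
  "expd Fil d (L tor.fs.T1h) (\<lambda>_. 0) Pth0"
  "expd Fil d (L tor.fs.T2h) (\<lambda>_. 0) (\<lambda>_. 0)"
  "expd Fil d (L tor.fs.T3h) (\<lambda>_. 0) (\<lambda>q. Sth0 q + ep q * Z q * cs q * X q)"
  "expd Fil d (L tor.fs.T1t) X2 Ptt0"
  "expd Fil d (L tor.fs.T2t) (\<lambda>_. 0) (\<lambda>_. 0)"
  "expd Fil d (L tor.fs.T3t) Zt (\<lambda>q. Stt0 q + ep q * sn q * (Zt q * X q + Z q * Yd q))"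
  unfolding tor.fs.T1_def tor.fs.T2_def tor.fs.T3_def tor.fs.T1h_def tor.fs.T2h_def tor.fs.T3h_def
    tor.fs.T1t_def tor.fs.T2t_def tor.fs.T3t_def case_prod_unfold prod.collapse
  by (rule sc.expd_cong', (rule expd_PS expd_rules)+, simp, simp)+

text \<open>Turns the curvature equation into a linear equation for x \<eta> with a uniform error.
  The size of H - 1 stays a hypothesis here, since it depends on where the surface lies.\<close>

lemma main_expansion:
  assumes Hc: "\<And>k. has_mean_curvature (\<lambda>p. torus_X (n k) (a k) p + \<phi> k p *\<^sub>R torus_N (n k) (a k) p) H"
    and h: "(\<lambda>q. H (tor.fs.Y (fst q) (snd q)) - 1) \<in> O[Fil](d)"
  shows "(\<lambda>q. L tor.ftt q + L tor.fhh q + 2 * ((X q)\<^sup>2 + (Gm q / X q)\<^sup>2) * L tor.f q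
     + ep q * sn q * ka q - 2 * (X q)\<^sup>2 * (H (tor.fs.Y (fst q) (snd q)) - 1)) \<in> o[Fil](d)"
proof -
  have "(\<lambda>q. X q * ett q + 2 * Yd q * et q + X2 q * e0 q + X q * ehh q
      + 2 * ((X q)\<^sup>2 + (Gm q / X q)\<^sup>2) * (X q * e0 q) + ep q * sn q * ka q
      - 2 * (X q)\<^sup>2 * (H (tor.fs.Y (fst q) (snd q)) - 1)) \<in> o[Fil](d)"
  proof (rule sc.curvature_expansion[where ?x2.0 = X2 and ?y2.0 = Y2 and zt = Zt and ztt = Ztt
        and y = Yd and z = Z and g = Gm and eh = eh and eth = eth and c = cs
        and ?P0.0 = P0 and Pt = Pt0 and Ph = Ph0 and Ptt = Ptt0 and Pth = Pth0 and Phh = Phh0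
        and St = St0 and Sh = Sh0 and Stt = Stt0 and Sth = Sth0 and Shh = Shh0
        and ?T1.0 = "L tor.fs.T1" and ?T2.0 = "L tor.fs.T2" and ?T3.0 = "L tor.fs.T3"
        and ?U1.0 = "L tor.Ph" and ?U2.0 = "L tor.P" and ?U3.0 = "L tor.Sh"
        and ?hh1.0 = "\<lambda>q. L tor.Phh q - L tor.P q" and ?hh2.0 = "\<lambda>q. 2 * L tor.Ph q" and ?hh3.0 = "L tor.Shh"
        and ?th1.0 = "\<lambda>q. L tor.fs.T1h q - L tor.fs.T2 q" and ?th2.0 = "\<lambda>q. L tor.fs.T2h q + L tor.fs.T1 q"
        and ?th3.0 = "L tor.fs.T3h"
        and ?tt1.0 = "L tor.fs.tt1" and ?tt2.0 = "L tor.fs.tt2" and ?tt3.0 = "L tor.fs.tt3"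
        and ?C1.0 = "L tor.fs.C1" and ?C2.0 = "L tor.fs.C2" and ?C3.0 = "L tor.fs.C3"
        and E = "L tor.fs.EE" and Fm = "L tor.fs.FF" and G = "L tor.fs.GG"])
    show "(Yd q)\<^sup>2 = (X q)\<^sup>2 - (Z q)\<^sup>2" for q :: "nat \<times> real \<times> real" by (rule tor.energy_zeta)
    show "Z q = (X q)\<^sup>2 - Gm q" for q :: "nat \<times> real \<times> real" by (rule tor.\<zeta>_def)
    show "X2 q = (1 + 2 * Gm q) * X q - 2 * X q ^ 3" for q :: "nat \<times> real \<times> real" by (rule tor.x2_def)
    show "Y2 q = (1 + 2 * Gm q) * Yd q - 6 * (X q)\<^sup>2 * Yd q" for q :: "nat \<times> real \<times> real" by (rule tor.y2_def)
    show "Zt q = 2 * X q * Yd q" for q :: "nat \<times> real \<times> real" by (rule tor.\<zeta>t_def)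
    show "Ztt q = 2 * (Yd q)\<^sup>2 + 2 * X q * X2 q" for q :: "nat \<times> real \<times> real" by (rule tor.\<zeta>tt_def)
    show "expd Fil d (\<lambda>q. L tor.Phh q - L tor.P q) (\<lambda>q. - X q) (\<lambda>q. Phh0 q - P0 q)"
      "expd Fil d (\<lambda>q. 2 * L tor.Ph q) (\<lambda>_. 0) (\<lambda>q. 2 * Ph0 q)"
      "expd Fil d (\<lambda>q. L tor.fs.T1h q - L tor.fs.T2 q) (\<lambda>_. 0) Pth0"
      "expd Fil d (\<lambda>q. L tor.fs.T2h q + L tor.fs.T1 q) Yd Pt0"
      by (rule sc.expd_cong', (rule expd_T expd_PS expd_rules)+, simp, simp)+
    show "expd Fil d (L tor.fs.tt1) X2 (\<lambda>q. Ptt0 q - ep q * Z q * sn q * Z q)"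
      "expd Fil d (L tor.fs.tt2) (\<lambda>_. 0) (\<lambda>q. - ep q * Z q * cs q * Z q)"
      "expd Fil d (L tor.fs.tt3) Zt (\<lambda>q. Stt0 q + ep q * Zt q * sn q * X q + 2 * ep q * Z q * sn q * Yd q)"
      unfolding tor.fs.tt1_def tor.fs.tt2_def tor.fs.tt3_def
      by (rule sc.expd_cong', (rule expd_T expd_PS expd_rules)+, simp, simp add: algebra_simps)+
    show "\<forall>\<^sub>F q in Fil. (L tor.fs.EE q * ((L tor.Phh q - L tor.P q) * L tor.fs.C1 q + 2 * L tor.Ph q * L tor.fs.C2 q + L tor.Shh q * L tor.fs.C3 q)
        - 2 * L tor.fs.FF q * ((L tor.fs.T1h q - L tor.fs.T2 q) * L tor.fs.C1 q + (L tor.fs.T2h q + L tor.fs.T1 q) * L tor.fs.C2 q + L tor.fs.T3h q * L tor.fs.C3 q)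
        + L tor.fs.GG q * (L tor.fs.tt1 q * L tor.fs.C1 q + L tor.fs.tt2 q * L tor.fs.C2 q + L tor.fs.tt3 q * L tor.fs.C3 q))\<^sup>2
      = 4 * (1 + (H (tor.fs.Y (fst q) (snd q)) - 1))\<^sup>2 * (L tor.fs.EE q * L tor.fs.GG q - (L tor.fs.FF q)\<^sup>2) ^ 3"
    proof (rule always_eventually, rule allI)
      fix q :: "nat \<times> real \<times> real"
      have "has_mean_curvature (tor.fs.Y (fst q)) H"
        using Hc[of "fst q"] unfolding tor.surface_eq .
      from tor.fs.curvature_equation[OF this, of "snd q"]
      show "(L tor.fs.EE q * ((L tor.Phh q - L tor.P q) * L tor.fs.C1 q + 2 * L tor.Ph q * L tor.fs.C2 q + L tor.Shh q * L tor.fs.C3 q)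
        - 2 * L tor.fs.FF q * ((L tor.fs.T1h q - L tor.fs.T2 q) * L tor.fs.C1 q + (L tor.fs.T2h q + L tor.fs.T1 q) * L tor.fs.C2 q + L tor.fs.T3h q * L tor.fs.C3 q)
        + L tor.fs.GG q * (L tor.fs.tt1 q * L tor.fs.C1 q + L tor.fs.tt2 q * L tor.fs.C2 q + L tor.fs.tt3 q * L tor.fs.C3 q))\<^sup>2
      = 4 * (1 + (H (tor.fs.Y (fst q) (snd q)) - 1))\<^sup>2 * (L tor.fs.EE q * L tor.fs.GG q - (L tor.fs.FF q)\<^sup>2) ^ 3"
        by (simp only: add_diff_cancel_left' diff_add_cancel add.commute[of 1])
    qed
    show "X q \<noteq> 0" for q :: "nat \<times> real \<times> real" using tor.x_pos[of "fst q" "fst (snd q)"] by simp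
  qed (rule expd_T expd_PS X_bdd inv_X_bdd h ka_def refl tor.fs.C1_def tor.fs.C2_def tor.fs.C3_def tor.fs.EE_def tor.fs.FF_def tor.fs.GG_def | simp add: tor.fs.C1_def tor.fs.C2_def tor.fs.C3_def tor.fs.EE_def tor.fs.FF_def tor.fs.GG_def)+
  then show ?thesis
    by (simp add: tor.f_def tor.ftt_def tor.fhh_def case_prod_unfold algebra_simps)
qed

end

section \<open>Position of the surface and the values of H along it\<close>

lemma tanh_sech: "1 - (tanh t)\<^sup>2 = (1 / cosh t)\<^sup>2" for t :: real
proof -
  have "1 - (tanh t)\<^sup>2 = ((cosh t)\<^sup>2 - (sinh t)\<^sup>2) / (cosh t)\<^sup>2"
    by (simp add: tanh_def power_divide diff_divide_distrib)
  also have "(cosh t)\<^sup>2 - (sinh t)\<^sup>2 = 1" by (simp add: cosh_square_eq)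
  finally show ?thesis by (simp add: power_divide)
qed

lemma (in del_small) z_bound: "\<bar>del_z a t\<bar> \<le> 2 * \<bar>t\<bar>"
proof -
  have "norm (del_z a t - del_z a 0) \<le> 2 * norm (t - 0)"
  proof (rule field_differentiable_bound[of UNIV])
    fix s
    show "(del_z a has_real_derivative (del_x a s)\<^sup>2 - del_\<gamma> a) (at s within UNIV)" using z_deriv by simp
    have "((del_x a s)\<^sup>2 - del_\<gamma> a)\<^sup>2 \<le> (del_x a s)\<^sup>2"
      using energy[of s] zero_le_power2[of "del_y a s"] by linarith
    then have "\<bar>(del_x a s)\<^sup>2 - del_\<gamma> a\<bar> \<le> \<bar>del_x a s\<bar>" by (simp add: abs_le_square_iff)
    then show "norm ((del_x a s)\<^sup>2 - del_\<gamma> a) \<le> 2"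
      using x_le[of s] x_pos[of s] a_small by simp
  qed auto
  then show ?thesis by simp
qed

lemma abs_cos_minus_one: "\<bar>cos u - 1\<bar> \<le> \<bar>u\<bar>" for u :: real
proof -
  have "\<bar>cos u - 1\<bar> = 2 * \<bar>sin (u / 2)\<bar> * \<bar>sin (u / 2)\<bar>"
    using cos_double_sin[of "u / 2"] by (simp add: power2_eq_square abs_mult)
  also have "\<dots> \<le> 2 * \<bar>u / 2\<bar> * 1"
    by (intro mult_mono abs_sin_x_le_abs_x) (auto intro: abs_sin_x_le_abs_x)
  finally show ?thesis by simp
qed

text \<open>The window is a piece of bounded size around the point of the core circle on the second
  axis: rotation by the angle u = e z moves that point by at most 2 |u| / e \<le> 4 |t|. Seen from
  the origin, at distance about 1/e, it collapses to the direction of that axis, which is why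
  \<open>A\<close> is evaluated there.\<close>

lemma (in torus) surface_near:
  "norm (fs.Y (t, \<theta>) - (1 / e) *\<^sub>R axis 2 1) \<le> 4 * \<bar>t\<bar> + \<bar>P (t, \<theta>)\<bar> + \<bar>S (t, \<theta>)\<bar>"
proof -
  let ?u = "e * del_z a t"
  let ?c = "vector [0, (cos ?u - 1) / e, sin ?u / e] :: real^3"
  have split: "fs.Y (t, \<theta>) - (1 / e) *\<^sub>R axis 2 1 = ?c + fr ?u \<theta> (P (t, \<theta>)) 0 (S (t, \<theta>))"
  proof -
    have 1: "sin \<theta> / e * cos \<theta> - cos \<theta> / e * sin \<theta> = 0" by simp
    have 2: "sin \<theta> / e * sin \<theta> + cos \<theta> / e * cos \<theta> = 1 / e"
      using trig_norm[of \<theta>] by (simp add: power2_eq_square add.commute flip: add_divide_distrib)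
    have "fs.Y (t, \<theta>) = fr ?u \<theta> (sin \<theta> / e) (cos \<theta> / e) 0 + fr ?u \<theta> (P (t, \<theta>)) 0 (S (t, \<theta>))"
      unfolding fs.Y_def prod.case fr_add by (simp add: add.commute)
    moreover have "fr ?u \<theta> (sin \<theta> / e) (cos \<theta> / e) 0 = ?c + (1 / e) *\<^sub>R axis 2 1"
      unfolding fr_def 1 2 by (simp add: vec_eq_iff forall_3 axis_def diff_divide_distrib)
    ultimately show ?thesis by simp
  qed
  have u: "\<bar>?u\<bar> / e \<le> 2 * \<bar>t\<bar>" using z_bound[of t] e_pos by (simp add: abs_mult)
  have "norm ?c \<le> (\<Sum>i\<in>UNIV. \<bar>?c $ i\<bar>)" by (rule norm_le_l1_cart)
  also have "\<dots> = \<bar>cos ?u - 1\<bar> / e + \<bar>sin ?u\<bar> / e" using e_pos by (simp add: sum_3)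
  also have "\<dots> \<le> \<bar>?u\<bar> / e + \<bar>?u\<bar> / e"
    using e_pos by (intro add_mono divide_right_mono abs_cos_minus_one abs_sin_x_le_abs_x) auto
  also have "\<dots> \<le> 4 * \<bar>t\<bar>" using u by simp
  finally have c: "norm ?c \<le> 4 * \<bar>t\<bar>" .
  have "(norm (fr ?u \<theta> (P (t, \<theta>)) 0 (S (t, \<theta>))))\<^sup>2 \<le> (\<bar>P (t, \<theta>)\<bar> + \<bar>S (t, \<theta>)\<bar>)\<^sup>2"
    unfolding fr_norm_sq by (simp add: power2_sum)
  from power2_le_imp_le[OF this]
  have "norm (fr ?u \<theta> (P (t, \<theta>)) 0 (S (t, \<theta>))) \<le> \<bar>P (t, \<theta>)\<bar> + \<bar>S (t, \<theta>)\<bar>" by simp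
  then show ?thesis
    unfolding split using c norm_triangle_ineq[of ?c "fr ?u \<theta> (P (t, \<theta>)) 0 (S (t, \<theta>))"] by linarith
qed

lemma C1_on_isCont:
  assumes "C1_on U g" "open U" "x \<in> U"
  shows "isCont g x"
proof -
  obtain D where "GDERIV g x :> D" using assms by (auto simp: C1_on_def)
  then show ?thesis unfolding gderiv_def by (rule has_derivative_continuous)
qed

context torus_seq
begin

abbreviation "YY \<equiv> \<lambda>q::nat \<times> real \<times> real. tor.fs.Y (fst q) (snd q)"

lemma ep_lim: "(ep \<longlongrightarrow> 0) Fil"
  by (rule smalloD_tendsto[where g = "\<lambda>_. 1", simplified]) (rule landau_o.big_small_trans[OF ep_big sc.d0])

lemma V_lim: "((\<lambda>q. ep q *\<^sub>R YY q) \<longlongrightarrow> axis 2 1) Fil"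
proof -
  define N where "N = (\<lambda>q. norm (YY q - (1 / ep q) *\<^sub>R axis 2 1))"
  have "N \<in> sc.bdd"
  proof -
    have "N \<in> O[Fil](\<lambda>q. 4 * T + \<bar>L tor.P q\<bar> + \<bar>L tor.S q\<bar>)"
    proof (rule bigoI[where c = 1], rule FilI)
      fix k t \<theta> assume "\<bar>t\<bar> \<le> T"
      then show "norm (N (k, t, \<theta>)) \<le> 1 * norm (4 * T + \<bar>L tor.P (k, t, \<theta>)\<bar> + \<bar>L tor.S (k, t, \<theta>)\<bar>)"
        using tor.surface_near[of k t \<theta>] pos by (simp add: N_def)
    qed
    moreover have "(\<lambda>q. 4 * T + \<bar>L tor.P q\<bar> + \<bar>L tor.S q\<bar>) \<in> sc.bdd"
      using expd_PS(1,7)[THEN sc.expd_bdd] by (intro sum_in_bigo(1)) auto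
    ultimately show ?thesis by (rule landau_o.big_trans)
  qed
  from sc.big_mult_bdd[OF ep_big this] have "(\<lambda>q. ep q * N q) \<in> o[Fil](\<lambda>_. 1)"
    using landau_o.big_small_trans sc.d0 by blast
  then have "((\<lambda>q. ep q * N q) \<longlongrightarrow> 0) Fil" by (rule smalloD_tendsto[where g = "\<lambda>_. 1", simplified])
  moreover have "ep q * N q = norm (ep q *\<^sub>R YY q - axis 2 1)" for q
  proof -
    have "ep q *\<^sub>R YY q - axis 2 1 = ep q *\<^sub>R (YY q - (1 / ep q) *\<^sub>R axis 2 1)"
      using tor.e_pos[of "fst q"] by (simp add: scaleR_diff_right)
    then show ?thesis using tor.e_pos[of "fst q"] by (simp add: N_def)
  qed
  ultimately have "((\<lambda>q. norm (ep q *\<^sub>R YY q - axis 2 1)) \<longlongrightarrow> 0) Fil" by simp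
  then show ?thesis by (simp add: tendsto_norm_zero_iff LIM_zero_iff)
qed

lemma norm_V_lim: "((\<lambda>q. norm (ep q *\<^sub>R YY q)) \<longlongrightarrow> 1) Fil"
  using tendsto_norm[OF V_lim] by simp

lemma Y_at_infinity: "filterlim YY at_infinity Fil"
proof -
  have "filterlim (\<lambda>q. inverse (ep q)) at_top Fil"
    by (rule filterlim_inverse_at_top[OF ep_lim]) (simp add: tor.e_pos)
  from filterlim_tendsto_pos_mult_at_top[OF norm_V_lim _ this]
  have "filterlim (\<lambda>q. norm (ep q *\<^sub>R YY q) * inverse (ep q)) at_top Fil" by simp
  moreover have "norm (ep q *\<^sub>R YY q) * inverse (ep q) = norm (YY q)" for q
    using tor.e_pos[of "fst q"] by simp
  ultimately have "filterlim (\<lambda>q. norm (YY q)) at_top Fil" by (simp only:)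
  then show ?thesis by (simp add: filterlim_at_infinity_conv_norm_at_top)
qed

text \<open>With V = e Y tending to the second unit vector, |Y| is |V| / e. Multiplied by
  e^(-\<beta>), the leading term therefore converges and the remainder is O(e^\<nu>).\<close>

lemma H_lim:
  assumes A: "C1_on_unit_sphere A" and nu: "\<nu> > 0"
    and H: "(\<lambda>X. H X - (1 + A (X /\<^sub>R norm X) / norm X powr \<beta>)) \<in> O[at_infinity](\<lambda>X. 1 / norm X powr (\<beta> + \<nu>))"
  shows "((\<lambda>q. (H (YY q) - 1) * ep q powr - \<beta>) \<longlongrightarrow> A (axis 2 1)) Fil"
proof -
  define V where "V = (\<lambda>q. ep q *\<^sub>R YY q)"
  have e: "ep q > 0" for q :: "nat \<times> real \<times> real" by (rule tor.e_pos)
  have V1: "((\<lambda>q. norm (V q)) \<longlongrightarrow> 1) Fil" unfolding V_def by (rule norm_V_lim)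
  have evV: "\<forall>\<^sub>F q in Fil. norm (V q) > 0" using order_tendstoD(1)[OF V1, of 0] by simp
  have nY: "norm (YY q) = norm (V q) / ep q" for q using e[of q] by (simp add: V_def)
  have sY: "YY q /\<^sub>R norm (YY q) = V q /\<^sub>R norm (V q)" for q
    using e[of q] by (simp add: V_def)
  \<comment> \<open>Only the values of \<open>A\<close> on the sphere are constrained, so continuity
    at the limit direction is taken from the extension \<open>g\<close>.\<close>
  obtain U g where g: "open U" "sphere 0 1 \<subseteq> U" "C1_on U g" "\<forall>x\<in>sphere 0 1. g x = A x"
    using A by (auto simp: C1_on_unit_sphere_def)
  have e2: "axis 2 1 \<in> sphere (0 :: real^3) 1" by (simp add: norm_axis_1)
  then have "isCont g (axis 2 1)" using g C1_on_isCont by blast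
  moreover have "((\<lambda>q. V q /\<^sub>R norm (V q)) \<longlongrightarrow> axis 2 1 /\<^sub>R 1) Fil"
    by (intro tendsto_intros V1) (use V_lim in \<open>simp_all add: V_def\<close>)
  ultimately have "((\<lambda>q. g (V q /\<^sub>R norm (V q))) \<longlongrightarrow> g (axis 2 1)) Fil"
    by (intro isCont_tendsto_compose[of _ g]) simp_all
  moreover have "\<forall>\<^sub>F q in Fil. g (V q /\<^sub>R norm (V q)) = A (YY q /\<^sub>R norm (YY q))"
    using evV
  proof (rule eventually_mono)
    fix q assume "norm (V q) > 0"
    then have "V q /\<^sub>R norm (V q) \<in> sphere 0 1" by simp
    then show "g (V q /\<^sub>R norm (V q)) = A (YY q /\<^sub>R norm (YY q))" unfolding sY using g(4) by blast
  qed
  ultimately have AL: "((\<lambda>q. A (YY q /\<^sub>R norm (YY q))) \<longlongrightarrow> A (axis 2 1)) Fil"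
    using g(4) e2 tendsto_cong by fastforce
  have pw: "((\<lambda>q. norm (V q) powr - b) \<longlongrightarrow> 1) Fil" for b
    using tendsto_powr[OF V1 tendsto_const[of "- b"]] by simp
  from tendsto_mult[OF AL pw[of \<beta>]]
  have 1: "((\<lambda>q. A (YY q /\<^sub>R norm (YY q)) * norm (V q) powr - \<beta>) \<longlongrightarrow> A (axis 2 1)) Fil" by simp
  define r where "r = (\<lambda>q. H (YY q) - (1 + A (YY q /\<^sub>R norm (YY q)) / norm (YY q) powr \<beta>))"
  have "r \<in> O[Fil](\<lambda>q. 1 / norm (YY q) powr (\<beta> + \<nu>))"
    unfolding r_def by (rule landau_o.big.compose[OF H Y_at_infinity])
  from landau_o.big.mult[OF this landau_o.big_refl[of "\<lambda>q. ep q powr - \<beta>"]]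
  have "(\<lambda>q. r q * ep q powr - \<beta>) \<in> O[Fil](\<lambda>q. 1 / norm (YY q) powr (\<beta> + \<nu>) * ep q powr - \<beta>)" .
  moreover have "(\<lambda>q. 1 / norm (YY q) powr (\<beta> + \<nu>) * ep q powr - \<beta>) \<in> o[Fil](\<lambda>_. 1)"
  proof (rule smalloI_tendsto)
    have "((\<lambda>q. ep q powr \<nu>) \<longlongrightarrow> 0) Fil"
      by (rule tendsto_zero_powrI[OF ep_lim tendsto_const _ nu]) (simp add: less_imp_le e)
    from tendsto_mult[OF pw[of "\<beta> + \<nu>"] this]
    have "((\<lambda>q. norm (V q) powr - (\<beta> + \<nu>) * ep q powr \<nu>) \<longlongrightarrow> 0) Fil" by simp
    moreover have "1 / norm (YY q) powr (\<beta> + \<nu>) * ep q powr - \<beta> = norm (V q) powr - (\<beta> + \<nu>) * ep q powr \<nu>" for q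
    proof -
      have "norm (YY q) powr (\<beta> + \<nu>) = norm (V q) powr (\<beta> + \<nu>) / ep q powr (\<beta> + \<nu>)"
        unfolding nY using e[of q] by (simp add: powr_divide less_imp_le)
      then have "1 / norm (YY q) powr (\<beta> + \<nu>) * ep q powr - \<beta>
          = norm (V q) powr - (\<beta> + \<nu>) * (ep q powr (\<beta> + \<nu>) * ep q powr - \<beta>)"
        unfolding powr_minus[of "norm (V q)"] by (simp add: divide_inverse)
      also have "ep q powr (\<beta> + \<nu>) * ep q powr - \<beta> = ep q powr \<nu>" by (simp flip: powr_add)
      finally show ?thesis .
    qed
    ultimately show "((\<lambda>q. 1 / norm (YY q) powr (\<beta> + \<nu>) * ep q powr - \<beta> / 1) \<longlongrightarrow> 0) Fil" by simp
  qed simp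
  ultimately have "(\<lambda>q. r q * ep q powr - \<beta>) \<in> o[Fil](\<lambda>_. 1)" by (rule landau_o.big_small_trans)
  then have "((\<lambda>q. r q * ep q powr - \<beta>) \<longlongrightarrow> 0) Fil" by (rule smalloD_tendsto[where g = "\<lambda>_. 1", simplified])
  from tendsto_add[OF 1 this]
  have "((\<lambda>q. A (YY q /\<^sub>R norm (YY q)) * norm (V q) powr - \<beta> + r q * ep q powr - \<beta>) \<longlongrightarrow> A (axis 2 1)) Fil" by simp
  moreover have "A (YY q /\<^sub>R norm (YY q)) * norm (V q) powr - \<beta> + r q * ep q powr - \<beta> = (H (YY q) - 1) * ep q powr - \<beta>" for q
  proof -
    have "norm (YY q) powr \<beta> = norm (V q) powr \<beta> / ep q powr \<beta>"
      unfolding nY using e[of q] by (simp add: powr_divide less_imp_le)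
    then have "A (YY q /\<^sub>R norm (YY q)) / norm (YY q) powr \<beta> * ep q powr - \<beta> = A (YY q /\<^sub>R norm (YY q)) * norm (V q) powr - \<beta>"
      using e[of q] by (simp add: powr_minus divide_inverse)
    then show ?thesis by (simp add: r_def algebra_simps)
  qed
  ultimately show ?thesis by simp
qed

lemma ep_powr_big: "(\<lambda>q. ep q powr \<beta>) \<in> O[Fil](\<lambda>q. real (n (fst q)) powr - \<beta>)"
proof (rule bigoI[where c = "40 powr \<beta>"], rule FilI)
  fix k t \<theta>
  have "tor.e k powr \<beta> \<le> (40 / real (n k)) powr \<beta>"
    using tor.e_le[of k] tor.e_pos[of k] pos by (intro powr_mono2) auto
  also have "\<dots> = 40 powr \<beta> * real (n k) powr - \<beta>"
    using n_pos[of k] by (simp add: powr_divide powr_minus_divide)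
  finally show "norm (ep (k, t, \<theta>) powr \<beta>) \<le> 40 powr \<beta> * norm (real (n (fst (k, t, \<theta>))) powr - \<beta>)" by simp
qed

lemma f_jet_big:
  assumes "\<And>\<psi>. \<psi> \<in> {L \<phi>, L (\<lambda>k. d_t (\<phi> k)), L (\<lambda>k. d_\<theta> (\<phi> k)), L (\<lambda>k. d_t (d_t (\<phi> k))),
     L (\<lambda>k. d_\<theta> (d_t (\<phi> k))), L (\<lambda>k. d_\<theta> (d_\<theta> (\<phi> k)))} \<Longrightarrow> \<psi> \<in> O[Fil](b)"
  shows "L tor.f \<in> O[Fil](b)" "L tor.ftt \<in> O[Fil](b)" "L tor.fhh \<in> O[Fil](b)"
proof -
  have m: "(\<lambda>q. u q * v q) \<in> O[Fil](b)" if "u \<in> sc.bdd" "v \<in> O[Fil](b)" for u v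
    using landau_o.big.mult[OF that] by simp
  have y: "(\<lambda>q. 2 * Yd q) \<in> sc.bdd" using Yd_bdd by simp
  note i = sum_in_bigo(1) m[OF X_bdd] m[OF base_bdd(1)] m[OF y] eta_jet_big[OF assms]
  show "L tor.f \<in> O[Fil](b)" "L tor.ftt \<in> O[Fil](b)" "L tor.fhh \<in> O[Fil](b)"
    unfolding tor.f_def tor.ftt_def tor.fhh_def case_prod_unfold prod.collapse
    by (intro i; assumption)+
qed

lemma gamma_lim: "(Gm \<longlongrightarrow> 0) Fil"
proof -
  have "((\<lambda>k. a k * (1 + a k)) \<longlongrightarrow> 0 * (1 + 0)) sequentially" by (intro tendsto_intros a_lim)
  then show ?thesis using lim_fst[of "\<lambda>k. del_\<gamma> (a k)" 0] by (simp add: del_\<gamma>_def)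
qed

lemma h_big:
  assumes "((\<lambda>q. (H (YY q) - 1) * ep q powr - \<beta>) \<longlongrightarrow> l) Fil"
  shows "(\<lambda>q. H (YY q) - 1) \<in> O[Fil](\<lambda>q. real (n (fst q)) powr - \<beta>)"
proof -
  have "(\<lambda>q. (H (YY q) - 1) * ep q powr - \<beta>) \<in> sc.bdd"
    by (rule bigoI_tendsto[where c = l]) (use assms in auto)
  from landau_o.big.mult[OF this ep_powr_big]
  have "(\<lambda>q. (H (YY q) - 1) * ep q powr - \<beta> * ep q powr \<beta>) \<in> O[Fil](\<lambda>q. real (n (fst q)) powr - \<beta>)" by simp
  moreover have "(H (YY q) - 1) * ep q powr - \<beta> * ep q powr \<beta> = H (YY q) - 1" for q
    using tor.e_pos[of "fst q"] by (simp add: powr_minus)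
  ultimately show ?thesis by (simp only:)
qed

lemma beta_not_gt_one:
  assumes Hc: "\<And>k. has_mean_curvature (\<lambda>p. torus_X (n k) (a k) p + \<phi> k p *\<^sub>R torus_N (n k) (a k) p) H"
    and lim: "((\<lambda>q. (H (YY q) - 1) * ep q powr - \<beta>) \<longlongrightarrow> l) Fil"
  shows "\<beta> \<le> 1"
proof (rule ccontr)
  assume "\<not> \<beta> \<le> 1"
  then have b: "\<beta> > 1" by simp
  let ?b = "\<lambda>q::nat \<times> real \<times> real. real (n (fst q)) powr - \<beta>"
  have d: "d q = 1 / real (n (fst q))" for q
    using b n_pos[of "fst q"] by (simp add: d_def powr_minus_divide)
  have small: "?b \<in> o[Fil](d)"
  proof (rule smalloI_tendsto)
    have "?b q / d q = real (n (fst q)) powr - (\<beta> - 1)" for q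
      using n_pos[of "fst q"] b by (simp add: d_def powr_diff powr_minus field_simps)
    then show "((\<lambda>q. ?b q / d q) \<longlongrightarrow> 0) Fil" using powr_lim[of "\<beta> - 1"] b by simp
    show "\<forall>\<^sub>F q in Fil. d q \<noteq> 0" using d_pos by (simp add: less_imp_neq[THEN not_sym])
  qed
  note sm = landau_o.big_small_trans[OF _ small]
  have h: "(\<lambda>q. H (YY q) - 1) \<in> o[Fil](d)" by (rule sm[OF h_big[OF lim]])
  have f: "L tor.f \<in> o[Fil](d)" "L tor.ftt \<in> o[Fil](d)" "L tor.fhh \<in> o[Fil](d)"
    by (rule sm, rule f_jet_big, erule phi_big_beta)+
  note M = main_expansion[OF Hc landau_o.small_imp_big[OF h]]
  have b1: "(\<lambda>q. 2 * ((X q)\<^sup>2 + (Gm q / X q)\<^sup>2)) \<in> sc.bdd"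
    unfolding power_divide divide_inverse[of "_\<^sup>2"]
    using sc.bdd_power[OF inv_X_bdd, of 2]
    by (intro sc.bdd_intros(1,3-) X_bdd Gm_bdd) (simp add: power_one_over inverse_eq_divide)
  have b2: "(\<lambda>q. 2 * (X q)\<^sup>2) \<in> sc.bdd" by (intro sc.bdd_intros X_bdd)
  define Er where "Er = (\<lambda>q. L tor.ftt q + L tor.fhh q + 2 * ((X q)\<^sup>2 + (Gm q / X q)\<^sup>2) * L tor.f q
     - 2 * (X q)\<^sup>2 * (H (YY q) - 1))"
  have "Er \<in> o[Fil](d)" unfolding Er_def
    by (intro sum_in_smallo(2) sum_in_smallo(1) f sc.bdd_mult_small[OF b1 f(1)] sc.bdd_mult_small[OF b2 h])
  from sum_in_smallo(2)[OF M this] have S: "(\<lambda>q. ep q * sn q * ka q) \<in> o[Fil](d)"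
    by (simp add: Er_def algebra_simps)
  \<comment> \<open>The threshold 1/8 combined with e \<ge> 1/(2 n) will give |ka| \<le> 1/4,
    incompatible with the limit -1.\<close>
  then have "\<forall>\<^sub>F q in Fil. norm (ep q * sn q * ka q) \<le> 1/8 * norm (d q)"
    by (rule landau_o.smallD) simp
  then have "\<forall>\<^sub>F k in sequentially. \<forall>p\<in>box. norm (ep (k, p) * sn (k, p) * ka (k, p)) \<le> 1/8 * norm (d (k, p))"
    by (simp only: eventually_Fil)
  moreover have pb: "(0, pi/2) \<in> box" using pos by (simp add: box_def)
  ultimately have 1: "\<forall>\<^sub>F k in sequentially. \<bar>ka (k, 0, pi/2)\<bar> \<le> 1/4"
  proof (rule_tac eventually_mono)
    fix k assume "\<forall>p\<in>box. norm (ep (k, p) * sn (k, p) * ka (k, p)) \<le> 1/8 * norm (d (k, p))"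
    from bspec[OF this pb] have "tor.e k * \<bar>ka (k, 0, pi/2)\<bar> \<le> 1/8 * (1 / real (n k))"
      using tor.e_pos[of k] by (simp add: d abs_mult)
    moreover have "1 / (2 * real (n k)) * \<bar>ka (k, 0, pi/2)\<bar> \<le> tor.e k * \<bar>ka (k, 0, pi/2)\<bar>"
      using tor.e_ge[of k] by (intro mult_right_mono) auto
    ultimately have "1 / (2 * real (n k)) * \<bar>ka (k, 0, pi/2)\<bar> \<le> 1/8 * (1 / real (n k))" by linarith
    then show "\<bar>ka (k, 0, pi/2)\<bar> \<le> 1/4" using n_pos[of k] by (simp add: field_simps)
  qed
  \<comment> \<open>At t = 0 one has y = 0, x and \<zeta> tend to 1 and \<open>x2\<close> tends to
    -1, so the coefficient tends to 2 + 1 + (1 + 1) - 6 = -1.\<close>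
  have "((\<lambda>k. ka (k, 0, pi/2)) \<longlongrightarrow> - 1) sequentially"
  proof -
    let ?x = "\<lambda>k. 1 + a k" and ?g = "\<lambda>k. a k * (1 + a k)"
    let ?z = "\<lambda>k. (?x k)\<^sup>2 - ?g k" and ?x2 = "\<lambda>k. (1 + 2 * ?g k) * ?x k - 2 * ?x k ^ 3"
    have "((\<lambda>k. (2*?x k^3*?z k^3 + ?x k^5*?z k + (?x k)\<^sup>2*(-(?x k)\<^sup>2*?z k*?x2 k + ?x k*?z k^3 + 2*?x k*0\<^sup>2*?z k + 2*?x k^3*0\<^sup>2) - 6*?x k^5*(?z k)\<^sup>2) / ?x k ^ 4)
      \<longlongrightarrow> (2*(1+0)^3*((1+0)\<^sup>2-0*(1+0))^3 + (1+0)^5*((1+0)\<^sup>2-0*(1+0)) + (1+0)\<^sup>2*(-(1+0)\<^sup>2*((1+0)\<^sup>2-0*(1+0))*((1+2*(0*(1+0)))*(1+0)-2*(1+0)^3) + (1+0)*((1+0)\<^sup>2-0*(1+0))^3 + 2*(1+0)*0\<^sup>2*((1+0)\<^sup>2-0*(1+0)) + 2*(1+0)^3*0\<^sup>2) - 6*(1+0)^5*((1+0)\<^sup>2-0*(1+0))\<^sup>2) / (1+0)^4) sequentially"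
      by (intro tendsto_intros a_lim) simp
    then show ?thesis
      by (simp add: ka_def tor.x_0 tor.\<zeta>_def tor.x2_def del_\<gamma>_def)
  qed
  then have "\<forall>\<^sub>F k in sequentially. ka (k, 0, pi/2) < - 1/2" by (rule order_tendstoD) simp
  with 1 have "\<forall>\<^sub>F k in sequentially. False" by eventually_elim linarith
  then show False by simp
qed

text \<open>In the expansion, x^2 is replaced by sech^2, \<gamma>/x by 0 and H - 1 by the constant l
  e^\<beta>; each replacement costs o(1) times O(d) or a bounded factor times o(d). Both sides of
  the resulting estimate scale like n^(-\<beta>), which cancels. The factor (1/2)^\<beta> comes from
  e \<ge> 1/(2 n), and 200000 is 2 times 50000 times 2, the last 2 from x \<le> 2 / cosh T at the
  ends of the window.\<close>

lemma key_inequality: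
  assumes Hc: "\<And>k. has_mean_curvature (\<lambda>p. torus_X (n k) (a k) p + \<phi> k p *\<^sub>R torus_N (n k) (a k) p) H"
    and lim: "((\<lambda>q. (H (YY q) - 1) * ep q powr - \<beta>) \<longlongrightarrow> l) Fil"
    and per: "\<And>k t \<theta>. \<phi> k (t, \<theta> + 2 * pi) = \<phi> k (t, \<theta>)"
    and b: "\<beta> \<le> 1"
  shows "\<bar>l\<bar> * (1/2) powr \<beta> * tanh T \<le> 200000 * R * (1 + T) / cosh T"
proof -
  have d: "d q = real (n (fst q)) powr - \<beta>" for q using b by (simp add: d_def)
  have dfun: "d = (\<lambda>q. real (n (fst q)) powr - \<beta>)" using d by (rule ext)
  have h: "(\<lambda>q. H (YY q) - 1) \<in> O[Fil](d)" unfolding dfun by (rule h_big[OF lim])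
  note M = main_expansion[OF Hc h]
  have f: "L tor.f \<in> O[Fil](d)" by (rule f_jet_big, erule phi_big)
  have Xs: "(\<lambda>q. (X q)\<^sup>2 - (1 - (tanh (fst (snd q)))\<^sup>2)) \<in> o[Fil](\<lambda>_. 1)"
  proof -
    have "(\<lambda>q. 1 / cosh (fst (snd q))) \<in> sc.bdd"
      by (rule bddI[where C = 1]) (simp add: cosh_real_ge_1)
    then have "(\<lambda>q. X q + 1 / cosh (fst (snd q))) \<in> sc.bdd" using X_bdd by (rule sum_in_bigo(1)[rotated])
    moreover have "(\<lambda>q. X q - 1 / cosh (fst (snd q))) \<in> o[Fil](\<lambda>_. 1)"
      using sech_lim by (intro smalloI_tendsto) auto
    ultimately have "(\<lambda>q. (X q + 1 / cosh (fst (snd q))) * (X q - 1 / cosh (fst (snd q)))) \<in> o[Fil](\<lambda>_. 1)"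
      using landau_o.big_small_mult by fastforce
    moreover have "(X q + 1 / cosh (fst (snd q))) * (X q - 1 / cosh (fst (snd q))) = (X q)\<^sup>2 - (1 - (tanh (fst (snd q)))\<^sup>2)" for q :: "nat \<times> real \<times> real"
      unfolding tanh_sech by (simp add: power2_eq_square algebra_simps)
    ultimately show ?thesis by (simp only:)
  qed
  have gX: "(\<lambda>q. (Gm q / X q)\<^sup>2) \<in> o[Fil](\<lambda>_. 1)"
  proof -
    have "Gm \<in> o[Fil](\<lambda>_. 1)" using gamma_lim by (intro smalloI_tendsto) auto
    from landau_o.small_big_mult[OF this inv_X_bdd] have "(\<lambda>q. Gm q / X q) \<in> o[Fil](\<lambda>_. 1)" by simp
    from landau_o.small_mult[OF this this] show ?thesis by (simp add: power2_eq_square)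
  qed
  define C where "C = (\<lambda>q::nat \<times> real \<times> real. l * ep q powr \<beta>)"
  have hC: "(\<lambda>q. H (YY q) - 1 - C q) \<in> o[Fil](d)"
  proof -
    have "((\<lambda>q. (H (YY q) - 1) * ep q powr - \<beta> - l) \<longlongrightarrow> 0) Fil" using lim by (simp add: LIM_zero)
    then have "(\<lambda>q. (H (YY q) - 1) * ep q powr - \<beta> - l) \<in> o[Fil](\<lambda>_. 1)" by (intro smalloI_tendsto) auto
    from landau_o.small_big_mult[OF this ep_powr_big]
    have "(\<lambda>q. ((H (YY q) - 1) * ep q powr - \<beta> - l) * ep q powr \<beta>) \<in> o[Fil](d)" by (simp add: dfun)
    moreover have "((H (YY q) - 1) * ep q powr - \<beta> - l) * ep q powr \<beta> = H (YY q) - 1 - C q" for q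
      using tor.e_pos[of "fst q"] by (simp add: C_def powr_minus field_simps)
    ultimately show ?thesis by (simp only:)
  qed
  define s2 where "s2 = (\<lambda>q::nat \<times> real \<times> real. 1 - (tanh (fst (snd q)))\<^sup>2)"
  have s2b: "(\<lambda>q. 2 * s2 q) \<in> sc.bdd"
  proof (rule bddI[where C = 2])
    fix k and t \<theta> :: real
    have "1 \<le> (cosh t)\<^sup>2" using cosh_real_ge_1[of t] by (simp add: one_le_power)
    then show "\<bar>2 * s2 (k, t, \<theta>)\<bar> \<le> 2" unfolding s2_def tanh_sech by (simp add: power_divide divide_le_eq)
  qed
  have two: "(\<lambda>q. 2 * u q) \<in> o[Fil](\<lambda>_. 1)" if "u \<in> o[Fil](\<lambda>_. 1)" for u :: "nat \<times> real \<times> real \<Rightarrow> real"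
    using that by simp
  define E1 where "E1 = (\<lambda>q. 2 * ((X q)\<^sup>2 - s2 q + (Gm q / X q)\<^sup>2))"
  have "(\<lambda>q. (X q)\<^sup>2 - s2 q + (Gm q / X q)\<^sup>2) \<in> o[Fil](\<lambda>_. 1)"
    using sum_in_smallo(1)[OF Xs gX] by (simp add: s2_def)
  from two[OF this] have E1: "E1 \<in> o[Fil](\<lambda>_. 1)" unfolding E1_def .
  define E2 where "E2 = (\<lambda>q. 2 * ((X q)\<^sup>2 - s2 q))"
  have E2: "E2 \<in> o[Fil](\<lambda>_. 1)" using two[OF Xs] unfolding E2_def s2_def .
  have p1: "(\<lambda>q. E1 q * L tor.f q) \<in> o[Fil](d)" using landau_o.small_big_mult[OF E1 f] by simp
  have p2: "(\<lambda>q. E2 q * (H (YY q) - 1)) \<in> o[Fil](d)" using landau_o.small_big_mult[OF E2 h] by simp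
  have p3: "(\<lambda>q. 2 * s2 q * (H (YY q) - 1 - C q)) \<in> o[Fil](d)" by (rule sc.bdd_mult_small[OF s2b hC])
  have "(\<lambda>q. (L tor.ftt q + L tor.fhh q + 2 * ((X q)\<^sup>2 + (Gm q / X q)\<^sup>2) * L tor.f q
     + ep q * sn q * ka q - 2 * (X q)\<^sup>2 * (H (YY q) - 1))
     - E1 q * L tor.f q + (E2 q * (H (YY q) - 1) + 2 * s2 q * (H (YY q) - 1 - C q))) \<in> o[Fil](d)"
    by (rule sum_in_smallo(1)[OF sum_in_smallo(2)[OF M p1] sum_in_smallo(1)[OF p2 p3]])
  moreover have "(L tor.ftt q + L tor.fhh q + 2 * ((X q)\<^sup>2 + (Gm q / X q)\<^sup>2) * L tor.f q
     + ep q * sn q * ka q - 2 * (X q)\<^sup>2 * (H (YY q) - 1))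
     - E1 q * L tor.f q + (E2 q * (H (YY q) - 1) + 2 * s2 q * (H (YY q) - 1 - C q))
     = L tor.ftt q + L tor.fhh q + 2 * s2 q * L tor.f q + ep q * ka q * sn q - 2 * s2 q * C q" for q
    unfolding E1_def E2_def by (simp add: algebra_simps)
  ultimately have G: "(\<lambda>q. L tor.ftt q + L tor.fhh q + 2 * s2 q * L tor.f q + ep q * ka q * sn q - 2 * s2 q * C q) \<in> o[Fil](d)"
    by (simp only:)
  have "\<bar>l\<bar> * (1/2) powr \<beta> * tanh T \<le> 200000 * R * (1 + T) / cosh T + y" if "y > 0" for y
  proof -
    \<comment> \<open>Chosen so that the error term T (1 + T) \<epsilon> of the test argument is
      exactly \<open>y\<close>.\<close>
    define \<epsilon> where "\<epsilon> = y / (T * (1 + T))"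
    have TT: "T * (1 + T) > 0" using pos by simp
    then have ep: "\<epsilon> > 0" "T * (1 + T) * \<epsilon> = y" using that pos by (simp_all add: \<epsilon>_def)
    have "\<forall>\<^sub>F q in Fil. norm (L tor.ftt q + L tor.fhh q + 2 * s2 q * L tor.f q + ep q * ka q * sn q - 2 * s2 q * C q) \<le> \<epsilon> * norm (d q)"
      by (rule landau_o.smallD[OF G ep(1)])
    moreover have "\<forall>\<^sub>F q in Fil. dist (X q - 1 / cosh (fst (snd q))) 0 < 1 / cosh T"
      using sech_lim by (rule tendstoD) simp
    ultimately have "\<forall>\<^sub>F q in Fil. norm (L tor.ftt q + L tor.fhh q + 2 * s2 q * L tor.f q + ep q * ka q * sn q - 2 * s2 q * C q) \<le> \<epsilon> * norm (d q)
        \<and> dist (X q - 1 / cosh (fst (snd q))) 0 < 1 / cosh T" by (rule eventually_conj)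
    from eventually_happens'[OF sequentially_bot this[unfolded eventually_Fil]]
    obtain k where k: "\<forall>p\<in>box. norm (L tor.ftt (k, p) + L tor.fhh (k, p) + 2 * s2 (k, p) * L tor.f (k, p) + ep (k, p) * ka (k, p) * sn (k, p) - 2 * s2 (k, p) * C (k, p)) \<le> \<epsilon> * norm (d (k, p))
        \<and> dist (X (k, p) - 1 / cosh (fst (snd (k, p)))) 0 < 1 / cosh T" ..
    define D where "D = real (n k) powr - \<beta>"
    have D: "D > 0" using n_pos[of k] by (simp add: D_def)
    define c where "c = l * tor.e k powr \<beta>"
    have xT: "del_x (a k) t \<le> 2 / cosh T" if "\<bar>t\<bar> = T" for t
    proof -
      have "(t, 0) \<in> box" using that by (auto simp: box_def)
      from bspec[OF k this] have "dist (del_x (a k) t - 1 / cosh t) 0 < 1 / cosh T"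
        by (simp only: fst_conv snd_conv)
      moreover have "cosh t = cosh T" using that by (metis cosh_real_abs)
      ultimately show ?thesis by (simp add: dist_real_def abs_less_iff)
    qed
    have bd: "\<bar>tor.f k (t, \<theta>)\<bar> \<le> 50000 * (R * D * (2 / cosh T))" "\<bar>tor.ft k (t, \<theta>)\<bar> \<le> 50000 * (R * D * (2 / cosh T))"
      if t: "\<bar>t\<bar> = T" "\<bar>\<theta>\<bar> \<le> pi" for t \<theta>
    proof -
      have "R * D * del_x (a k) t \<le> R * D * (2 / cosh T)"
        using xT[OF t(1)] D pos by (intro mult_left_mono) auto
      moreover have "\<bar>\<phi> k (t, \<theta>)\<bar> \<le> R * D * del_x (a k) t" "\<bar>d_t (\<phi> k) (t, \<theta>)\<bar> \<le> R * D * del_x (a k) t"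
        unfolding D_def by (rule bnd; use t in simp)+
      ultimately have "\<bar>\<phi> k (t, \<theta>)\<bar> \<le> R * D * (2 / cosh T)" "\<bar>d_t (\<phi> k) (t, \<theta>)\<bar> \<le> R * D * (2 / cosh T)"
        by linarith+
      then show "\<bar>tor.f k (t, \<theta>)\<bar> \<le> 50000 * (R * D * (2 / cosh T))" "\<bar>tor.ft k (t, \<theta>)\<bar> \<le> 50000 * (R * D * (2 / cosh T))"
        by (rule tor.f_bounds)+
    qed
    have "\<bar>c\<bar> * tanh T \<le> 2 * (1 + T) * (50000 * (R * D * (2 / cosh T))) + T * (1 + T) * (\<epsilon> * D)"
    proof (rule green_test[where f = "tor.f k" and ft = "tor.ft k" and ftt = "tor.ftt k" and fh = "tor.fh k"
          and fhh = "tor.fhh k" and b = "\<lambda>t. tor.e k * ka (k, t, 0)"])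
      fix t \<theta> assume "\<bar>t\<bar> \<le> T" "\<bar>\<theta>\<bar> \<le> pi"
      then have "(t, \<theta>) \<in> box" by (auto simp: box_def)
      from bspec[OF k this] have "norm (tor.ftt k (t, \<theta>) + tor.fhh k (t, \<theta>) + 2 * s2 (k, t, \<theta>) * tor.f k (t, \<theta>) + tor.e k * ka (k, t, \<theta>) * sin \<theta> - 2 * s2 (k, t, \<theta>) * C (k, t, \<theta>)) \<le> \<epsilon> * norm (d (k, t, \<theta>))"
        by (simp only: fst_conv snd_conv)
      \<comment> \<open>The test argument asks for a coefficient of sin \<theta> that depends on t
        alone.\<close>
      moreover have "ka (k, t, \<theta>) = ka (k, t, 0)" by (simp add: ka_def)
      ultimately show "\<bar>tor.ftt k (t, \<theta>) + tor.fhh k (t, \<theta>) + 2 * (1 - (tanh t)\<^sup>2) * tor.f k (t, \<theta>) + tor.e k * ka (k, t, 0) * sin \<theta> - 2 * (1 - (tanh t)\<^sup>2) * c\<bar> \<le> \<epsilon> * D"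
        using D by (simp add: s2_def C_def c_def d D_def)
    next
      show "tor.fh k (t, pi) = tor.fh k (t, - pi)" for t by (rule tor.fh_periodic[OF per])
    qed (use pos bd tor.f_deriv tor.f_continuous in auto)
    also have "\<dots> = D * (200000 * R * (1 + T) / cosh T + y)"
      unfolding ep(2)[symmetric] by (simp add: algebra_simps)
    finally have c1: "\<bar>c\<bar> * tanh T \<le> D * (200000 * R * (1 + T) / cosh T + y)" .
    have "(1/2) powr \<beta> * D = (1 / (2 * real (n k))) powr \<beta>"
      using n_pos[of k] by (simp add: D_def powr_minus_divide powr_divide powr_mult)
    also have "\<dots> \<le> tor.e k powr \<beta>"
      using tor.e_ge[of k] pos n_pos[of k] by (intro powr_mono2) auto
    finally have "\<bar>l\<bar> * ((1/2) powr \<beta> * D) \<le> \<bar>c\<bar>" by (simp add: c_def abs_mult mult_left_mono)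
    then have "\<bar>l\<bar> * ((1/2) powr \<beta> * D) * tanh T \<le> \<bar>c\<bar> * tanh T"
      using pos by (intro mult_right_mono) auto
    with c1 have "D * (\<bar>l\<bar> * (1/2) powr \<beta> * tanh T) \<le> D * (200000 * R * (1 + T) / cosh T + y)"
      by (simp add: mult.commute mult.left_commute)
    then show ?thesis using D by (simp only: mult_le_cancel_left_pos)
  qed
  then show ?thesis by (rule field_le_epsilon)
qed

end

section \<open>Conclusion\<close>

lemma weighted_C2_norm_bound:
  assumes le: "weighted_C2_norm n a \<phi> \<le> ereal B" and p: "p \<in> torus_K n a" and x: "del_x a (fst p) > 0"
    and \<psi>: "\<psi> \<in> {\<phi>, d_t \<phi>, d_\<theta> \<phi>, d_t (d_t \<phi>), d_\<theta> (d_t \<phi>), d_\<theta> (d_\<theta> \<phi>)}"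
  shows "\<bar>\<psi> p\<bar> \<le> B * del_x a (fst p)"
proof -
  have "ereal ((\<bar>\<phi> p\<bar> + norm (grad_plane \<phi> p) + norm (hess_plane \<phi> p)) / del_x a (fst p)) \<le> weighted_C2_norm n a \<phi>"
    unfolding weighted_C2_norm_def by (rule SUP_upper[OF p])
  also note le
  finally have "\<bar>\<phi> p\<bar> + norm (grad_plane \<phi> p) + norm (hess_plane \<phi> p) \<le> B * del_x a (fst p)"
    using x by (simp add: pos_divide_le_eq)
  moreover have "\<bar>d_t \<phi> p\<bar> \<le> norm (grad_plane \<phi> p)" "\<bar>d_\<theta> \<phi> p\<bar> \<le> norm (grad_plane \<phi> p)"
    using component_le_norm_cart[of "grad_plane \<phi> p" 1] component_le_norm_cart[of "grad_plane \<phi> p" 2]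
    by (simp_all add: grad_plane_def)
  moreover have hess: "\<bar>hess_plane \<phi> p $ i $ j\<bar> \<le> norm (hess_plane \<phi> p)" for i j
    using component_le_norm_cart[of "hess_plane \<phi> p $ i" j] Finite_Cartesian_Product.norm_nth_le[of "hess_plane \<phi> p" i] by simp
  have "\<bar>d_t (d_t \<phi>) p\<bar> \<le> norm (hess_plane \<phi> p)" "\<bar>d_\<theta> (d_t \<phi>) p\<bar> \<le> norm (hess_plane \<phi> p)"
    "\<bar>d_\<theta> (d_\<theta> \<phi>) p\<bar> \<le> norm (hess_plane \<phi> p)"
    using hess[of 1 1] hess[of 1 2] hess[of 2 2] by (simp_all add: hess_plane_def)
  moreover have "norm (grad_plane \<phi> p) \<ge> 0" "norm (hess_plane \<phi> p) \<ge> 0" "\<bar>\<phi> p\<bar> \<ge> 0" by simp_all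
  ultimately have "\<bar>\<phi> p\<bar> \<le> B * del_x a (fst p)" "\<bar>d_t \<phi> p\<bar> \<le> B * del_x a (fst p)" "\<bar>d_\<theta> \<phi> p\<bar> \<le> B * del_x a (fst p)"
    "\<bar>d_t (d_t \<phi>) p\<bar> \<le> B * del_x a (fst p)" "\<bar>d_\<theta> (d_t \<phi>) p\<bar> \<le> B * del_x a (fst p)"
    "\<bar>d_\<theta> (d_\<theta> \<phi>) p\<bar> \<le> B * del_x a (fst p)" by linarith+
  then show ?thesis using \<psi> by (elim insertE emptyE) simp_all
qed

text \<open>Follows from exp T = exp (T/2)^2 and exp s \<ge> 1 + s. Quadratic growth suffices to
  beat the factor 1 + T produced by the linear growth of \<open>w\<close>.\<close>

lemma cosh_real_ge_quadratic: "(1 + T)\<^sup>2 / 8 \<le> cosh T" if "T \<ge> 0" for T :: real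
proof -
  have "(1 + T) / 2 \<le> 1 + T / 2" using that by simp
  also have "\<dots> \<le> exp (T / 2)" by (rule exp_ge_add_one_self)
  finally have "((1 + T) / 2)\<^sup>2 \<le> (exp (T / 2))\<^sup>2" using that by (intro power_mono) auto
  also have "\<dots> = exp T" by (simp flip: exp_of_nat_mult exp_double)
  also have "\<dots> \<le> 2 * cosh T" by (simp add: cosh_field_def)
  finally show ?thesis by (simp add: power_divide)
qed

theorem theorem1p1:
  fixes H :: "real^3 \<Rightarrow> real" and A :: "real^3 \<Rightarrow> real" and \<beta> \<nu> :: real
  assumes "C1_on UNIV H"
    and "C1_on_unit_sphere A"
    and "\<beta> > 0" and "\<nu> > 0"
    and "(\<lambda>X. H X - (1 + A (X /\<^sub>R norm X) / norm X powr \<beta>))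
           \<in> O[at_infinity](\<lambda>X. 1 / norm X powr (\<beta> + \<nu>))"
    and "A (axis 2 1) \<noteq> 0"
    and "Limsup at_infinity (\<lambda>X. ereal (norm X powr (\<beta> + 1) * norm (grad H X))) < \<infinity>"
  shows "\<not> (\<exists>(\<alpha>::real) (a :: nat \<Rightarrow> real) (n :: nat \<Rightarrow> nat) (\<phi> :: nat \<Rightarrow> real \<times> real \<Rightarrow> real).
      0 < \<alpha> \<and> \<alpha> \<le> 1 \<and>
      (\<forall>k. a k \<ge> - 1/2 \<and> a k \<noteq> 0) \<and>
      (\<forall>k. 0 < n k) \<and>
      (\<forall>k. C2_holder_plane \<alpha> (\<phi> k)) \<and>
      a \<longlonglongrightarrow> 0 \<and> filterlim n at_top sequentially \<and>
      (\<forall>k t \<theta>. \<phi> k (t + 2 * real (n k) * del_\<tau> (a k), \<theta>) = \<phi> k (t, \<theta>) \<and>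
                \<phi> k (t, \<theta> + 2 * pi) = \<phi> k (t, \<theta>)) \<and>
      (\<exists>R>0. \<forall>k.
         weighted_C2_norm (n k) (a k) (\<phi> k) \<le> ereal (R / real (n k) powr \<beta>) \<and>
         holder_const \<alpha> (torus_K (n k) (a k)) (hess_plane (\<phi> k)) \<le> ereal (R / real (n k) powr \<beta>)) \<and>
      (\<forall>k. has_mean_curvature
             (\<lambda>p. torus_X (n k) (a k) p + \<phi> k p *\<^sub>R torus_N (n k) (a k) p) H))"
proof (rule ccontr)
  assume "\<not> ?thesis"
  then obtain \<alpha> :: real and a n \<phi> R where
    a: "\<And>k. a k \<noteq> 0" and C2: "\<And>k. C2_plane (\<phi> k)"
    and a_lim: "a \<longlonglongrightarrow> 0" and n_lim: "filterlim n at_top sequentially"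
    and per: "\<And>k t \<theta>. \<phi> k (t, \<theta> + 2 * pi) = \<phi> k (t, \<theta>)"
    and R: "R > 0" and wn: "\<And>k. weighted_C2_norm (n k) (a k) (\<phi> k) \<le> ereal (R / real (n k) powr \<beta>)"
    and Hc: "\<And>k. has_mean_curvature (\<lambda>p. torus_X (n k) (a k) p + \<phi> k p *\<^sub>R torus_N (n k) (a k) p) H"
    unfolding C2_holder_plane_def by blast
  let ?l = "A (axis 2 1)"
  \<comment> \<open>How many initial terms must be dropped depends on \<open>T\<close>, so each
    \<open>T\<close> gets its own shifted sequence; the constants in the inequality are the same for
    all of them, which permits \<open>T\<close> to grow afterwards.\<close>
  have key: "\<beta> \<le> 1 \<and> \<bar>?l\<bar> * (1/2) powr \<beta> * tanh T \<le> 200000 * R * (1 + T) / cosh T" if T: "T \<ge> 1" for T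
  proof -
    have "\<forall>\<^sub>F k in sequentially. \<bar>a k\<bar> \<le> 1/1000"
      using tendstoD[OF a_lim, of "1/1000"] by (auto simp: dist_real_def elim: eventually_mono)
    moreover have "\<forall>\<^sub>F k in sequentially. nat \<lceil>T\<rceil> + 100 \<le> n k"
      using n_lim unfolding filterlim_at_top by blast
    ultimately have "\<forall>\<^sub>F k in sequentially. \<bar>a k\<bar> \<le> 1/1000 \<and> nat \<lceil>T\<rceil> + 100 \<le> n k"
      by (rule eventually_conj)
    then obtain k0 where k0: "\<And>k. k \<ge> k0 \<Longrightarrow> \<bar>a k\<bar> \<le> 1/1000 \<and> nat \<lceil>T\<rceil> + 100 \<le> n k"
      unfolding eventually_sequentially by blast
    define b m \<psi> where "b = (\<lambda>k. a (k + k0))" and "m = (\<lambda>k. n (k + k0))" and "\<psi> = (\<lambda>k. \<phi> (k + k0))"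
    have bm: "\<bar>b k\<bar> \<le> 1/1000" "100 \<le> m k" "T \<le> real (m k)" for k
      using k0[of "k + k0", OF le_add2] unfolding b_def m_def by linarith+
    have tor: "torus (b k) (m k) (\<psi> k)" for k
    proof
      show "b k > - 1/2" "b k \<noteq> 0" using bm(1)[of k] a by (auto simp: b_def)
    qed (use bm C2 in \<open>auto simp: \<psi>_def\<close>)
    then have ts: "del_small (b k)" for k by (rule torus.axioms(1))
    interpret torus_seq b m \<psi> \<beta> R T
    proof (rule torus_seq.intro)
      show "b \<longlonglongrightarrow> 0" unfolding b_def by (rule LIMSEQ_ignore_initial_segment[OF a_lim])
      show "filterlim m at_top sequentially" unfolding m_def
        by (rule filterlim_compose[OF n_lim filterlim_add_const_nat_at_top])
      fix k t \<theta> g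
      assume t: "\<bar>t\<bar> \<le> T" "\<bar>\<theta>\<bar> \<le> pi"
        and g: "g \<in> {\<psi> k, d_t (\<psi> k), d_\<theta> (\<psi> k), d_t (d_t (\<psi> k)), d_\<theta> (d_t (\<psi> k)), d_\<theta> (d_\<theta> (\<psi> k))}"
      have "1 * T \<le> del_\<tau> (b k) * real (m k)"
        using del_small.tau_ge_1[OF ts, of k] bm(3)[of k] T by (intro mult_mono) auto
      then have "(t, \<theta>) \<in> torus_K (m k) (b k)" using t by (auto simp: torus_K_def mult.commute abs_le_iff)
      moreover have "weighted_C2_norm (m k) (b k) (\<psi> k) \<le> ereal (R * real (m k) powr - \<beta>)"
        using wn[of "k + k0"] by (simp add: b_def m_def \<psi>_def powr_minus_divide)
      moreover have "del_x (b k) (fst (t, \<theta>)) > 0"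
        using del_param.x_pos[OF del_small.axioms(1)[OF ts]] by simp
      ultimately show "\<bar>g (t, \<theta>)\<bar> \<le> R * real (m k) powr - \<beta> * del_x (b k) t"
        using weighted_C2_norm_bound[OF _ _ _ g] by fastforce
    qed (use assms R T bm tor in auto)
    have Hc': "has_mean_curvature (\<lambda>p. torus_X (m k) (b k) p + \<psi> k p *\<^sub>R torus_N (m k) (b k) p) H" for k
      using Hc by (simp add: m_def b_def \<psi>_def)
    have per': "\<psi> k (t, \<theta> + 2 * pi) = \<psi> k (t, \<theta>)" for k t \<theta>
      using per by (simp add: \<psi>_def)
    note lim = H_lim[OF assms(2,4,5)]
    have "\<beta> \<le> 1" by (rule beta_not_gt_one[OF Hc' lim])
    then show ?thesis using key_inequality[OF Hc' lim per'] by blast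
  qed
  \<comment> \<open>A lower bound for the left side of the inequality that is valid for every T
    \<ge> 1, as tanh increases.\<close>
  define c where "c = \<bar>?l\<bar> * (1/2) powr \<beta> * tanh 1"
  have c: "c > 0" using assms(6) by (simp add: c_def)
  \<comment> \<open>Large enough that 1600000 R / (1 + T) falls below \<open>c\<close>; 1600000 is
    200000 times the 8 of the quadratic bound for cosh.\<close>
  define T where "T = 1 + 1600000 * R / c"
  have T: "T \<ge> 1" using R c by (simp add: T_def)
  have "c \<le> \<bar>?l\<bar> * (1/2) powr \<beta> * tanh T"
    unfolding c_def using T by (intro mult_left_mono) auto
  also have "\<dots> \<le> 200000 * R * (1 + T) / cosh T" using key[OF T] by blast
  also have "\<dots> \<le> 200000 * R * (1 + T) / ((1 + T)\<^sup>2 / 8)"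
    using cosh_real_ge_quadratic[of T] T R by (intro divide_left_mono) auto
  also have "\<dots> = 1600000 * R / (1 + T)"
  proof -
    have "200000 * R * s / (s\<^sup>2 / 8) = 1600000 * R / s" for s by (simp add: power2_eq_square)
    then show ?thesis .
  qed
  also have "\<dots> < c"
  proof -
    have "1600000 * R < c * (1 + T)" using c R by (simp add: T_def field_simps)
    then show ?thesis using T by (simp add: field_simps)
  qed
  finally show False by simp
qed

end
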